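(* Let $r\in\{0,1\}$, let $(M,g)$ be a three-dimensional pseudo-Riemannian spin manifold of signature $(r,3-r)$ with principal spin bundle $\pi\colon P\to M$, and let $c>0$. For each $\epsilon\in\mathcal E_r$ there is a one-to-one correspondence between $\epsilon$-unit generalized Killing spinors on $(M,g)$ and Lagrangian sections of the almost pseudo-Hermitian structure $(\mathcal G_c,\mathcal J_c)$ on the total space of $\pi\colon P\to M$. Thus, in the Lorentzian case ($r=1$), the correspondence is two-to-one if spacelike ($\epsilon=+1$) and timelike ($\epsilon=-1$) spinors are considered together.
   Context: Algebra. $r=0$ is the Riemannian and $r=1$ the Lorentzian case. $\mathfrak m=(\mathbb R^{r,3-r},\langle\cdot,\cdot\rangle)$ is oriented with oriented orthonormal basis $X_0,X_1,X_2$, $\langle X_0,X_0\rangle=(-1)^r$, $\langle X_1,X_1\rangle=\langle X_2,X_2\rangle=1$; the cross product is defined by $\langle X\times Y,Z\rangle=\mathrm{vol}(X,Y,Z)$, $\mathrm{vol}(X_0,X_1,X_2)=1$. $H=\mathrm{SU}(2)$ if $r=0$, $H=\mathrm{SU}(1,1)$ if $r=1$, with Lie algebra $\mathfrak h$. Put $\gamma_1=\begin{pmatrix}0&1\\-1&0\end{pmatrix}$, $\gamma_2=\begin{pmatrix}0&\sqrt{-1}\\ \sqrt{-1}&0\end{pmatrix}$, and $\gamma_0=\mathrm{diag}(\sqrt{-1},-\sqrt{-1})$ if $r=0$, $\gamma_0=\mathrm{diag}(1,-1)$ if $r=1$; $\gamma\colon\mathfrak m\to\mathfrak{gl}(2,\mathbb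 C)$ is linear with $\gamma(X_k)=\gamma_k$. $\lambda\colon H\to \mathrm{SO}_0(\mathfrak m)$ is the double covering with $\gamma(\lambda(h)X)=h\gamma(X)h^{-1}$, and $\lambda_*$ is its differential. $l_g\colon\mathfrak m\to\mathfrak h$ is the linear isomorphism with $\lambda_*(l_g(X))Y=X\times Y$ (explicitly $l_g(X)=\frac{(\sqrt{-1})^r}{2}\gamma(X)$). Spin geometry. A spin structure is a principal $H$-bundle $\pi\colon P\to M$ (the principal spin bundle) with a $\lambda$-equivariant double covering $\Lambda$ from $P$ onto the bundle of oriented (and, if $r=1$, time-oriented) orthonormal frames of $(M,g)$. For $u\in P$, $X\in\mathfrak m$, $[u,X]\in T_{\pi(u)}M$ is the image of $X$ under the frame $\Lambda(u)$, so $TM=P\times_\lambda\mathfrak m$. $\theta\in\Omega^1(P;\mathfrak m)$ is the solder form ($d\pi(\xi)=[u,\theta(\xi)]$ for $\xi\in T_uP$) and $\widetilde\omega\in\Omega^1(P;\mathfrak h)$ the spin Levi-Civita connection form. For $X\in\mathfrak m$, $X^H$ is the vector field on $P$ with $\theta(X^H)=X$, $\widetilde\omega(X^H)=0$; for $U\in\mathfrak h$, $U^\#$ is the fundamental vector field ($\widetilde\omega(U^\#)=U$, $\theta(U^\#)=0$). Almost pseudo-Hermitian structure on $P$. For $c>0$: $\mathcal J_c(X^H_u+U^\#_u)=-c^{-1}(l_g^{-1}U)^H_u+c(l_gX)^\#_u$ and $\mathcal G_c(X^H_u+U^\#_u,Y^H_u+V^\#_u)=c\langle X,Y\rangle+c^{-1}\langle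 l_g^{-1}U,l_g^{-1}V\rangle$. The fundamental two-form is $\Omega=\mathcal G_c(\mathcal J_c\cdot,\cdot)$, i.e. $\Omega(X^H+U^\#,Y^H+V^\#)=\langle X,l_g^{-1}V\rangle-\langle l_g^{-1}U,Y\rangle$, which is independent of $c$. A (global) section $s$ of $P$ is Lagrangian if $s^*\Omega=0$. Spinors. $\Sigma M=P\times_H\mathbb C^2$ (defining representation of $H$); for $v\in\mathbb C^2$, Clifford multiplication is $[u,X]\cdot[u,v]=[u,\gamma(X)v]$; the Hermitian form is $\langle\psi,\phi\rangle=\psi^\dagger(\gamma_0)^r\phi$; the spin Levi-Civita connection is $\nabla_{\mathcal X}[s,v]=[s,dv(\mathcal X)+(s^*\widetilde\omega)(\mathcal X)v]$ for a local section $s$ of $P$ and a $\mathbb C^2$-valued function $v$. $\mathcal E_0=\{+1\}$, $\mathcal E_1=\{+1,-1\}$. For $\epsilon\in\mathcal E_r$, $\psi\in\Gamma(\Sigma M)$ is an $\epsilon$-unit spinor if $\langle\psi,\psi\rangle=\epsilon$; for $r=1$ it is called spacelike if $\epsilon=+1$ and timelike if $\epsilon=-1$. Such $\psi$ has a unique real $(1,1)$-tensor field $A$ with $\nabla_{\mathcal X}\psi=(\sqrt{-1})^rA(\mathcal X)\cdot\psi$ for all vector fields $\mathcal X$; $\psi$ is a generalized Killing spinor if $A$ is symmetric with respect to $g$. *)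

theory Defs
  imports "HOL-Analysis.Analysis"
begin

section \<open>Smooth maps between subsets of Euclidean spaces\<close>

primrec Ck_on :: "nat \<Rightarrow> 'a::real_normed_vector set \<Rightarrow> ('a \<Rightarrow> 'b::real_normed_vector) \<Rightarrow> bool" where
  "Ck_on 0 W f \<longleftrightarrow> continuous_on W f"
| "Ck_on (Suc k) W f \<longleftrightarrow>
     f differentiable_on W \<and> (\<forall>v. Ck_on k W (\<lambda>x. frechet_derivative f (at x) v))"

text \<open>Smoothness on an arbitrary subset means having local smooth extensions. For an open set this
  is ordinary smoothness; for an embedded submanifold, such as a matrix group, it is smoothness
  with respect to the submanifold structure.\<close>

definition smooth_on :: "'a::real_normed_vector set \<Rightarrow> ('a \<Rightarrow> 'b::real_normed_vector) \<Rightarrow> bool" where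
  "smooth_on S f \<longleftrightarrow>
     (\<forall>x\<in>S. \<exists>W F. open W \<and> x \<in> W \<and> (\<forall>k. Ck_on k W F) \<and> (\<forall>y\<in>W \<inter> S. F y = f y))"


section \<open>Manifolds, tangent vectors and differentials\<close>

type_synonym ('a, 'e) chart = "'a set \<times> ('a \<Rightarrow> 'e)"
type_synonym ('a, 'e) atlas = "('a, 'e) chart set"

definition cinv :: "('a, 'e) chart \<Rightarrow> 'e \<Rightarrow> 'a" where
  "cinv c = inv_into (fst c) (snd c)"

definition smooth_atlas :: "('a::topological_space, 'e::euclidean_space) atlas \<Rightarrow> bool" where
  "smooth_atlas A \<longleftrightarrow>
     (\<Union>c\<in>A. fst c) = UNIV \<and>
     (\<forall>c\<in>A. open (fst c) \<and> open (snd c ` fst c) \<and>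
            homeomorphism (fst c) (snd c ` fst c) (snd c) (cinv c)) \<and>
     (\<forall>c\<in>A. \<forall>d\<in>A. smooth_on (snd c ` (fst c \<inter> fst d)) (snd d \<circ> cinv c))"

text \<open>Besides smooth atlases in the sense above, the following notions are also used for families
  of "charts" whose images are not open but are embedded submanifolds of a Euclidean space (the group
  \<open>H\<close> inside the matrices, products with \<open>H\<close>, bundles of orthonormal frames). The topology is
  the one given by the charts.\<close>

definition atlas_open :: "('a, 'e::euclidean_space) atlas \<Rightarrow> 'a set \<Rightarrow> 'a set \<Rightarrow> bool" where
  "atlas_open A S V \<longleftrightarrow> V \<subseteq> S \<and>
     (\<forall>c\<in>A. openin (top_of_set (snd c ` (S \<inter> fst c))) (snd c ` (V \<inter> fst c)))"

definition smooth_map ::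
  "('a, 'e::euclidean_space) atlas \<Rightarrow> 'a set \<Rightarrow> ('b, 'f::euclidean_space) atlas \<Rightarrow> ('a \<Rightarrow> 'b) \<Rightarrow> bool"
where
  "smooth_map A S B f \<longleftrightarrow>
     f ` S \<subseteq> (\<Union>d\<in>B. fst d) \<and>
     (\<forall>d\<in>B. atlas_open A S {p\<in>S. f p \<in> fst d}) \<and>
     (\<forall>c\<in>A. \<forall>d\<in>B.
        smooth_on (snd c ` {p \<in> S \<inter> fst c. f p \<in> fst d}) (snd d \<circ> f \<circ> cinv c))"

definition diffeo ::
  "('a, 'e::euclidean_space) atlas \<Rightarrow> 'a set \<Rightarrow> ('b, 'f::euclidean_space) atlas \<Rightarrow> 'b set \<Rightarrow> ('a \<Rightarrow> 'b) \<Rightarrow> bool"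
where
  "diffeo A S B T f \<longleftrightarrow>
     bij_betw f S T \<and> smooth_map A S B f \<and> smooth_map B T A (inv_into S f)"

definition smooth_double_covering ::
  "('a, 'e::euclidean_space) atlas \<Rightarrow> 'a set \<Rightarrow> ('b, 'f::euclidean_space) atlas \<Rightarrow> 'b set \<Rightarrow> ('a \<Rightarrow> 'b) \<Rightarrow> bool"
where
  "smooth_double_covering A S B T f \<longleftrightarrow>
     f ` S = T \<and>
     (\<forall>q\<in>T. \<exists>V W1 W2. q \<in> V \<and> atlas_open B T V \<and>
        W1 \<inter> W2 = {} \<and> W1 \<union> W2 = {p\<in>S. f p \<in> V} \<and>
        (\<forall>W\<in>{W1, W2}. atlas_open A S W \<and> diffeo A W B V f))"

definition prod_atlas :: "('a, 'e) atlas \<Rightarrow> ('b, 'f) atlas \<Rightarrow> ('a \<times> 'b, 'e \<times> 'f) atlas" where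
  "prod_atlas A B = {(fst c \<times> fst d, map_prod (snd c) (snd d)) | c d. c \<in> A \<and> d \<in> B}"

definition euc :: "('e, 'e) atlas" where
  "euc = {(UNIV, id)}"

text \<open>The tangent space at \<open>p\<close> is the model space \<open>'e\<close> itself: a vector stands for the tangent
  vector having these components in the distinguished chart \<open>chart_at A p\<close>. The maps
  \<open>comp A c p\<close> and \<open>tvec A c p\<close> convert from tangent vectors to their components in the chart
  \<open>c\<close> and back; smoothness of tensor fields is smoothness of the components in every chart.\<close>

definition chart_at :: "('a, 'e) atlas \<Rightarrow> 'a \<Rightarrow> ('a, 'e) chart" where
  "chart_at A p = (SOME c. c \<in> A \<and> p \<in> fst c)"

definition dtrans :: "('a, 'e::euclidean_space) chart \<Rightarrow> ('a, 'e) chart \<Rightarrow> 'a \<Rightarrow> 'e \<Rightarrow> 'e" where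
  "dtrans c d p = frechet_derivative (snd d \<circ> cinv c) (at (snd c p))"

definition comp :: "('a, 'e::euclidean_space) atlas \<Rightarrow> ('a, 'e) chart \<Rightarrow> 'a \<Rightarrow> 'e \<Rightarrow> 'e" where
  "comp A c p = dtrans (chart_at A p) c p"

definition tvec :: "('a, 'e::euclidean_space) atlas \<Rightarrow> ('a, 'e) chart \<Rightarrow> 'a \<Rightarrow> 'e \<Rightarrow> 'e" where
  "tvec A c p = dtrans c (chart_at A p) p"

definition mdiff ::
  "('a, 'e::euclidean_space) atlas \<Rightarrow> ('b, 'f::euclidean_space) atlas \<Rightarrow> ('a \<Rightarrow> 'b) \<Rightarrow> 'a \<Rightarrow> 'e \<Rightarrow> 'f"
where
  "mdiff A B f p =
     frechet_derivative (snd (chart_at B (f p)) \<circ> f \<circ> cinv (chart_at A p)) (at (snd (chart_at A p) p))"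

definition smooth_vector_field :: "('a, 'e::euclidean_space) atlas \<Rightarrow> ('a \<Rightarrow> 'e) \<Rightarrow> bool" where
  "smooth_vector_field A X \<longleftrightarrow>
     (\<forall>c\<in>A. smooth_on (snd c ` fst c) (\<lambda>y. comp A c (cinv c y) (X (cinv c y))))"

definition smooth_one_form ::
  "('a, 'e::euclidean_space) atlas \<Rightarrow> ('a \<Rightarrow> 'e \<Rightarrow> 'v::real_normed_vector) \<Rightarrow> bool"
where
  "smooth_one_form A \<alpha> \<longleftrightarrow>
     (\<forall>p. linear (\<alpha> p)) \<and>
     (\<forall>c\<in>A. \<forall>w. smooth_on (snd c ` fst c) (\<lambda>y. \<alpha> (cinv c y) (tvec A c (cinv c y) w)))"

definition smooth_bilinear_field ::
  "('a, 'e::euclidean_space) atlas \<Rightarrow> ('a \<Rightarrow> 'e \<Rightarrow> 'e \<Rightarrow> real) \<Rightarrow> bool"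
where
  "smooth_bilinear_field A b \<longleftrightarrow>
     (\<forall>p. bilinear (b p)) \<and>
     (\<forall>c\<in>A. \<forall>v w. smooth_on (snd c ` fst c)
        (\<lambda>y. b (cinv c y) (tvec A c (cinv c y) v) (tvec A c (cinv c y) w)))"

definition smooth_endo_field :: "('a, 'e::euclidean_space) atlas \<Rightarrow> ('a \<Rightarrow> 'e \<Rightarrow> 'e) \<Rightarrow> bool" where
  "smooth_endo_field A E \<longleftrightarrow>
     (\<forall>p. linear (E p)) \<and>
     (\<forall>c\<in>A. \<forall>w. smooth_on (snd c ` fst c)
        (\<lambda>y. comp A c (cinv c y) (E (cinv c y) (tvec A c (cinv c y) w))))"

text \<open>Exterior derivative of a one-form, computed in the distinguished chart at \<open>p\<close>:
  \<open>d\<alpha>(\<xi>,\<eta>) = \<partial>\<^sub>\<xi>(\<alpha>(\<eta>)) - \<partial>\<^sub>\<eta>(\<alpha>(\<xi>))\<close> for the extensions of \<open>\<xi>, \<eta>\<close> with constant components.\<close>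

definition ext_d ::
  "('a, 'e::euclidean_space) atlas \<Rightarrow> ('a \<Rightarrow> 'e \<Rightarrow> 'v::real_normed_vector) \<Rightarrow> 'a \<Rightarrow> 'e \<Rightarrow> 'e \<Rightarrow> 'v"
where
  "ext_d A \<alpha> p \<xi> \<eta> =
     (let c = chart_at A p;
          a = (\<lambda>w y. \<alpha> (cinv c y) (tvec A c (cinv c y) w))
      in frechet_derivative (a \<eta>) (at (snd c p)) \<xi> - frechet_derivative (a \<xi>) (at (snd c p)) \<eta>)"


section \<open>The algebra of \<open>\<mm>\<close> and \<open>H\<close>\<close>

text \<open>\<open>\<mm>\<close> is \<open>real^3\<close> with \<open>X\<^sub>k = axis k 1\<close> for \<open>k = 0, 1, 2 :: 3\<close>. In the index type \<open>3\<close> one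
  has \<open>0 = 3\<close>, so the library's order \<open>1, 2, 3\<close> is \<open>1, 2, 0\<close>, an even permutation of \<open>0, 1, 2\<close>,
  and the library determinant is the volume form with \<open>vol(X\<^sub>0, X\<^sub>1, X\<^sub>2) = 1\<close>.\<close>

definition ip :: "nat \<Rightarrow> real^3 \<Rightarrow> real^3 \<Rightarrow> real" where
  "ip r X Y = (-1) ^ r * X$0 * Y$0 + X$1 * Y$1 + X$2 * Y$2"

definition vol :: "real^3 \<Rightarrow> real^3 \<Rightarrow> real^3 \<Rightarrow> real" where
  "vol X Y Z = det (vector [X, Y, Z] :: real^3^3)"

definition cross :: "nat \<Rightarrow> real^3 \<Rightarrow> real^3 \<Rightarrow> real^3" where
  "cross r X Y = (THE W. \<forall>Z. ip r W Z = vol X Y Z)"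

definition mat2 :: "complex \<Rightarrow> complex \<Rightarrow> complex \<Rightarrow> complex \<Rightarrow> complex^2^2" where
  "mat2 a b c d = vector [vector [a, b], vector [c, d]]"

definition gamma0 :: "nat \<Rightarrow> complex^2^2" where
  "gamma0 r = (if r = 0 then mat2 \<i> 0 0 (- \<i>) else mat2 1 0 0 (- 1))"

definition gam :: "nat \<Rightarrow> real^3 \<Rightarrow> complex^2^2" where
  "gam r X = X$0 *\<^sub>R gamma0 r + X$1 *\<^sub>R mat2 0 1 (- 1) 0 + X$2 *\<^sub>R mat2 0 \<i> \<i> 0"

definition dagger :: "complex^2^2 \<Rightarrow> complex^2^2" where
  "dagger h = (\<chi> i j. cnj (h $ j $ i))"

text \<open>\<open>(\<gamma>\<^sub>0)\<^sup>r\<close>, the Gram matrix of the invariant Hermitian form: the identity for \<open>SU(2)\<close> and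
  \<open>diag(1,-1)\<close> for \<open>SU(1,1)\<close>.\<close>

definition herm_mat :: "nat \<Rightarrow> complex^2^2" where
  "herm_mat r = (if r = 0 then mat 1 else gamma0 r)"

definition herm :: "nat \<Rightarrow> complex^2 \<Rightarrow> complex^2 \<Rightarrow> complex" where
  "herm r v w = (\<Sum>i\<in>UNIV. cnj (v $ i) * (herm_mat r *v w) $ i)"

definition H_group :: "nat \<Rightarrow> (complex^2^2) set" where
  "H_group r = {h. det h = 1 \<and> dagger h ** herm_mat r ** h = herm_mat r}"

definition H_lie :: "nat \<Rightarrow> (complex^2^2) set" where
  "H_lie r = {U. trace U = 0 \<and> dagger U ** herm_mat r + herm_mat r ** U = 0}"

definition H_atlas :: "nat \<Rightarrow> (complex^2^2, complex^2^2) atlas" where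
  "H_atlas r = {(H_group r, id)}"

definition H_curve :: "nat \<Rightarrow> (real \<Rightarrow> complex^2^2) \<Rightarrow> complex^2^2 \<Rightarrow> bool" where
  "H_curve r h U \<longleftrightarrow>
     (\<forall>t. h t \<in> H_group r) \<and> h 0 = mat 1 \<and> (h has_vector_derivative U) (at 0)"

definition lam :: "nat \<Rightarrow> complex^2^2 \<Rightarrow> real^3 \<Rightarrow> real^3" where
  "lam r h X = (THE Y. gam r Y = h ** gam r X ** matrix_inv h)"

definition lam_star :: "nat \<Rightarrow> complex^2^2 \<Rightarrow> real^3 \<Rightarrow> real^3" where
  "lam_star r U Y =
     (THE Z. \<forall>h. H_curve r h U \<longrightarrow> ((\<lambda>t. lam r (h t) Y) has_vector_derivative Z) (at 0))"

definition lg :: "nat \<Rightarrow> real^3 \<Rightarrow> complex^2^2" where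
  "lg r X = (THE U. U \<in> H_lie r \<and> (\<forall>Y. lam_star r U Y = cross r X Y))"

definition lg_inv :: "nat \<Rightarrow> complex^2^2 \<Rightarrow> real^3" where
  "lg_inv r U = (THE X. lg r X = U)"

definition signs :: "nat \<Rightarrow> real set" where
  "signs r = (if r = 0 then {1} else {1, -1})"


section \<open>Three-dimensional pseudo-Riemannian spin manifolds\<close>

text \<open>\<open>base_at\<close> and \<open>tot_at\<close> are the atlases of \<open>M\<close> and \<open>P\<close>, whose points are the elements of
  the types \<open>'m\<close> and \<open>'p\<close>. The vector field \<open>tor\<close> represents the time-orientation and is only
  relevant for \<open>r = 1\<close>. \<open>frm u\<close> is the frame \<open>\<Lambda>(u)\<close>, regarded as a linear map from \<open>\<mm>\<close> to
  \<open>T\<^bsub>\<pi>(u)\<^esub>M\<close>, so that \<open>[u,X] = frm u X\<close>.\<close>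

record ('m, 'p) spin_data =
  idx :: nat
  base_at :: "('m, real^3) atlas"
  met :: "'m \<Rightarrow> real^3 \<Rightarrow> real^3 \<Rightarrow> real"
  tor :: "'m \<Rightarrow> real^3"
  tot_at :: "('p, real^6) atlas"
  prj :: "'p \<Rightarrow> 'm"
  act :: "'p \<Rightarrow> complex^2^2 \<Rightarrow> 'p"
  frm :: "'p \<Rightarrow> real^3 \<Rightarrow> real^3"

text \<open>The orientation of \<open>M\<close> is encoded by requiring the atlas to be oriented.\<close>

definition oriented_atlas :: "('m, real^3) atlas \<Rightarrow> bool" where
  "oriented_atlas A \<longleftrightarrow>
     (\<forall>c\<in>A. \<forall>d\<in>A. \<forall>p\<in>fst c \<inter> fst d. det (matrix (dtrans c d p)) > 0)"

definition pseudo_riemannian ::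
  "('m::{t2_space, second_countable_topology}, 'p) spin_data \<Rightarrow> bool"
where
  "pseudo_riemannian S \<longleftrightarrow>
     smooth_atlas (base_at S) \<and> oriented_atlas (base_at S) \<and>
     smooth_bilinear_field (base_at S) (met S) \<and>
     (\<forall>x X Y. met S x X Y = met S x Y X) \<and>
     (\<forall>x. \<exists>f. linear f \<and> (\<forall>X Y. met S x (f X) (f Y) = ip (idx S) X Y)) \<and>
     (idx S = 1 \<longrightarrow>
        smooth_vector_field (base_at S) (tor S) \<and> (\<forall>x. met S x (tor S x) (tor S x) < 0))"

definition principal_bundle ::
  "('m::{t2_space, second_countable_topology}, 'p::{t2_space, second_countable_topology}) spin_data \<Rightarrow> bool"
where
  "principal_bundle S \<longleftrightarrow>
     smooth_atlas (tot_at S) \<and>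
     smooth_map (tot_at S) UNIV (base_at S) (prj S) \<and>
     smooth_map (prod_atlas (tot_at S) (H_atlas (idx S))) (UNIV \<times> H_group (idx S)) (tot_at S)
       (\<lambda>(u, h). act S u h) \<and>
     (\<forall>u. act S u (mat 1) = u) \<and>
     (\<forall>u. \<forall>h\<in>H_group (idx S). \<forall>k\<in>H_group (idx S). act S (act S u h) k = act S u (h ** k)) \<and>
     (\<forall>u. \<forall>h\<in>H_group (idx S). prj S (act S u h) = prj S u) \<and>
     (\<forall>x. \<exists>V \<Psi>. open V \<and> x \<in> V \<and>
        diffeo (prod_atlas (base_at S) (H_atlas (idx S))) (V \<times> H_group (idx S))
               (tot_at S) (prj S -` V) \<Psi> \<and>
        (\<forall>y\<in>V. \<forall>h\<in>H_group (idx S). prj S (\<Psi> (y, h)) = y) \<and>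
        (\<forall>y\<in>V. \<forall>h\<in>H_group (idx S). \<forall>k\<in>H_group (idx S).
           \<Psi> (y, h ** k) = act S (\<Psi> (y, h)) k))"

text \<open>Oriented (and, if \<open>r = 1\<close>, future-directed) orthonormal frames, as isometries
  \<open>\<mm> \<rightarrow> T\<^sub>xM\<close>.\<close>

definition on_frames :: "('m, 'p) spin_data \<Rightarrow> ('m \<times> (real^3 \<Rightarrow> real^3)) set" where
  "on_frames S = {(x, f). linear f \<and>
     (\<forall>X Y. met S x (f X) (f Y) = ip (idx S) X Y) \<and>
     det (matrix f) > 0 \<and>
     (idx S = 1 \<longrightarrow> met S x (f (axis 0 1)) (tor S x) < 0)}"

definition frame_atlas ::
  "('m, real^3) atlas \<Rightarrow> ('m \<times> (real^3 \<Rightarrow> real^3), (real^3) \<times> (real^3^3)) atlas"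
where
  "frame_atlas A = {(fst c \<times> {f. linear f}, \<lambda>(x, f). (snd c x, matrix (comp A c x \<circ> f))) | c. c \<in> A}"

definition spin_structure ::
  "('m::{t2_space, second_countable_topology}, 'p::{t2_space, second_countable_topology}) spin_data \<Rightarrow> bool"
where
  "spin_structure S \<longleftrightarrow>
     pseudo_riemannian S \<and> principal_bundle S \<and>
     smooth_double_covering (tot_at S) UNIV (frame_atlas (base_at S)) (on_frames S)
       (\<lambda>u. (prj S u, frm S u)) \<and>
     (\<forall>u. \<forall>h\<in>H_group (idx S). frm S (act S u h) = frm S u \<circ> lam (idx S) h)"

definition solder :: "('m, 'p) spin_data \<Rightarrow> 'p \<Rightarrow> real^6 \<Rightarrow> real^3" where
  "solder S u \<xi> = (THE X. mdiff (tot_at S) (base_at S) (prj S) u \<xi> = frm S u X)"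

text \<open>The spin Levi-Civita connection form: the unique connection one-form on \<open>P\<close> which is
  torsion-free, i.e. \<open>d\<theta> + \<lambda>\<^sub>*(\<omega>) \<and> \<theta> = 0\<close>. (Metricity is built in, as \<open>\<omega>\<close> has values in the
  Lie algebra of \<open>H\<close>.)\<close>

definition connection_form ::
  "('m, 'p) spin_data \<Rightarrow> ('p \<Rightarrow> real^6 \<Rightarrow> complex^2^2) \<Rightarrow> bool"
where
  "connection_form S \<omega> \<longleftrightarrow>
     smooth_one_form (tot_at S) \<omega> \<and>
     (\<forall>u \<xi>. \<omega> u \<xi> \<in> H_lie (idx S)) \<and>
     (\<forall>u \<xi>. \<forall>h\<in>H_group (idx S).
        \<omega> (act S u h) (mdiff (tot_at S) (tot_at S) (\<lambda>u. act S u h) u \<xi>)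
          = matrix_inv h ** \<omega> u \<xi> ** h) \<and>
     (\<forall>u h U. H_curve (idx S) h U \<longrightarrow>
        \<omega> u (mdiff euc (tot_at S) (\<lambda>t::real. act S u (h t)) 0 1) = U)"

definition spin_levi_civita ::
  "('m, 'p) spin_data \<Rightarrow> ('p \<Rightarrow> real^6 \<Rightarrow> complex^2^2) \<Rightarrow> bool"
where
  "spin_levi_civita S \<omega> \<longleftrightarrow>
     connection_form S \<omega> \<and>
     (\<forall>u \<xi> \<eta>. ext_d (tot_at S) (solder S) u \<xi> \<eta>
        + lam_star (idx S) (\<omega> u \<xi>) (solder S u \<eta>)
        - lam_star (idx S) (\<omega> u \<eta>) (solder S u \<xi>) = 0)"


section \<open>The almost pseudo-Hermitian structure on \<open>P\<close>\<close>

definition horiz ::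
  "('m, 'p) spin_data \<Rightarrow> ('p \<Rightarrow> real^6 \<Rightarrow> complex^2^2) \<Rightarrow> 'p \<Rightarrow> real^3 \<Rightarrow> real^6"
where
  "horiz S \<omega> u X = (THE \<xi>. solder S u \<xi> = X \<and> \<omega> u \<xi> = 0)"

definition fund ::
  "('m, 'p) spin_data \<Rightarrow> ('p \<Rightarrow> real^6 \<Rightarrow> complex^2^2) \<Rightarrow> 'p \<Rightarrow> complex^2^2 \<Rightarrow> real^6"
where
  "fund S \<omega> u U = (THE \<xi>. solder S u \<xi> = 0 \<and> \<omega> u \<xi> = U)"

text \<open>A tangent vector \<open>\<xi>\<close> of \<open>P\<close> is \<open>X\<^sup>H + U\<^sup>#\<close> with \<open>X = \<theta>(\<xi>)\<close> and \<open>U = \<omega>(\<xi>)\<close>.\<close>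

definition J_str ::
  "('m, 'p) spin_data \<Rightarrow> ('p \<Rightarrow> real^6 \<Rightarrow> complex^2^2) \<Rightarrow> real \<Rightarrow> 'p \<Rightarrow> real^6 \<Rightarrow> real^6"
where
  "J_str S \<omega> c u \<xi> =
     - (inverse c *\<^sub>R horiz S \<omega> u (lg_inv (idx S) (\<omega> u \<xi>)))
     + c *\<^sub>R fund S \<omega> u (lg (idx S) (solder S u \<xi>))"

definition G_str ::
  "('m, 'p) spin_data \<Rightarrow> ('p \<Rightarrow> real^6 \<Rightarrow> complex^2^2) \<Rightarrow> real \<Rightarrow> 'p \<Rightarrow> real^6 \<Rightarrow> real^6 \<Rightarrow> real"
where
  "G_str S \<omega> c u \<xi> \<eta> =
     c * ip (idx S) (solder S u \<xi>) (solder S u \<eta>)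
     + inverse c * ip (idx S) (lg_inv (idx S) (\<omega> u \<xi>)) (lg_inv (idx S) (\<omega> u \<eta>))"

definition fund_form ::
  "('m, 'p) spin_data \<Rightarrow> ('p \<Rightarrow> real^6 \<Rightarrow> complex^2^2) \<Rightarrow> real \<Rightarrow> 'p \<Rightarrow> real^6 \<Rightarrow> real^6 \<Rightarrow> real"
where
  "fund_form S \<omega> c u \<xi> \<eta> = G_str S \<omega> c u (J_str S \<omega> c u \<xi>) \<eta>"

definition local_section ::
  "('m::topological_space, 'p) spin_data \<Rightarrow> 'm set \<Rightarrow> ('m \<Rightarrow> 'p) \<Rightarrow> bool"
where
  "local_section S V s \<longleftrightarrow>
     open V \<and> (\<forall>x\<in>V. prj S (s x) = x) \<and> smooth_map (base_at S) V (tot_at S) s"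

definition lagrangian_sections ::
  "('m::topological_space, 'p) spin_data \<Rightarrow> ('p \<Rightarrow> real^6 \<Rightarrow> complex^2^2) \<Rightarrow> real \<Rightarrow> ('m \<Rightarrow> 'p) set"
where
  "lagrangian_sections S \<omega> c =
     {s. local_section S UNIV s \<and>
         (\<forall>x X Y. fund_form S \<omega> c (s x)
            (mdiff (base_at S) (tot_at S) s x X) (mdiff (base_at S) (tot_at S) s x Y) = 0)}"


section \<open>Spinors and generalized Killing spinors\<close>

text \<open>The class \<open>[u,v]\<close> in \<open>\<Sigma>M = P \<times>\<^sub>H \<complex>\<^sup>2\<close>, as a set of pairs \<open>(uh, h\<^sup>-\<^sup>1v)\<close>.\<close>

definition sp_class ::
  "('m, 'p) spin_data \<Rightarrow> 'p \<Rightarrow> complex^2 \<Rightarrow> ('p \<times> (complex^2)) set"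
where
  "sp_class S u v = {(act S u h, matrix_inv h *v v) | h. h \<in> H_group (idx S)}"

definition sp_scale :: "complex \<Rightarrow> ('p \<times> (complex^2)) set \<Rightarrow> ('p \<times> (complex^2)) set" where
  "sp_scale z a = (\<lambda>(u, v). (u, z *s v)) ` a"

definition clifford ::
  "('m, 'p) spin_data \<Rightarrow> real^3 \<Rightarrow> ('p \<times> (complex^2)) set \<Rightarrow> ('p \<times> (complex^2)) set"
where
  "clifford S X a =
     (THE b. \<exists>u Y v. (u, v) \<in> a \<and> frm S u Y = X \<and> b = sp_class S u (gam (idx S) Y *v v))"

definition sp_herm ::
  "('m, 'p) spin_data \<Rightarrow> ('p \<times> (complex^2)) set \<Rightarrow> ('p \<times> (complex^2)) set \<Rightarrow> complex"
where
  "sp_herm S a b = (THE z. \<exists>u v w. (u, v) \<in> a \<and> (u, w) \<in> b \<and> z = herm (idx S) v w)"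

definition represents ::
  "('m::topological_space, 'p) spin_data \<Rightarrow> ('m \<Rightarrow> ('p \<times> (complex^2)) set)
     \<Rightarrow> 'm set \<Rightarrow> ('m \<Rightarrow> 'p) \<Rightarrow> ('m \<Rightarrow> complex^2) \<Rightarrow> bool"
where
  "represents S \<psi> V s v \<longleftrightarrow>
     local_section S V s \<and> smooth_map (base_at S) V euc v \<and>
     (\<forall>x\<in>V. \<psi> x = sp_class S (s x) (v x))"

definition spinor_field ::
  "('m::topological_space, 'p) spin_data \<Rightarrow> ('m \<Rightarrow> ('p \<times> (complex^2)) set) \<Rightarrow> bool"
where
  "spinor_field S \<psi> \<longleftrightarrow> (\<forall>x. \<exists>V s v. x \<in> V \<and> represents S \<psi> V s v)"

definition cov_deriv ::
  "('m::topological_space, 'p) spin_data \<Rightarrow> ('p \<Rightarrow> real^6 \<Rightarrow> complex^2^2)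
     \<Rightarrow> ('m \<Rightarrow> ('p \<times> (complex^2)) set) \<Rightarrow> 'm \<Rightarrow> real^3 \<Rightarrow> ('p \<times> (complex^2)) set"
where
  "cov_deriv S \<omega> \<psi> x X =
     (THE b. \<exists>V s v. x \<in> V \<and> represents S \<psi> V s v \<and>
        b = sp_class S (s x)
              (mdiff (base_at S) euc v x X
               + \<omega> (s x) (mdiff (base_at S) (tot_at S) s x X) *v v x))"

definition unit_spinor ::
  "('m::topological_space, 'p) spin_data \<Rightarrow> real \<Rightarrow> ('m \<Rightarrow> ('p \<times> (complex^2)) set) \<Rightarrow> bool"
where
  "unit_spinor S \<epsilon> \<psi> \<longleftrightarrow>
     spinor_field S \<psi> \<and> (\<forall>x. sp_herm S (\<psi> x) (\<psi> x) = complex_of_real \<epsilon>)"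

definition gen_killing ::
  "('m::topological_space, 'p) spin_data \<Rightarrow> ('p \<Rightarrow> real^6 \<Rightarrow> complex^2^2) \<Rightarrow> real
     \<Rightarrow> ('m \<Rightarrow> ('p \<times> (complex^2)) set) set"
where
  "gen_killing S \<omega> \<epsilon> =
     {\<psi>. unit_spinor S \<epsilon> \<psi> \<and>
         (\<exists>A. smooth_endo_field (base_at S) A \<and>
            (\<forall>x X. cov_deriv S \<omega> \<psi> x X = sp_scale (\<i> ^ idx S) (clifford S (A x X) (\<psi> x))) \<and>
            (\<forall>x X Y. met S x (A x X) Y = met S x X (A x Y)))}"

end

theory Submission
  imports Defs
begin

text \<open>Fix a vector \<open>v\<^sub>\<epsilon>\<close> with \<open>\<langle>v\<^sub>\<epsilon>, v\<^sub>\<epsilon>\<rangle> = \<epsilon>\<close>. Since \<open>H\<close> acts simply transitively on the vectors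
  of square \<open>\<epsilon>\<close>, every \<open>\<epsilon>\<close>-unit spinor is \<open>\<psi> = [s, v\<^sub>\<epsilon>]\<close> for a unique global section \<open>s\<close> of \<open>P\<close>; the
  section is smooth because the element of \<open>H\<close> taking \<open>v\<^sub>\<epsilon>\<close> to \<open>v\<close> depends real-linearly on \<open>v\<close>.
  Then \<open>\<nabla>\<^sub>X\<psi> = [s, \<omega>(ds X) v\<^sub>\<epsilon>]\<close>, and as an element of \<open>\<hh>\<close> is determined by its value on \<open>v\<^sub>\<epsilon>\<close>,
  the endomorphism field of \<open>\<psi>\<close> is \<open>A X = [s, l\<^sub>g\<^sup>-\<^sup>1(\<omega>(ds X)) / 2]\<close>. Because \<open>\<theta>(ds X)\<close> represents \<open>X\<close>
  in the frame \<open>s\<close>, symmetry of \<open>A\<close> is literally the vanishing of \<open>s\<^sup>*\<Omega>\<close>.\<close>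

section \<open>Calculus of smooth maps\<close>

text \<open>The constant 1/2 comes from \<open>\<i> ^ r * gamma(X) = 2 * l_g(X)\<close>: the factor
  \<open>\<i> ^ r\<close> in the Killing equation turns Clifford multiplication by X into the action
  of the Lie algebra element \<open>2 * l_g(X)\<close>, so both sides of the equation are Lie
  algebra elements applied to \<open>v\<^sub>\<epsilon>\<close> and can be compared. Two obstacles
  shape the rest. The group \<open>H\<close> is not open among the matrices, so smoothness on it
  only yields local extensions; the action on P is therefore differentiated through an ambient map
  \<open>G\<close> that agrees with it where the group argument lies in \<open>H\<close>. Moreover,
  most objects are definite descriptions, and each formula for one of them rests on unique
  existence: \<open>lam_star\<close> needs a curve in \<open>H\<close> for every velocity,
  \<open>horiz\<close> and \<open>fund\<close> need the splitting of the tangent spaces of P by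
  (\<theta>, \<omega>), and \<open>cov_deriv\<close> needs independence of the representation of the
  spinor.\<close>

lemma Ck_on_subset: "Ck_on k W f \<Longrightarrow> W' \<subseteq> W \<Longrightarrow> Ck_on k W' f"
  by (induction k arbitrary: f) (auto intro: continuous_on_subset differentiable_on_subset)

lemma Ck_on_cong:
  assumes "open W" "\<And>x. x \<in> W \<Longrightarrow> f x = g x" "Ck_on k W f"
  shows "Ck_on k W g"
  using assms(2,3)
proof (induction k arbitrary: f g)
  case 0
  then show ?case using continuous_on_cong by auto
next
  case (Suc k)
  have d: "f differentiable at x" if "x \<in> W" for x
    using Suc.prems(2) that assms(1) by (auto simp: differentiable_on_eq_differentiable_at)
  have eq: "(g has_derivative frechet_derivative f (at x)) (at x)" if "x \<in> W" for x
    using d[OF that] that Suc.prems(1) assms(1) frechet_derivative_works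
    by (metis has_derivative_transform_within_open)
  have "g differentiable_on W"
    using eq assms(1) by (auto simp: differentiable_on_eq_differentiable_at differentiable_def)
  moreover have "Ck_on k W (\<lambda>x. frechet_derivative g (at x) v)" for v
    using Suc.IH[of "\<lambda>x. frechet_derivative f (at x) v" "\<lambda>x. frechet_derivative g (at x) v"]
      Suc.prems(2) frechet_derivative_at[OF eq] by simp
  ultimately show ?case by simp
qed

text \<open>Any derivative \<open>D\<close> may serve in place of the chosen
  \<open>frechet_derivative\<close>. The closure properties below are inductions on \<open>k\<close>
  that exhibit such a \<open>D\<close> by a differentiation rule.\<close>

lemma Ck_on_Suc_iff:
  assumes "open W"
  shows "Ck_on (Suc k) W f \<longleftrightarrow>
    (\<exists>D. (\<forall>x\<in>W. (f has_derivative D x) (at x)) \<and> (\<forall>v. Ck_on k W (\<lambda>x. D x v)))" (is "?L = ?R")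
proof
  assume ?L
  then show ?R using assms frechet_derivative_works
    by (intro exI[of _ "\<lambda>x. frechet_derivative f (at x)"])
       (auto simp: differentiable_on_eq_differentiable_at)
next
  assume ?R
  then obtain D where D: "\<And>x. x \<in> W \<Longrightarrow> (f has_derivative D x) (at x)"
    and C: "\<And>v. Ck_on k W (\<lambda>x. D x v)" by blast
  have "Ck_on k W (\<lambda>x. frechet_derivative f (at x) v)" for v
    by (rule Ck_on_cong[OF assms _ C]) (use frechet_derivative_at[OF D] in auto)
  then show ?L using D assms
    by (auto simp: differentiable_on_eq_differentiable_at differentiable_def)
qed

lemma Ck_on_imp_continuous_on: "Ck_on k W f \<Longrightarrow> continuous_on W f"
  by (cases k) (auto intro: differentiable_imp_continuous_on)

lemma Ck_on_SucD: "Ck_on (Suc k) W f \<Longrightarrow> Ck_on k W f"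
proof (induction k arbitrary: f)
  case 0
  then show ?case using differentiable_imp_continuous_on by auto
next
  case (Suc k)
  then show ?case by (metis Ck_on.simps(2))
qed

section \<open>Closure properties of maps of class C^k\<close>

lemma Ck_on_const: "open W \<Longrightarrow> Ck_on k W (\<lambda>x. a)"
proof (induction k arbitrary: a)
  case (Suc k)
  then show ?case
    unfolding Ck_on_Suc_iff[OF Suc.prems] by (intro exI[of _ "\<lambda>x v. 0"]) auto
qed auto

lemma Ck_on_add:
  assumes "open W"
  shows "Ck_on k W f \<Longrightarrow> Ck_on k W g \<Longrightarrow> Ck_on k W (\<lambda>x. f x + g x)"
proof (induction k arbitrary: f g)
  case 0
  then show ?case by (auto intro: continuous_on_add)
next
  case (Suc k)
  from Suc.prems[unfolded Ck_on_Suc_iff[OF assms]] obtain D E where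
    "\<And>x. x \<in> W \<Longrightarrow> (f has_derivative D x) (at x)" "\<And>v. Ck_on k W (\<lambda>x. D x v)"
    "\<And>x. x \<in> W \<Longrightarrow> (g has_derivative E x) (at x)" "\<And>v. Ck_on k W (\<lambda>x. E x v)" by blast
  then show ?case unfolding Ck_on_Suc_iff[OF assms]
    by (intro exI[of _ "\<lambda>x v. D x v + E x v"]) (auto intro: has_derivative_add Suc.IH)
qed

lemma Ck_on_sum:
  assumes "open W" "\<And>i. i \<in> I \<Longrightarrow> Ck_on k W (f i)"
  shows "Ck_on k W (\<lambda>x. \<Sum>i\<in>I. f i x)"
  using assms(2)
  by (induction I rule: infinite_finite_induct) (auto intro: Ck_on_const Ck_on_add assms(1))

lemma Ck_on_bounded_linear:
  assumes "open W" "bounded_linear L"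
  shows "Ck_on k W f \<Longrightarrow> Ck_on k W (\<lambda>x. L (f x))"
proof (induction k arbitrary: f)
  case 0
  then show ?case using bounded_linear.continuous_on[OF assms(2)] by auto
next
  case (Suc k)
  from Suc.prems[unfolded Ck_on_Suc_iff[OF assms(1)]] obtain D where
    "\<And>x. x \<in> W \<Longrightarrow> (f has_derivative D x) (at x)" "\<And>v. Ck_on k W (\<lambda>x. D x v)" by blast
  then show ?case unfolding Ck_on_Suc_iff[OF assms(1)]
    by (intro exI[of _ "\<lambda>x v. L (D x v)"])
       (auto intro: bounded_linear.has_derivative[OF assms(2)] Suc.IH)
qed

lemma Ck_on_bounded_bilinear:
  assumes "open W" "bounded_bilinear B"
  shows "Ck_on k W f \<Longrightarrow> Ck_on k W g \<Longrightarrow> Ck_on k W (\<lambda>x. B (f x) (g x))"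
proof (induction k arbitrary: f g)
  case 0
  then show ?case using bounded_bilinear.continuous_on[OF assms(2)] by auto
next
  case (Suc k)
  from Suc.prems[unfolded Ck_on_Suc_iff[OF assms(1)]] obtain D E where
    D: "\<And>x. x \<in> W \<Longrightarrow> (f has_derivative D x) (at x)" "\<And>v. Ck_on k W (\<lambda>x. D x v)" and
    E: "\<And>x. x \<in> W \<Longrightarrow> (g has_derivative E x) (at x)" "\<And>v. Ck_on k W (\<lambda>x. E x v)" by blast
  have "((\<lambda>x. B (f x) (g x)) has_derivative (\<lambda>v. B (f x) (E x v) + B (D x v) (g x))) (at x)"
    if "x \<in> W" for x
    using bounded_bilinear.FDERIV[OF assms(2) D(1)[OF that] E(1)[OF that]] .
  note d = this
  \<comment> \<open>Each product pairs a derivative of class \<open>k\<close> with an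
    undifferentiated factor of class \<open>Suc k\<close>, which is also of class \<open>k\<close>;
    so the induction hypothesis applies to both.\<close>
  have C: "Ck_on k W (\<lambda>x. B (f x) (E x v) + B (D x v) (g x))" for v
    by (rule Ck_on_add[OF assms(1) Suc.IH[OF Ck_on_SucD[OF Suc.prems(1)] E(2)]
          Suc.IH[OF D(2) Ck_on_SucD[OF Suc.prems(2)]]])
  show ?case unfolding Ck_on_Suc_iff[OF assms(1)]
    by (intro exI conjI ballI allI, erule d, rule C)
qed

lemma linear_sum_Basis:
  fixes f :: "'a::euclidean_space \<Rightarrow> 'b::real_vector"
  assumes "linear f"
  shows "f x = (\<Sum>b\<in>Basis. (x \<bullet> b) *\<^sub>R f b)"
  by (subst euclidean_representation[of x, symmetric])
     (simp add: linear_sum[OF assms] linear_cmul[OF assms])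

text \<open>In the chain rule \<open>E (f x) (D x v)\<close> the point x occurs twice. Expanding in
  a basis of the middle space separates the occurrences: coordinates of \<open>D x v\<close> times
  the maps \<open>E (f x) b\<close>, and the latter are compositions with a map of class
  \<open>k\<close>, covered by the induction hypothesis.\<close>

lemma Ck_on_compose:
  fixes g :: "'b::euclidean_space \<Rightarrow> 'c::real_normed_vector"
  assumes "open W" "open V" "f ` W \<subseteq> V"
  shows "Ck_on k W f \<Longrightarrow> Ck_on k V g \<Longrightarrow> Ck_on k W (\<lambda>x. g (f x))"
proof (induction k arbitrary: g)
  case 0
  then show ?case using assms(3) by (auto intro: continuous_on_compose2)
next
  case (Suc k)
  from Suc.prems[unfolded Ck_on_Suc_iff[OF assms(1)] Ck_on_Suc_iff[OF assms(2)]] obtain D E where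
    D: "\<And>x. x \<in> W \<Longrightarrow> (f has_derivative D x) (at x)" "\<And>v. Ck_on k W (\<lambda>x. D x v)" and
    E: "\<And>x. x \<in> V \<Longrightarrow> (g has_derivative E x) (at x)" "\<And>v. Ck_on k V (\<lambda>x. E x v)" by blast
  have d: "((\<lambda>x. g (f x)) has_derivative (\<lambda>v. \<Sum>b\<in>Basis. (D x v \<bullet> b) *\<^sub>R E (f x) b)) (at x)"
    if x: "x \<in> W" for x
  proof -
    have "((\<lambda>x. g (f x)) has_derivative (\<lambda>v. E (f x) (D x v))) (at x)"
      using x assms(3) by (intro has_derivative_compose[OF D(1) E(1)]) auto
    moreover have "linear (E (f x))"
      using E(1) x assms(3) has_derivative_linear by blast
    ultimately show ?thesis by (subst (asm) linear_sum_Basis)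
  qed
  have C: "Ck_on k W (\<lambda>x. \<Sum>b\<in>Basis. (D x v \<bullet> b) *\<^sub>R E (f x) b)" for v
    by (rule Ck_on_sum[OF assms(1) Ck_on_bounded_bilinear[OF assms(1) bounded_bilinear_scaleR
          Ck_on_bounded_linear[OF assms(1) bounded_linear_inner_left D(2)]
          Suc.IH[OF Ck_on_SucD[OF Suc.prems(1)] E(2)]]])
  show ?case unfolding Ck_on_Suc_iff[OF assms(1)]
    by (intro exI conjI ballI allI, erule d, rule C)
qed

text \<open>One neighbourhood serves all orders \<open>k\<close>, so the notion depends only on the
  germ and is closed under \<open>frechet_derivative\<close>. At interior points of a set it is what
  \<open>smooth_on\<close> amounts to.\<close>

definition smooth_at :: "('a::real_normed_vector \<Rightarrow> 'b::real_normed_vector) \<Rightarrow> 'a \<Rightarrow> bool" where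
  "smooth_at f x \<longleftrightarrow> (\<exists>W. open W \<and> x \<in> W \<and> (\<forall>k. Ck_on k W f))"

lemma smooth_at_cong:
  assumes "smooth_at f x" "\<forall>\<^sub>F y in nhds x. f y = g y"
  shows "smooth_at g x"
proof -
  obtain W where W: "open W" "x \<in> W" "\<forall>k. Ck_on k W f" using assms(1) smooth_at_def by blast
  obtain V where V: "open V" "x \<in> V" "\<And>y. y \<in> V \<Longrightarrow> f y = g y"
    using assms(2) by (auto simp: eventually_nhds)
  have "Ck_on k (W \<inter> V) g" for k
    by (rule Ck_on_cong[of _ f]) (use W V in \<open>auto intro: Ck_on_subset\<close>)
  then show ?thesis using W V unfolding smooth_at_def
    by (intro exI[of _ "W \<inter> V"]) auto
qed

lemma smooth_at_const: "smooth_at (\<lambda>x. a) x"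
  unfolding smooth_at_def by (auto intro!: exI[of _ UNIV] Ck_on_const)

lemma smooth_at_add:
  assumes "smooth_at f x" "smooth_at g x"
  shows "smooth_at (\<lambda>x. f x + g x) x"
proof -
  obtain W V where "open W" "x \<in> W" "\<forall>k. Ck_on k W f" "open V" "x \<in> V" "\<forall>k. Ck_on k V g"
    using assms smooth_at_def by metis
  then show ?thesis unfolding smooth_at_def
    by (intro exI[of _ "W \<inter> V"]) (auto intro!: Ck_on_add intro: Ck_on_subset)
qed

lemma smooth_at_sum: "(\<And>i. i \<in> I \<Longrightarrow> smooth_at (f i) x) \<Longrightarrow> smooth_at (\<lambda>x. \<Sum>i\<in>I. f i x) x"
  by (induction I rule: infinite_finite_induct) (auto intro: smooth_at_const smooth_at_add)

lemma smooth_at_bounded_bilinear: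
  assumes "bounded_bilinear B" "smooth_at f x" "smooth_at g x"
  shows "smooth_at (\<lambda>x. B (f x) (g x)) x"
proof -
  obtain W V where "open W" "x \<in> W" "\<forall>k. Ck_on k W f" "open V" "x \<in> V" "\<forall>k. Ck_on k V g"
    using assms smooth_at_def by metis
  then show ?thesis unfolding smooth_at_def
    by (intro exI[of _ "W \<inter> V"])
       (auto intro!: Ck_on_bounded_bilinear[OF _ assms(1)] intro: Ck_on_subset)
qed

lemma smooth_at_bounded_linear:
  "bounded_linear L \<Longrightarrow> smooth_at f x \<Longrightarrow> smooth_at (\<lambda>x. L (f x)) x"
  unfolding smooth_at_def using Ck_on_bounded_linear by blast

lemma smooth_at_Pair:
  assumes "smooth_at f x" "smooth_at g x"
  shows "smooth_at (\<lambda>x. (f x, g x)) x"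
proof -
  have "smooth_at (\<lambda>x. (f x, 0) + (0, g x)) x"
    by (intro smooth_at_add smooth_at_bounded_linear[of "\<lambda>y. (y, 0)"]
        smooth_at_bounded_linear[of "\<lambda>y. (0, y)"] assms bounded_linear_intros)
  then show ?thesis by simp
qed

lemma smooth_at_continuous: "smooth_at f x \<Longrightarrow> isCont f x"
  unfolding smooth_at_def using Ck_on_imp_continuous_on continuous_on_eq_continuous_at by blast

lemma smooth_at_has_derivative:
  "smooth_at f x \<Longrightarrow> (f has_derivative frechet_derivative f (at x)) (at x)"
  unfolding smooth_at_def
  by (metis Ck_on.simps(2) differentiable_on_eq_differentiable_at frechet_derivative_works)

lemma smooth_at_frechet_derivative:
  "smooth_at f x \<Longrightarrow> smooth_at (\<lambda>y. frechet_derivative f (at y) v) x"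
  unfolding smooth_at_def using Ck_on.simps(2) by blast

lemma smooth_at_compose:
  fixes g :: "'b::euclidean_space \<Rightarrow> 'c::real_normed_vector"
  assumes "smooth_at f x" "smooth_at g (f x)"
  shows "smooth_at (\<lambda>x. g (f x)) x"
proof -
  obtain W V where W: "open W" "x \<in> W" "\<And>k. Ck_on k W f" and V: "open V" "f x \<in> V" "\<And>k. Ck_on k V g"
    using assms smooth_at_def by metis
  have *: "open (W \<inter> f -` V)"
    using W V Ck_on_imp_continuous_on continuous_open_preimage by blast
  have "Ck_on k (W \<inter> f -` V) (\<lambda>x. g (f x))" for k
    by (rule Ck_on_compose[OF * V(1) _ Ck_on_subset[OF W(3)] V(3)]) auto
  then show ?thesis using * W V unfolding smooth_at_def by blast
qed

lemma smooth_onI: "(\<And>x. x \<in> S \<Longrightarrow> smooth_at f x) \<Longrightarrow> smooth_on S f"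
  unfolding smooth_on_def smooth_at_def by blast

lemma smooth_on_extension:
  assumes "smooth_on S f" "x \<in> S"
  obtains F where "smooth_at F x" "\<forall>\<^sub>F y in nhds x. y \<in> S \<longrightarrow> F y = f y"
  using assms unfolding smooth_on_def smooth_at_def eventually_nhds by (metis IntI)

lemma smooth_on_eventually:
  assumes "smooth_on S f" "\<forall>\<^sub>F y in nhds x. y \<in> S"
  shows "smooth_at f x"
proof -
  have "x \<in> S" using assms(2) eventually_nhds_x_imp_x by blast
  then obtain F where F: "smooth_at F x" "\<forall>\<^sub>F y in nhds x. y \<in> S \<longrightarrow> F y = f y"
    using smooth_on_extension[OF assms(1)] by blast
  have "\<forall>\<^sub>F y in nhds x. F y = f y" using F(2) assms(2) by eventually_elim auto
  then show ?thesis using smooth_at_cong F(1) by blast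
qed

lemma eventually_nhds_isCont:
  "isCont f x \<Longrightarrow> \<forall>\<^sub>F y in nhds (f x). P y \<Longrightarrow> \<forall>\<^sub>F y in nhds x. P (f y)"
  using eventually_compose_filterlim[of P "nhds (f x)" f "nhds x"]
  by (simp add: isCont_def tendsto_at_iff_tendsto_nhds)


section \<open>Charts and differentials\<close>

lemma
  assumes "smooth_atlas A" "c \<in> A"
  shows open_chart: "open (fst c)"
    and open_chart_image: "open (snd c ` fst c)"
    and continuous_on_cinv: "continuous_on (snd c ` fst c) (cinv c)"
    and inj_on_chart: "inj_on (snd c) (fst c)"
proof -
  have h: "homeomorphism (fst c) (snd c ` fst c) (snd c) (cinv c)"
    and "open (fst c)" "open (snd c ` fst c)"
    using assms unfolding smooth_atlas_def by blast+
  then show "open (fst c)" "open (snd c ` fst c)" "continuous_on (snd c ` fst c) (cinv c)"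
    by (auto simp: homeomorphism_def)
  show "inj_on (snd c) (fst c)"
    using h unfolding homeomorphism_def by (metis inj_onI)
qed

lemma
  assumes "smooth_atlas A"
  shows chart_at_in: "chart_at A p \<in> A"
    and chart_at_mem: "p \<in> fst (chart_at A p)"
proof -
  have "\<exists>c. c \<in> A \<and> p \<in> fst c" using assms unfolding smooth_atlas_def by blast
  then show "chart_at A p \<in> A" "p \<in> fst (chart_at A p)"
    unfolding chart_at_def by (metis (mono_tags, lifting) someI_ex)+
qed

lemma cinv_chart: "inj_on (snd c) (fst c) \<Longrightarrow> p \<in> fst c \<Longrightarrow> cinv c (snd c p) = p"
  unfolding cinv_def by simp

lemma eventually_cinv:
  assumes "smooth_atlas A" "c \<in> A" "p \<in> fst c" "\<forall>\<^sub>F q in nhds p. P q"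
  shows "\<forall>\<^sub>F y in nhds (snd c p). P (cinv c y)"
proof -
  have "snd c p \<in> snd c ` fst c" using assms by auto
  then have "isCont (cinv c) (snd c p)"
    using continuous_on_cinv[OF assms(1,2)] open_chart_image[OF assms(1,2)]
      continuous_on_eq_continuous_at by blast
  then show ?thesis
    using eventually_nhds_isCont[of "snd c p" "cinv c" P]
      cinv_chart[OF inj_on_chart[OF assms(1,2)] assms(3)] assms(4) by simp
qed

lemma eventually_chart_image:
  assumes "smooth_atlas A" "c \<in> A" "p \<in> fst c"
  shows "\<forall>\<^sub>F y in nhds (snd c p). y \<in> snd c ` fst c"
  using open_chart_image[OF assms(1,2)] assms(3) eventually_nhds_in_open by blast

lemma eventually_chart:
  assumes "smooth_atlas A" "c \<in> A" "p \<in> fst c"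
  shows "\<forall>\<^sub>F y in nhds (snd c p). cinv c y \<in> fst c \<and> snd c (cinv c y) = y"
  using eventually_chart_image[OF assms]
  by eventually_elim (auto simp: cinv_chart[OF inj_on_chart[OF assms(1,2)]])

section \<open>Open sets and smooth maps read in charts\<close>

lemma open_imp_atlas_open:
  assumes "smooth_atlas A" "open V"
  shows "atlas_open A UNIV V"
  unfolding atlas_open_def
proof (intro conjI ballI)
  fix c assume c: "c \<in> A"
  have "open (snd c ` (V \<inter> fst c))"
  proof (rule Topological_Spaces.openI)
    fix y assume "y \<in> snd c ` (V \<inter> fst c)"
    then obtain p where p: "p \<in> V" "p \<in> fst c" "y = snd c p" by blast
    have "\<forall>\<^sub>F z in nhds y. cinv c z \<in> V"
      using eventually_cinv[OF assms(1) c p(2), of "\<lambda>q. q \<in> V"] assms(2) p eventually_nhds_in_open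
      by blast
    then have "\<forall>\<^sub>F z in nhds y. z \<in> snd c ` (V \<inter> fst c)"
      using eventually_chart[OF assms(1) c p(2)] unfolding p(3)
      by eventually_elim (metis IntI imageI)
    then show "\<exists>T. open T \<and> y \<in> T \<and> T \<subseteq> snd c ` (V \<inter> fst c)"
      unfolding eventually_nhds by blast
  qed
  then show "openin (top_of_set (snd c ` (UNIV \<inter> fst c))) (snd c ` (V \<inter> fst c))"
    by (intro open_subset) auto
qed simp

lemma atlas_open_UNIV: "smooth_atlas A \<Longrightarrow> atlas_open A UNIV UNIV"
  by (simp add: open_imp_atlas_open)

lemma open_chart_image_atlas_open:
  assumes "smooth_atlas A" "atlas_open A UNIV V" "c \<in> A"
  shows "open (snd c ` (V \<inter> fst c))"
  using assms open_chart_image[OF assms(1,3)] unfolding atlas_open_def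
  by (metis Int_UNIV_left openin_open_trans)

text \<open>On an open part of a smooth atlas the relatively open chart images are open, so the
  local extensions hidden in \<open>smooth_map\<close> coincide with the map itself near the point.
  The target \<open>B\<close> may be any family of charts; \<open>frame_atlas\<close>, whose charts
  leave out the non-linear maps, is such a target.\<close>

lemma smooth_mapD:
  assumes A: "smooth_atlas A" and V: "atlas_open A UNIV V" and f: "smooth_map A V B f"
    and p: "p \<in> V" "c \<in> A" "d \<in> B" "p \<in> fst c" "f p \<in> fst d"
  shows smooth_map_smooth_at: "smooth_at (\<lambda>y. snd d (f (cinv c y))) (snd c p)"
    and smooth_map_eventually: "\<forall>\<^sub>F y in nhds (snd c p). cinv c y \<in> V \<and> f (cinv c y) \<in> fst d"
proof -
  let ?T = "snd c ` ({p \<in> V. f p \<in> fst d} \<inter> fst c)"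
  have "openin (top_of_set (snd c ` (V \<inter> fst c))) ?T"
    using f p unfolding smooth_map_def atlas_open_def by blast
  then have o: "open ?T" using open_chart_image_atlas_open[OF A V p(2)] openin_open_trans by blast
  then have e: "\<forall>\<^sub>F y in nhds (snd c p). y \<in> ?T"
    using p by (intro eventually_nhds_in_open) auto
  then show "\<forall>\<^sub>F y in nhds (snd c p). cinv c y \<in> V \<and> f (cinv c y) \<in> fst d"
    by eventually_elim (auto simp: cinv_chart[OF inj_on_chart[OF A p(2)]])
  have "?T = snd c ` {p \<in> V \<inter> fst c. f p \<in> fst d}" by auto
  then have "smooth_on ?T (snd d \<circ> f \<circ> cinv c)"
    using f p unfolding smooth_map_def by auto
  from smooth_on_eventually[OF this e]
  show "smooth_at (\<lambda>y. snd d (f (cinv c y))) (snd c p)" by (simp add: o_def)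
qed

lemma smooth_mapI:
  assumes A: "smooth_atlas A" and V: "atlas_open A UNIV V"
    and r: "\<And>p. p \<in> V \<Longrightarrow> \<exists>d\<in>B. f p \<in> fst d"
    and s: "\<And>p c d. p \<in> V \<Longrightarrow> c \<in> A \<Longrightarrow> d \<in> B \<Longrightarrow> p \<in> fst c \<Longrightarrow> f p \<in> fst d \<Longrightarrow>
      smooth_at (\<lambda>y. snd d (f (cinv c y))) (snd c p)"
    and e: "\<And>p c d. p \<in> V \<Longrightarrow> c \<in> A \<Longrightarrow> d \<in> B \<Longrightarrow> p \<in> fst c \<Longrightarrow> f p \<in> fst d \<Longrightarrow>
      \<forall>\<^sub>F y in nhds (snd c p). f (cinv c y) \<in> fst d"
  shows "smooth_map A V B f"
  unfolding smooth_map_def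
proof (intro conjI ballI)
  show "f ` V \<subseteq> (\<Union>d\<in>B. fst d)" using r by blast
next
  fix d assume d: "d \<in> B"
  show "atlas_open A V {p \<in> V. f p \<in> fst d}"
    unfolding atlas_open_def
  proof (intro conjI ballI)
    fix c assume c: "c \<in> A"
    let ?T = "snd c ` ({p \<in> V. f p \<in> fst d} \<inter> fst c)"
    have "open ?T"
    proof (rule Topological_Spaces.openI)
      fix y assume "y \<in> ?T"
      then obtain p where p: "p \<in> V" "f p \<in> fst d" "p \<in> fst c" "y = snd c p" by blast
      have "\<forall>\<^sub>F z in nhds y. z \<in> snd c ` (V \<inter> fst c)"
        using open_chart_image_atlas_open[OF A V c] p by (intro eventually_nhds_in_open) auto
      then have "\<forall>\<^sub>F z in nhds y. z \<in> ?T"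
        using e[OF p(1) c d p(3,2)] unfolding p(4)
        by eventually_elim (auto simp: cinv_chart[OF inj_on_chart[OF A c]])
      then show "\<exists>T. open T \<and> y \<in> T \<and> T \<subseteq> ?T" unfolding eventually_nhds by blast
    qed
    then show "openin (top_of_set (snd c ` (V \<inter> fst c))) ?T"
      by (intro open_subset) auto
  qed auto
next
  fix c d assume c: "c \<in> A" and d: "d \<in> B"
  show "smooth_on (snd c ` {p \<in> V \<inter> fst c. f p \<in> fst d}) (snd d \<circ> f \<circ> cinv c)"
    using s[OF _ c d] by (intro smooth_onI) (auto simp: o_def)
qed

lemma smooth_map_const:
  assumes "smooth_atlas A" "atlas_open A UNIV V" "smooth_atlas B"
  shows "smooth_map A V B (\<lambda>x. b)"
  using chart_at_in[OF assms(3)] chart_at_mem[OF assms(3)]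
  by (intro smooth_mapI assms) (auto intro: smooth_at_const)

lemma smooth_at_transition:
  assumes A: "smooth_atlas A" and p: "c \<in> A" "d \<in> A" "p \<in> fst c" "p \<in> fst d"
  shows "smooth_at (\<lambda>y. snd d (cinv c y)) (snd c p)"
    and "\<forall>\<^sub>F y in nhds (snd c p). cinv c y \<in> fst d"
proof -
  show e: "\<forall>\<^sub>F y in nhds (snd c p). cinv c y \<in> fst d"
    using eventually_cinv[OF A p(1,3), of "\<lambda>q. q \<in> fst d"] open_chart[OF A p(2)] p(4)
      eventually_nhds_in_open by blast
  have "smooth_on (snd c ` (fst c \<inter> fst d)) (snd d \<circ> cinv c)"
    using A p unfolding smooth_atlas_def by blast
  moreover have "\<forall>\<^sub>F y in nhds (snd c p). y \<in> snd c ` (fst c \<inter> fst d)"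
    using e eventually_chart[OF A p(1,3)] by eventually_elim (metis IntI imageI)
  ultimately show "smooth_at (\<lambda>y. snd d (cinv c y)) (snd c p)"
    using smooth_on_eventually by (fastforce simp: o_def)
qed

section \<open>Tangent vectors and differentials in arbitrary charts\<close>

lemma has_derivative_dtrans:
  assumes A: "smooth_atlas A" and p: "c \<in> A" "d \<in> A" "p \<in> fst c" "p \<in> fst d"
  shows "((\<lambda>y. snd d (cinv c y)) has_derivative dtrans c d p) (at (snd c p))"
  using smooth_at_has_derivative[OF smooth_at_transition(1)[OF assms]]
  unfolding dtrans_def by (simp add: o_def)

lemma linear_tvec: "smooth_atlas A \<Longrightarrow> c \<in> A \<Longrightarrow> p \<in> fst c \<Longrightarrow> linear (tvec A c p)"
  unfolding tvec_def
  by (meson has_derivative_dtrans chart_at_in chart_at_mem has_derivative_linear)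

lemma linear_comp: "smooth_atlas A \<Longrightarrow> c \<in> A \<Longrightarrow> p \<in> fst c \<Longrightarrow> linear (comp A c p)"
  unfolding comp_def
  by (meson has_derivative_dtrans chart_at_in chart_at_mem has_derivative_linear)

lemma mdiff_eq:
  assumes "((\<lambda>y. snd (chart_at B (f p)) (f (cinv (chart_at A p) y))) has_derivative D)
    (at (snd (chart_at A p) p))"
  shows "mdiff A B f p = D"
  using frechet_derivative_at[OF assms] unfolding mdiff_def by (simp add: o_def)

lemma has_derivative_mdiff:
  assumes "smooth_atlas A" "smooth_atlas B" "atlas_open A UNIV V" "smooth_map A V B f" "p \<in> V"
  shows "((\<lambda>y. snd (chart_at B (f p)) (f (cinv (chart_at A p) y))) has_derivative mdiff A B f p)
    (at (snd (chart_at A p) p))"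
  using smooth_at_has_derivative[OF smooth_map_smooth_at[OF assms(1,3,4,5) chart_at_in chart_at_in
        chart_at_mem chart_at_mem]] assms(1,2)
  unfolding mdiff_def by (simp add: o_def)

lemma linear_mdiff:
  assumes "smooth_atlas A" "smooth_atlas B" "atlas_open A UNIV V" "smooth_map A V B f" "p \<in> V"
  shows "linear (mdiff A B f p)"
  using has_derivative_mdiff[OF assms] has_derivative_linear by blast

lemma has_derivative_eventually_unique:
  assumes "(f has_derivative D) (at x)" "(g has_derivative E) (at x)" "\<forall>\<^sub>F y in nhds x. f y = g y"
  shows "D = E"
proof -
  obtain W where "open W" "x \<in> W" "\<And>y. y \<in> W \<Longrightarrow> f y = g y"
    using assms(3) unfolding eventually_nhds by blast
  then have "(g has_derivative D) (at x)"
    using has_derivative_transform_within_open[OF assms(1)] by blast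
  then show ?thesis using assms(2) has_derivative_unique by blast
qed

text \<open>Both sides are the derivative at \<open>snd c p\<close> of \<open>f\<close> read from
  the chart \<open>c\<close> into the distinguished chart at \<open>f p\<close>, factored once
  through the distinguished chart at \<open>p\<close> and once through \<open>d\<close>.\<close>

lemma mdiff_tvec:
  assumes A: "smooth_atlas A" and B: "smooth_atlas B" and V: "atlas_open A UNIV V"
    and f: "smooth_map A V B f" and p: "p \<in> V" "c \<in> A" "d \<in> B" "p \<in> fst c" "f p \<in> fst d"
  shows "mdiff A B f p (tvec A c p w) =
    tvec B d (f p) (frechet_derivative (\<lambda>y. snd d (f (cinv c y))) (at (snd c p)) w)"
proof -
  let ?c = "chart_at A p" and ?d = "chart_at B (f p)"
  note ca = chart_at_in[OF A, of p] chart_at_mem[OF A, of p]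
    chart_at_in[OF B, of "f p"] chart_at_mem[OF B, of "f p"]
  have cp: "cinv c (snd c p) = p" using cinv_chart[OF inj_on_chart[OF A p(2)] p(4)] .
  have m: "((\<lambda>y. snd ?d (f (cinv ?c y))) has_derivative mdiff A B f p)
      (at (snd ?c (cinv c (snd c p))))"
    using has_derivative_mdiff[OF A B V f p(1)] by (simp add: cp)
  have 1: "((\<lambda>y. snd ?d (f (cinv ?c (snd ?c (cinv c y))))) has_derivative
      (\<lambda>w. mdiff A B f p (tvec A c p w))) (at (snd c p))"
    unfolding tvec_def
    by (rule has_derivative_compose[OF has_derivative_dtrans[OF A p(2) ca(1) p(4) ca(2)] m])
  have m: "((\<lambda>y. snd ?d (cinv d y)) has_derivative tvec B d (f p))
      (at (snd d (f (cinv c (snd c p)))))"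
    using has_derivative_dtrans[OF B p(3) ca(3) p(5) ca(4)] by (simp add: cp tvec_def)
  have 2: "((\<lambda>y. snd ?d (cinv d (snd d (f (cinv c y))))) has_derivative
      (\<lambda>w. tvec B d (f p) (frechet_derivative (\<lambda>y. snd d (f (cinv c y))) (at (snd c p)) w)))
      (at (snd c p))"
    by (rule has_derivative_compose[OF smooth_at_has_derivative[OF
            smooth_map_smooth_at[OF A V f p]] m])
  have "\<forall>\<^sub>F y in nhds (snd c p). snd ?d (f (cinv ?c (snd ?c (cinv c y)))) =
      snd ?d (cinv d (snd d (f (cinv c y))))"
    using smooth_map_eventually[OF A V f p] smooth_at_transition(2)[OF A p(2) ca(1) p(4) ca(2)]
    by eventually_elim
       (simp add: cinv_chart[OF inj_on_chart[OF A ca(1)]] cinv_chart[OF inj_on_chart[OF B p(3)]])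
  from fun_cong[OF has_derivative_eventually_unique[OF 1 2 this]] show ?thesis .
qed

text \<open>The chart \<open>d\<close> at \<open>f p\<close> stays fixed while the point moves. In
  it the pulled back form is a sum over basis vectors \<open>b\<close>: components of the derivative
  of \<open>f\<close>, times coefficients of \<alpha> evaluated along \<open>f\<close>. Both factors
  are smooth.\<close>

lemma smooth_one_form_pullback:
  assumes A: "smooth_atlas A" and B: "smooth_atlas B" and V: "atlas_open A UNIV V"
    and f: "smooth_map A V B f" and \<alpha>: "smooth_one_form B \<alpha>"
    and p: "p \<in> V" "c \<in> A" "p \<in> fst c"
  shows "smooth_at (\<lambda>y. \<alpha> (f (cinv c y)) (mdiff A B f (cinv c y) (tvec A c (cinv c y) w))) (snd c p)"
proof -
  define d where "d = chart_at B (f p)"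
  have d: "d \<in> B" "f p \<in> fst d" using chart_at_in[OF B] chart_at_mem[OF B] d_def by auto
  define \<phi> where "\<phi> = (\<lambda>y. snd d (f (cinv c y)))"
  have \<phi>: "smooth_at \<phi> (snd c p)"
    using smooth_map_smooth_at[OF A V f p(1,2) d(1) p(3) d(2)] \<phi>_def by simp
  have cp: "cinv c (snd c p) = p" using cinv_chart[OF inj_on_chart[OF A p(2)] p(3)] .
  have comp: "smooth_at (\<lambda>z. \<alpha> (cinv d z) (tvec B d (cinv d z) b)) (snd d (f p))" for b
    using \<alpha> d eventually_chart_image[OF B d] smooth_on_eventually
    unfolding smooth_one_form_def by fastforce
  have "smooth_at (\<lambda>y. \<Sum>b\<in>Basis. (frechet_derivative \<phi> (at y) w \<bullet> b) *\<^sub>R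
      \<alpha> (cinv d (\<phi> y)) (tvec B d (cinv d (\<phi> y)) b)) (snd c p)"
    using comp cp unfolding \<phi>_def[symmetric]
    by (intro smooth_at_sum smooth_at_bounded_bilinear[OF bounded_bilinear_scaleR]
        smooth_at_bounded_linear[OF bounded_linear_inner_left] smooth_at_frechet_derivative \<phi>
        smooth_at_compose[OF \<phi>]) (simp add: \<phi>_def)
  then show ?thesis
  proof (rule smooth_at_cong)
    show "\<forall>\<^sub>F y in nhds (snd c p). (\<Sum>b\<in>Basis. (frechet_derivative \<phi> (at y) w \<bullet> b) *\<^sub>R
      \<alpha> (cinv d (\<phi> y)) (tvec B d (cinv d (\<phi> y)) b)) =
      \<alpha> (f (cinv c y)) (mdiff A B f (cinv c y) (tvec A c (cinv c y) w))"
      using smooth_map_eventually[OF A V f p(1,2) d(1) p(3) d(2)] eventually_chart[OF A p(2,3)]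
    proof eventually_elim
      case (elim y)
      define q where "q = cinv c y"
      have q: "q \<in> V" "f q \<in> fst d" "q \<in> fst c" "snd c q = y" using elim q_def by auto
      have fq: "cinv d (\<phi> y) = f q"
        using cinv_chart[OF inj_on_chart[OF B d(1)] q(2)] \<phi>_def q_def by simp
      have "mdiff A B f q (tvec A c q w) = tvec B d (f q) (frechet_derivative \<phi> (at y) w)"
        using mdiff_tvec[OF A B V f q(1) p(2) d(1) q(3,2)] q(4) \<phi>_def by simp
      moreover have "linear (\<lambda>b. \<alpha> (f q) (tvec B d (f q) b))"
        using linear_compose[OF linear_tvec[OF B d(1) q(2)], of "\<alpha> (f q)"] \<alpha>
        by (auto simp: smooth_one_form_def o_def)
      from linear_sum_Basis[OF this, of "frechet_derivative \<phi> (at y) w"]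
      have "\<alpha> (f q) (tvec B d (f q) (frechet_derivative \<phi> (at y) w)) =
        (\<Sum>b\<in>Basis. (frechet_derivative \<phi> (at y) w \<bullet> b) *\<^sub>R \<alpha> (f q) (tvec B d (f q) b))" .
      ultimately show ?case using fq q_def by simp
    qed
  qed
qed

lemma chart_at_euc: "chart_at euc x = (UNIV, id)"
  unfolding chart_at_def euc_def by (rule some_equality) auto

lemma cinv_euc [simp]: "cinv (UNIV, id) = id"
  by (simp add: cinv_def fun_eq_iff inv_into_def)

lemma smooth_at_ident: "smooth_at (\<lambda>x. x) x"
proof -
  have "Ck_on k UNIV (\<lambda>x::'a. x)" for k
  proof (cases k)
    case (Suc l)
    show ?thesis unfolding Suc Ck_on_Suc_iff[OF open_UNIV]
      by (intro exI[of _ "\<lambda>x v. v"]) (auto intro: Ck_on_const)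
  qed auto
  then show ?thesis unfolding smooth_at_def by blast
qed

lemma smooth_atlas_euc: "smooth_atlas euc"
proof -
  have "smooth_on UNIV (id :: 'a \<Rightarrow> 'a)"
    using smooth_at_ident by (intro smooth_onI) (simp add: id_def)
  then show ?thesis
    unfolding smooth_atlas_def euc_def by (auto simp: homeomorphism_def)
qed


section \<open>The groups SU(2) and SU(1,1)\<close>

lemma forall_3_0: "(\<forall>i::3. P i) \<longleftrightarrow> P 0 \<and> P 1 \<and> P 2"
proof -
  have "(3::3) = 0" by simp
  then show ?thesis unfolding forall_3 by metis
qed

lemma mat2_nth [simp]:
  "mat2 a b c d $ 1 $ 1 = a" "mat2 a b c d $ 1 $ 2 = b"
  "mat2 a b c d $ 2 $ 1 = c" "mat2 a b c d $ 2 $ 2 = d"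
  by (simp_all add: mat2_def)

lemma matrix2_eq_iff:
  "A = (B :: 'a^2^2) \<longleftrightarrow> A$1$1 = B$1$1 \<and> A$1$2 = B$1$2 \<and> A$2$1 = B$2$1 \<and> A$2$2 = B$2$2"
  by (auto simp: vec_eq_iff forall_2)

lemma matrix2_mult_nth:
  "((A :: 'a::semiring_1^2^2) ** B) $ i $ j = A$i$1 * B$1$j + A$i$2 * B$2$j"
  by (simp add: matrix_matrix_mult_def sum_2)

lemma matrix2_vector_mult_nth:
  "((A :: 'a::semiring_1^2^2) *v v) $ i = A$i$1 * v$1 + A$i$2 * v$2"
  by (simp add: matrix_vector_mult_def sum_2)

lemma mat1_nth2 [simp]:
  "(mat 1 :: complex^2^2) $ 1 $ 1 = 1" "(mat 1 :: complex^2^2) $ 1 $ 2 = 0"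
  "(mat 1 :: complex^2^2) $ 2 $ 1 = 0" "(mat 1 :: complex^2^2) $ 2 $ 2 = 1"
  by (simp_all add: mat_def)

lemma scaleR_complex: "a *\<^sub>R z = complex_of_real a * z"
  by (rule scaleR_conv_of_real)

text \<open>The adjugate. It is the inverse when the determinant is 1, but it is linear in the
  entries, so \<open>h ** gam r Y ** adj2 h\<close> can be differentiated by the product rule
  alone.\<close>

definition adj2 :: "complex^2^2 \<Rightarrow> complex^2^2" where
  "adj2 h = mat2 (h$2$2) (- h$1$2) (- h$2$1) (h$1$1)"

lemma adj2_mult: "det h = 1 \<Longrightarrow> h ** adj2 h = mat 1" "det h = 1 \<Longrightarrow> adj2 h ** h = mat 1"
  by (simp_all add: matrix2_eq_iff matrix2_mult_nth adj2_def det_2 algebra_simps)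

lemma matrix_inv_eq_adj2: "det h = 1 \<Longrightarrow> matrix_inv h = adj2 h"
  unfolding matrix_inv_def
proof (rule some_equality)
  assume d: "det h = 1"
  show "h ** adj2 h = mat 1 \<and> adj2 h ** h = mat 1" using adj2_mult[OF d] by simp
  fix k assume k: "h ** k = mat 1 \<and> k ** h = mat 1"
  have "k = adj2 h ** h ** k" by (simp add: adj2_mult(2)[OF d])
  also have "\<dots> = adj2 h" using k by (simp add: matrix_mul_assoc[symmetric])
  finally show "k = adj2 h" .
qed

lemma gam_nth [simp]:
  "gam r X $ 1 $ 1 = (if r = 0 then \<i> * X$0 else X$0)" "gam r X $ 1 $ 2 = X$1 + \<i> * X$2"
  "gam r X $ 2 $ 1 = - X$1 + \<i> * X$2" "gam r X $ 2 $ 2 = - (if r = 0 then \<i> * X$0 else X$0)"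
  by (simp_all add: gam_def gamma0_def scaleR_complex)

lemma herm_mat_nth:
  "herm_mat r $ 1 $ 1 = 1" "herm_mat r $ 1 $ 2 = 0"
  "herm_mat r $ 2 $ 1 = 0" "herm_mat r $ 2 $ 2 = (if r = 0 then 1 else - 1)"
  by (simp_all add: herm_mat_def gamma0_def)

lemma dagger_nth [simp]: "dagger h $ i $ j = cnj (h $ j $ i)"
  by (simp add: dagger_def)

text \<open>Since the inverse is the adjugate, invariance of the Hermitian form can be written
  \<open>dagger h ** herm_mat r = herm_mat r ** adj2 h\<close>, which is real-linear in the entries
  and expresses one column through the other. Only the determinant condition stays
  quadratic.\<close>

lemma H_group_iff:
  assumes "r \<in> {0, 1}"
  shows "h \<in> H_group r \<longleftrightarrow> h$2$2 = cnj (h$1$1) \<and> h$1$2 = - ((-1)^r) * cnj (h$2$1) \<and>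
    (cmod (h$1$1))\<^sup>2 + (-1)^r * (cmod (h$2$1))\<^sup>2 = 1" (is "_ \<longleftrightarrow> ?R")
proof
  assume "h \<in> H_group r"
  then have d: "det h = 1" and g: "dagger h ** herm_mat r ** h = herm_mat r"
    by (auto simp: H_group_def)
  have "dagger h ** herm_mat r = dagger h ** herm_mat r ** (h ** adj2 h)"
    by (simp add: adj2_mult(1)[OF d])
  also have "\<dots> = herm_mat r ** adj2 h" by (simp add: matrix_mul_assoc g)
  finally have e: "dagger h ** herm_mat r = herm_mat r ** adj2 h" .
  have 1: "h$2$2 = cnj (h$1$1)" "h$1$2 = - ((-1)^r) * cnj (h$2$1)"
    using assms e by (auto simp: matrix2_eq_iff matrix2_mult_nth herm_mat_nth adj2_def)
  have "complex_of_real ((cmod (h$1$1))\<^sup>2 + (-1)^r * (cmod (h$2$1))\<^sup>2) = 1"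
    using d unfolding det_2 1 of_real_add of_real_mult complex_norm_square by (simp add: algebra_simps)
  then show ?R using 1 of_real_eq_1_iff by blast
next
  assume R: ?R
  then have "complex_of_real ((cmod (h$1$1))\<^sup>2 + (-1)^r * (cmod (h$2$1))\<^sup>2) = 1" by simp
  then have n: "h$1$1 * cnj (h$1$1) + (-1)^r * (h$2$1 * cnj (h$2$1)) = 1"
    unfolding of_real_add of_real_mult complex_norm_square by simp
  then have "det h = 1" using R by (simp add: det_2 algebra_simps)
  moreover have "dagger h ** herm_mat r ** h = herm_mat r"
    using assms R n
    by (auto simp: matrix2_eq_iff matrix2_mult_nth herm_mat_nth algebra_simps)
  ultimately show "h \<in> H_group r" by (simp add: H_group_def)
qed

lemma H_group_det: "h \<in> H_group r \<Longrightarrow> det h = 1"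
  by (simp add: H_group_def)

lemma H_group_one: "mat 1 \<in> H_group r"
  by (auto simp: H_group_def matrix2_eq_iff matrix2_mult_nth herm_mat_nth)

lemma dagger_mult: "dagger (A ** B) = dagger B ** dagger A"
  by (simp add: matrix2_eq_iff matrix2_mult_nth algebra_simps)

lemma H_group_mult: "h \<in> H_group r \<Longrightarrow> k \<in> H_group r \<Longrightarrow> h ** k \<in> H_group r"
proof -
  assume h: "h \<in> H_group r" and k: "k \<in> H_group r"
  have "dagger (h ** k) ** herm_mat r ** (h ** k) =
      dagger k ** (dagger h ** herm_mat r ** h) ** k"
    by (simp add: dagger_mult matrix_mul_assoc)
  then show ?thesis using h k by (simp add: H_group_def det_mul)
qed

lemma H_group_inv:
  assumes "h \<in> H_group r"
  shows "matrix_inv h \<in> H_group r" "h ** matrix_inv h = mat 1" "matrix_inv h ** h = mat 1"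
proof -
  have d: "det h = 1" and g: "dagger h ** herm_mat r ** h = herm_mat r"
    using assms by (auto simp: H_group_def)
  show 1: "h ** matrix_inv h = mat 1" "matrix_inv h ** h = mat 1"
    using adj2_mult[OF d] matrix_inv_eq_adj2[OF d] by auto
  have d': "det (matrix_inv h) = 1" using arg_cong[OF 1(1), of det] d by (simp add: det_mul)
  have 2: "dagger (matrix_inv h) ** dagger h = mat 1"
    by (simp add: dagger_mult[symmetric] 1) (simp add: matrix2_eq_iff)
  have "dagger (matrix_inv h) ** herm_mat r ** matrix_inv h =
      dagger (matrix_inv h) ** (dagger h ** herm_mat r ** h) ** matrix_inv h"
    unfolding g ..
  also have "\<dots> = (dagger (matrix_inv h) ** dagger h) ** herm_mat r ** (h ** matrix_inv h)"
    by (simp only: matrix_mul_assoc)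
  also have "\<dots> = herm_mat r" by (simp add: 1 2)
  finally have "dagger (matrix_inv h) ** herm_mat r ** matrix_inv h = herm_mat r" .
  then show "matrix_inv h \<in> H_group r" using d'
    by (simp add: H_group_def)
qed

text \<open>The closed formula for l_g, used for all computations; \<open>lg_eq_lgx\<close>
  identifies it with the described map \<open>lg\<close>.\<close>

definition lgx :: "nat \<Rightarrow> real^3 \<Rightarrow> complex^2^2" where
  "lgx r X = (\<chi> i j. \<i> ^ r / 2 * gam r X $ i $ j)"

text \<open>The coordinates are read off the first row. This map, like \<open>gam_inv\<close> below,
  is defined and real-linear on all matrices, so it commutes with derivatives; it inverts
  \<open>lgx\<close> in both directions only on the Lie algebra.\<close>

definition lgx_inv :: "nat \<Rightarrow> complex^2^2 \<Rightarrow> real^3" where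
  "lgx_inv r U = (\<chi> i. if i = 0 then 2 * Im (U$1$1)
     else if i = 1 then (if r = 0 then 2 * Re (U$1$2) else 2 * Im (U$1$2))
     else (if r = 0 then 2 * Im (U$1$2) else - 2 * Re (U$1$2)))"

definition gam_inv :: "nat \<Rightarrow> complex^2^2 \<Rightarrow> real^3" where
  "gam_inv r G = (\<chi> i. if i = 0 then (if r = 0 then Im (G$1$1) else Re (G$1$1))
     else if i = 1 then Re (G$1$2) else Im (G$1$2))"

lemma gam_inv_gam: "gam_inv r (gam r X) = X"
  by (simp add: vec_eq_iff forall_3_0 gam_inv_def)

lemma bounded_linear_gam_inv: "bounded_linear (gam_inv r)"
  unfolding linear_conv_bounded_linear[symmetric]
  by (rule linearI) (simp_all add: vec_eq_iff forall_3_0 gam_inv_def)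

lemma bounded_linear_lgx_inv: "bounded_linear (lgx_inv r)"
  unfolding linear_conv_bounded_linear[symmetric]
  by (rule linearI) (simp_all add: vec_eq_iff forall_3_0 lgx_inv_def)

lemma linear_lgx: "linear (lgx r)"
  by (rule linearI)
     (auto simp: lgx_def vec_eq_iff forall_2 algebra_simps scaleR_complex)

lemma lgx_inv_lgx: "r \<in> {0, 1} \<Longrightarrow> lgx_inv r (lgx r X) = X"
  by (auto simp: vec_eq_iff forall_3_0 lgx_inv_def lgx_def)

lemma lgx_in_H_lie: "r \<in> {0, 1} \<Longrightarrow> lgx r X \<in> H_lie r"
  by (auto simp: H_lie_def matrix2_eq_iff matrix2_mult_nth herm_mat_nth lgx_def trace_def sum_2
      complex_eq_iff)

lemma lgx_lgx_inv:
  assumes "r \<in> {0, 1}" "U \<in> H_lie r"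
  shows "lgx r (lgx_inv r U) = U"
proof -
  have t: "U$2$2 = - U$1$1" and e: "dagger U ** herm_mat r + herm_mat r ** U = 0"
    using assms(2) by (auto simp: H_lie_def trace_def sum_2 eq_neg_iff_add_eq_0 add.commute)
  have "cnj (U$1$1) + U$1$1 = 0" "cnj (U$1$2) + (-1)^r * U$2$1 = 0"
    using e assms(1) by (auto simp: matrix2_eq_iff matrix2_mult_nth herm_mat_nth)
  then have "Re (U$1$1) = 0" and "U$2$1 = - ((-1)^r) * cnj (U$1$2)"
    using assms(1) by (auto simp: complex_eq_iff)
  then show ?thesis using assms(1) t
    by (auto simp: matrix2_eq_iff lgx_def lgx_inv_def complex_eq_iff)
qed

text \<open>\<open>gam_inv\<close> inverts \<open>gam\<close> from the right only on the range of
  \<open>gam\<close>; the entry relations of \<open>H\<close> keep conjugates inside that range.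
  This is the existence half of the description \<open>lam\<close>.\<close>

lemma gam_gam_inv_conj:
  assumes "r \<in> {0, 1}" "h \<in> H_group r"
  shows "gam r (gam_inv r (h ** gam r X ** adj2 h)) = h ** gam r X ** adj2 h"
proof -
  have h: "h$2$2 = cnj (h$1$1)" "h$1$2 = - ((-1)^r) * cnj (h$2$1)"
    using assms H_group_iff by blast+
  show ?thesis using assms(1)
    by (auto simp: matrix2_eq_iff matrix2_mult_nth gam_inv_def h adj2_def complex_eq_iff algebra_simps)
qed

lemma gam_lam:
  assumes "r \<in> {0, 1}" "h \<in> H_group r"
  shows "gam r (lam r h X) = h ** gam r X ** matrix_inv h"
proof -
  have "lam r h X = gam_inv r (h ** gam r X ** adj2 h)"
    unfolding lam_def matrix_inv_eq_adj2[OF H_group_det[OF assms(2)]]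
  proof (rule the_equality)
    show "gam r (gam_inv r (h ** gam r X ** adj2 h)) = h ** gam r X ** adj2 h"
      by (rule gam_gam_inv_conj[OF assms])
    fix Y assume "gam r Y = h ** gam r X ** adj2 h"
    from arg_cong[OF this, of "gam_inv r"] show "Y = gam_inv r (h ** gam r X ** adj2 h)"
      by (simp add: gam_inv_gam)
  qed
  then show ?thesis
    using gam_gam_inv_conj[OF assms] matrix_inv_eq_adj2[OF H_group_det[OF assms(2)]] by simp
qed

lemma lam_eq:
  assumes "r \<in> {0, 1}" "h \<in> H_group r"
  shows "lam r h X = gam_inv r (h ** gam r X ** adj2 h)"
  using arg_cong[OF gam_lam[OF assms], of "gam_inv r"]
  by (simp add: gam_inv_gam matrix_inv_eq_adj2[OF H_group_det[OF assms(2)]])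

section \<open>The differential of the covering and the isomorphism l_g\<close>

lemma bounded_bilinear_matrix2_mult:
  "bounded_bilinear ((**) :: complex^2^2 \<Rightarrow> complex^2^2 \<Rightarrow> complex^2^2)"
proof -
  have "bilinear ((**) :: complex^2^2 \<Rightarrow> complex^2^2 \<Rightarrow> complex^2^2)"
    unfolding bilinear_def
    by (intro conjI allI linearI; simp add: matrix2_eq_iff matrix2_mult_nth;
        simp only: distrib_left distrib_right scaleR_add_right add_ac)
  then show ?thesis using bilinear_conv_bounded_bilinear by blast
qed

lemma bounded_linear_adj2: "bounded_linear adj2"
  unfolding linear_conv_bounded_linear[symmetric]
  by (rule linearI) (simp_all add: matrix2_eq_iff adj2_def)

text \<open>Without a curve of velocity \<open>U\<close> the condition describing
  \<open>lam_star r U Y\<close> would hold vacuously for every vector. The same curves produce the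
  vertical vectors of P.\<close>

lemma H_curve_exists:
  assumes "r \<in> {0, 1}" "U \<in> H_lie r"
  shows "\<exists>h. H_curve r h U"
proof -
  define X where "X = lgx_inv r U"
  have U: "U = lgx r X" using lgx_lgx_inv[OF assms] X_def by simp
  \<comment> \<open>With \<open>n = det U\<close> one has \<open>U\<^sup>2 = -n\<close>, so \<open>p + t U\<close> lies in \<open>H\<close> as soon as \<open>p\<^sup>2 + t\<^sup>2 n = 1\<close>.\<close>
  define n where "n = ((X$0)\<^sup>2 + (-1)^r * ((X$1)\<^sup>2 + (X$2)\<^sup>2)) / 4"
  \<comment> \<open>\<open>H_curve\<close> asks for values in \<open>H\<close> at all times but for
    a derivative only at 0, so the curve may jump to the identity where the radicand
    \<open>1 - t\<^sup>2 * n\<close> is no longer positive.\<close>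
  define h where "h = (\<lambda>t::real. if t\<^sup>2 * n < 1 then sqrt (1 - t\<^sup>2 * n) *\<^sub>R mat 1 + t *\<^sub>R U else mat 1)"
  have "h t \<in> H_group r" for t
  proof (cases "t\<^sup>2 * n < 1")
    case True
    define p where "p = sqrt (1 - t\<^sup>2 * n)"
    have p: "p\<^sup>2 = 1 - t\<^sup>2 * n" using True p_def by simp
    have "h t = p *\<^sub>R mat 1 + t *\<^sub>R U" using True h_def p_def by simp
    then have h: "h t $ 1 $ 1 = p + t *\<^sub>R (lgx r X $ 1 $ 1)" "h t $ 2 $ 1 = t *\<^sub>R (lgx r X $ 2 $ 1)"
        "h t $ 1 $ 2 = t *\<^sub>R (lgx r X $ 1 $ 2)" "h t $ 2 $ 2 = p + t *\<^sub>R (lgx r X $ 2 $ 2)"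
      by (simp_all add: U scaleR_complex)
    have "(cmod (h t $ 1 $ 1))\<^sup>2 = p\<^sup>2 + t\<^sup>2 * (X$0)\<^sup>2 / 4"
      unfolding h cmod_power2 using assms(1) by (auto simp: lgx_def power2_eq_square)
    moreover have "(cmod (h t $ 2 $ 1))\<^sup>2 = t\<^sup>2 * ((X$1)\<^sup>2 + (X$2)\<^sup>2) / 4"
      unfolding h cmod_power2 using assms(1) by (auto simp: lgx_def power2_eq_square field_simps)
    ultimately have "(cmod (h t $ 1 $ 1))\<^sup>2 + (-1)^r * (cmod (h t $ 2 $ 1))\<^sup>2 = 1"
      using assms(1) p by (auto simp: n_def field_simps)
    then show ?thesis using assms(1) unfolding H_group_iff[OF assms(1)]
      by (auto simp: h lgx_def complex_eq_iff)
  qed (simp add: h_def H_group_one)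
  moreover have "h 0 = mat 1" by (simp add: h_def)
  moreover have "(h has_vector_derivative U) (at 0)"
  proof (rule has_vector_derivative_transform_within_open)
    show "((\<lambda>t. sqrt (1 - t\<^sup>2 * n) *\<^sub>R mat 1 + t *\<^sub>R U) has_vector_derivative U) (at 0)"
    proof -
      have "((\<lambda>t. sqrt (1 - t\<^sup>2 * n)) has_real_derivative 0) (at 0)"
        by (auto intro!: derivative_eq_intros)
      from has_vector_derivative_add[OF
          has_vector_derivative_scaleR[OF this has_vector_derivative_const[of "mat 1"]]
          has_vector_derivative_scaleR[OF DERIV_ident has_vector_derivative_const[of U]]]
      show ?thesis by simp
    qed
    show "open {t::real. t\<^sup>2 * n < 1}" by (intro open_Collect_less continuous_intros)
  qed (auto simp: h_def)
  ultimately show ?thesis unfolding H_curve_def by blast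
qed

text \<open>On trace-free matrices the adjugate is the negative, so the product rule applied to
  \<open>h ** gam r Y ** adj2 h\<close> gives the commutator.\<close>

lemma lam_star_eq:
  assumes "r \<in> {0, 1}" "U \<in> H_lie r"
  shows "lam_star r U Y = gam_inv r (U ** gam r Y - gam r Y ** U)"
  unfolding lam_star_def
proof (rule the_equality)
  note bb = bounded_bilinear_matrix2_mult
  show *: "\<forall>h. H_curve r h U \<longrightarrow>
    ((\<lambda>t. lam r (h t) Y) has_vector_derivative gam_inv r (U ** gam r Y - gam r Y ** U)) (at 0)"
  proof (intro allI impI)
    fix h assume h: "H_curve r h U"
    then have H: "\<And>t. h t \<in> H_group r" and h0: "h 0 = mat 1"
      and d: "(h has_vector_derivative U) (at 0)" by (auto simp: H_curve_def)
    have "U$1$1 + U$2$2 = 0" using assms(2) by (auto simp: H_lie_def trace_def sum_2)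
    then have aU: "adj2 U = - U"
      by (auto simp: matrix2_eq_iff adj2_def eq_neg_iff_add_eq_0 add.commute)
    have a1: "adj2 (mat 1) = mat 1" by (simp add: matrix2_eq_iff adj2_def)
    have "((\<lambda>t. h t ** gam r Y ** adj2 (h t)) has_vector_derivative
       (h 0 ** gam r Y ** adj2 U + (h 0 ** 0 + U ** gam r Y) ** adj2 (h 0))) (at 0)"
      by (intro bounded_bilinear.has_vector_derivative[OF bb]
          bounded_linear.has_vector_derivative[OF bounded_linear_adj2] d has_vector_derivative_const)
    then have "((\<lambda>t. h t ** gam r Y ** adj2 (h t)) has_vector_derivative
       (U ** gam r Y - gam r Y ** U)) (at 0)"
      by (simp add: h0 a1 aU bounded_bilinear.minus_right[OF bb] bounded_bilinear.zero_right[OF bb])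
    from bounded_linear.has_vector_derivative[OF bounded_linear_gam_inv this, of r]
    show "((\<lambda>t. lam r (h t) Y) has_vector_derivative gam_inv r (U ** gam r Y - gam r Y ** U)) (at 0)"
      by (simp add: lam_eq[OF assms(1) H])
  qed
  fix Z assume Z: "\<forall>h. H_curve r h U \<longrightarrow> ((\<lambda>t. lam r (h t) Y) has_vector_derivative Z) (at 0)"
  obtain h where "H_curve r h U" using H_curve_exists[OF assms] by blast
  then show "Z = gam_inv r (U ** gam r Y - gam r Y ** U)"
    using * Z vector_derivative_unique_at by blast
qed

text \<open>The components are the cofactors of Z in the determinant; the sign in component 0
  cancels the one carried by \<open>ip\<close>. Testing against the three axis vectors gives
  uniqueness.\<close>

lemma cross_eq:
  assumes "r \<in> {0, 1}"
  shows "cross r X Y = (\<chi> i. if i = 0 then (-1)^r * (X$1 * Y$2 - X$2 * Y$1)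
    else if i = 1 then X$2 * Y$0 - X$0 * Y$2 else X$0 * Y$1 - X$1 * Y$0)" (is "_ = ?W")
  unfolding cross_def
proof (rule the_equality)
  have t: "(3::3) = 0" by simp
  have v: "vol X Y Z = (X$1 * Y$2 - X$2 * Y$1) * Z$0 + (X$2 * Y$0 - X$0 * Y$2) * Z$1
    + (X$0 * Y$1 - X$1 * Y$0) * Z$2" for Z
    using vector_3[of X Y Z] unfolding vol_def det_3 t by (simp add: algebra_simps)
  show *: "\<forall>Z. ip r ?W Z = vol X Y Z"
    using assms by (auto simp: v ip_def algebra_simps)
  fix W assume "\<forall>Z. ip r W Z = vol X Y Z"
  then have e: "ip r W Z = ip r ?W Z" for Z using * by simp
  have "W$0 = ?W$0" using e[of "axis 0 1"] assms by (auto simp: ip_def axis_def)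
  moreover have "W$1 = ?W$1" using e[of "axis 1 1"] assms by (auto simp: ip_def axis_def)
  moreover have "W$2 = ?W$2" using e[of "axis 2 1"] assms by (auto simp: ip_def axis_def)
  ultimately show "W = ?W" unfolding vec_eq_iff forall_3_0 by blast
qed

lemma lam_star_lgx:
  assumes "r \<in> {0, 1}"
  shows "lam_star r (lgx r X) Y = cross r X Y"
  unfolding lam_star_eq[OF assms lgx_in_H_lie[OF assms]] cross_eq[OF assms]
  using assms by (auto simp: vec_eq_iff forall_3_0 gam_inv_def lgx_def matrix2_mult_nth field_simps)

text \<open>A single product loses the component along its second factor: the product with axis 1
  shows components 0 and 2, and the product with axis 0 supplies component 1.\<close>

lemma cross_inj:
  assumes "r \<in> {0, 1}" "\<And>Y. cross r X Y = cross r X' Y"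
  shows "X = X'"
proof -
  have "X$0 = X'$0" "X$2 = X'$2"
    using assms(2)[of "axis 1 1"] assms(1)
    by (auto simp: cross_eq vec_eq_iff forall_3_0 axis_def)
  moreover have "X$1 = X'$1"
    using assms(2)[of "axis 0 1"] assms(1)
    by (auto simp: cross_eq vec_eq_iff forall_3_0 axis_def)
  ultimately show ?thesis by (simp add: vec_eq_iff forall_3_0)
qed

lemma lg_eq_lgx:
  assumes "r \<in> {0, 1}"
  shows "lg r X = lgx r X"
  unfolding lg_def
proof (rule the_equality)
  show "lgx r X \<in> H_lie r \<and> (\<forall>Y. lam_star r (lgx r X) Y = cross r X Y)"
    using lgx_in_H_lie lam_star_lgx assms by blast
  fix U assume "U \<in> H_lie r \<and> (\<forall>Y. lam_star r U Y = cross r X Y)"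
  then show "U = lgx r X"
    using lgx_lgx_inv[OF assms] lam_star_lgx[OF assms] cross_inj[OF assms] by metis
qed

lemma lg_inv_lgx:
  assumes "r \<in> {0, 1}"
  shows "lg_inv r (lgx r X) = X"
  unfolding lg_inv_def lg_eq_lgx[OF assms]
  using lgx_inv_lgx[OF assms] by (intro the_equality) metis+

lemma lg_inv_eq:
  assumes "r \<in> {0, 1}" "U \<in> H_lie r"
  shows "lg_inv r U = lgx_inv r U"
  using lg_inv_lgx[OF assms(1)] lgx_lgx_inv[OF assms] by metis

definition unit_vec :: "real \<Rightarrow> complex^2" where
  "unit_vec \<epsilon> = (if \<epsilon> = 1 then vector [1, 0] else vector [0, 1])"

text \<open>The column selected by \<open>unit_vec \<epsilon>\<close> is \<open>v\<close>; the other
  column is forced by the entry relations of \<open>H_group_iff\<close>. The second branch is meant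
  for timelike \<open>v\<close>, that is for r = 1.\<close>

definition vec_group :: "nat \<Rightarrow> real \<Rightarrow> complex^2 \<Rightarrow> complex^2^2" where
  "vec_group r \<epsilon> v = (if \<epsilon> = 1 then mat2 (v$1) (- ((-1)^r) * cnj (v$2)) (v$2) (cnj (v$1))
     else mat2 (cnj (v$2)) (v$1) (cnj (v$1)) (v$2))"

lemma unit_vec_nth [simp]:
  "unit_vec \<epsilon> $ 1 = (if \<epsilon> = 1 then 1 else 0)" "unit_vec \<epsilon> $ 2 = (if \<epsilon> = 1 then 0 else 1)"
  by (simp_all add: unit_vec_def)

lemma herm_eq:
  assumes "r \<in> {0, 1}"
  shows "herm r v w = cnj (v$1) * w$1 + (-1)^r * (cnj (v$2) * w$2)"
  using assms by (auto simp: herm_def sum_2 matrix2_vector_mult_nth herm_mat_nth)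

lemma herm_unit_vec:
  "r \<in> {0, 1} \<Longrightarrow> \<epsilon> \<in> signs r \<Longrightarrow> herm r (unit_vec \<epsilon>) (unit_vec \<epsilon>) = complex_of_real \<epsilon>"
  by (auto simp: herm_eq signs_def split: if_splits)

text \<open>The entry relations hold by construction, and the remaining determinant condition is the
  normalization of \<open>v\<close>, up to the sign \<epsilon>.\<close>

lemma vec_group_in_H:
  assumes "r \<in> {0, 1}" "\<epsilon> \<in> signs r" "herm r v v = complex_of_real \<epsilon>"
  shows "vec_group r \<epsilon> v \<in> H_group r"
proof -
  have "complex_of_real ((cmod (v$1))\<^sup>2 + (-1)^r * (cmod (v$2))\<^sup>2) = complex_of_real \<epsilon>"
    using assms(3) unfolding herm_eq[OF assms(1)] of_real_add of_real_mult complex_norm_square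
    by (simp add: algebra_simps)
  then have "(cmod (v$1))\<^sup>2 + (-1)^r * (cmod (v$2))\<^sup>2 = \<epsilon>" using of_real_eq_iff by blast
  then show ?thesis
    using assms(1,2) unfolding H_group_iff[OF assms(1)]
    by (auto simp: vec_group_def signs_def split: if_splits)
qed

lemma vec_group_unit_vec: "vec_group r \<epsilon> v *v unit_vec \<epsilon> = v"
  by (simp add: vec_eq_iff forall_2 matrix2_vector_mult_nth vec_group_def)

lemma bounded_linear_vec_group: "bounded_linear (vec_group r \<epsilon>)"
  unfolding linear_conv_bounded_linear[symmetric]
  by (rule linearI) (simp_all add: matrix2_eq_iff vec_group_def algebra_simps)

text \<open>Fixing \<open>unit_vec \<epsilon>\<close> prescribes one column, and one column
  determines an element of \<open>H\<close>.\<close>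

lemma H_group_stabilizer:
  assumes "r \<in> {0, 1}" "\<epsilon> \<in> signs r" "h \<in> H_group r" "h *v unit_vec \<epsilon> = unit_vec \<epsilon>"
  shows "h = mat 1"
  using assms(4,3,1) unfolding H_group_iff[OF assms(1)]
  by (auto simp: vec_eq_iff forall_2 matrix2_vector_mult_nth split: if_splits)

text \<open>Applying \<open>lgx r X\<close> to \<open>unit_vec \<epsilon>\<close> extracts a column,
  and the real and imaginary parts of either column contain all three coordinates of X.\<close>

lemma H_lie_unit_vec_inj:
  assumes "r \<in> {0, 1}" "U \<in> H_lie r" "W \<in> H_lie r" "U *v unit_vec \<epsilon> = W *v unit_vec \<epsilon>"
  shows "U = W"
proof -
  have "lgx r (lgx_inv r U) *v unit_vec \<epsilon> = lgx r (lgx_inv r W) *v unit_vec \<epsilon>"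
    using assms lgx_lgx_inv by simp
  then have "lgx_inv r U = lgx_inv r W"
    using assms(1) unfolding vec_eq_iff forall_2 forall_3_0
    by (auto simp: matrix2_vector_mult_nth lgx_def complex_eq_iff split: if_splits)
  then show ?thesis using lgx_lgx_inv assms by metis
qed

lemma herm_invariant:
  assumes "r \<in> {0, 1}" "h \<in> H_group r"
  shows "herm r (h *v v) (h *v w) = herm r v w"
proof -
  have g: "dagger h ** herm_mat r ** h = herm_mat r" using assms(2) by (auto simp: H_group_def)
  have "herm r v w = (\<Sum>i\<in>UNIV. cnj (v $ i) * ((dagger h ** herm_mat r ** h) *v w) $ i)"
    unfolding herm_def g ..
  also have "\<dots> = herm r (h *v v) (h *v w)"
    unfolding herm_def
    by (simp add: sum_2 matrix2_vector_mult_nth matrix2_mult_nth algebra_simps)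
  finally show ?thesis by simp
qed

lemma gam_clifford:
  "\<i> ^ r *s (gam r X *v v) = (2 *\<^sub>R lgx r X) *v v"
  by (simp add: vec_eq_iff forall_2 matrix2_vector_mult_nth lgx_def scaleR_complex algebra_simps)


section \<open>Sections of the spin bundle and the connection\<close>

lemma has_derivative_cong_eventually:
  assumes "(f has_derivative D) (at x)" "\<forall>\<^sub>F y in nhds x. f y = g y"
  shows "(g has_derivative D) (at x)"
proof -
  obtain W where "open W" "x \<in> W" "\<And>y. y \<in> W \<Longrightarrow> f y = g y"
    using assms(2) unfolding eventually_nhds by blast
  then show ?thesis using has_derivative_transform_within_open[OF assms(1)] by blast
qed

lemma mdiff_cong:
  assumes A: "smooth_atlas A" and "\<forall>\<^sub>F q in nhds p. f q = g q"
    and d: "((\<lambda>y. snd (chart_at B (f p)) (f (cinv (chart_at A p) y))) has_derivative D)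
      (at (snd (chart_at A p) p))"
  shows "mdiff A B f p = mdiff A B g p"
proof -
  have fg: "f p = g p" using assms(2) eventually_nhds_x_imp_x by fastforce
  have "\<forall>\<^sub>F y in nhds (snd (chart_at A p) p). f (cinv (chart_at A p) y) = g (cinv (chart_at A p) y)"
    by (rule eventually_cinv[OF A chart_at_in[OF A] chart_at_mem[OF A] assms(2)])
  then have "((\<lambda>y. snd (chart_at B (g p)) (g (cinv (chart_at A p) y))) has_derivative D)
      (at (snd (chart_at A p) p))"
    using d unfolding fg
    by (elim has_derivative_cong_eventually) (auto elim: eventually_mono)
  from mdiff_eq[OF this] mdiff_eq[OF d] show ?thesis by simp
qed

lemma mdiff_const:
  assumes "smooth_atlas A" "smooth_atlas B"
  shows "mdiff A B (\<lambda>x. b) p X = 0"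
  using mdiff_eq[of B "\<lambda>x. b" p A "\<lambda>x. 0"] by simp

lemma ip_nondegenerate:
  assumes "r \<in> {0, 1}" "\<And>Y. ip r X Y = 0"
  shows "X = 0"
  using assms(1) assms(2)[of "axis 0 1"] assms(2)[of "axis 1 1"] assms(2)[of "axis 2 1"]
  by (auto simp: ip_def axis_def vec_eq_iff forall_3_0)

lemma ip_commute: "ip r X Y = ip r Y X"
  by (simp add: ip_def)

lemma linear_ip: "linear (\<lambda>X. ip r X Y)"
  by (rule linearI) (simp_all add: ip_def algebra_simps)

locale spin_manifold =
  fixes S :: "('m::{t2_space, second_countable_topology},
      'p::{t2_space, second_countable_topology}) spin_data"
    and \<omega> :: "'p \<Rightarrow> real^6 \<Rightarrow> complex^2^2"
  assumes idx: "idx S \<in> {0, 1}"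
    and spin: "spin_structure S"
    and levi_civita: "spin_levi_civita S \<omega>"
begin

abbreviation "H \<equiv> H_group (idx S)"
abbreviation "MA \<equiv> base_at S"
abbreviation "PA \<equiv> tot_at S"

lemma principal: "principal_bundle S" and riemannian: "pseudo_riemannian S"
  and covering: "smooth_double_covering PA UNIV (frame_atlas MA) (on_frames S)
    (\<lambda>u. (prj S u, frm S u))"
  and frm_act: "h \<in> H \<Longrightarrow> frm S (act S u h) = frm S u \<circ> lam (idx S) h"
  using spin unfolding spin_structure_def by auto

lemma base_atlas: "smooth_atlas MA"
  using riemannian unfolding pseudo_riemannian_def by (elim conjE)

lemma tot_atlas: "smooth_atlas PA"
  and prj_smooth: "smooth_map PA UNIV MA (prj S)"
  and act_smooth: "smooth_map (prod_atlas PA (H_atlas (idx S))) (UNIV \<times> H) PA (\<lambda>(u, h). act S u h)"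
proof -
  note p = principal[unfolded principal_bundle_def]
  show "smooth_atlas PA" "smooth_map PA UNIV MA (prj S)"
    using p[THEN conjunct1] p[THEN conjunct2, THEN conjunct1] .
  show "smooth_map (prod_atlas PA (H_atlas (idx S))) (UNIV \<times> H) PA (\<lambda>(u, h). act S u h)"
    using p[THEN conjunct2, THEN conjunct2, THEN conjunct1] .
qed

lemma act_one: "act S u (mat 1) = u"
  and act_mult: "h \<in> H \<Longrightarrow> k \<in> H \<Longrightarrow> act S (act S u h) k = act S u (h ** k)"
  and prj_act: "h \<in> H \<Longrightarrow> prj S (act S u h) = prj S u"
  and trivialization: "\<exists>V \<Psi>. open V \<and> x \<in> V \<and>
        diffeo (prod_atlas MA (H_atlas (idx S))) (V \<times> H) PA (prj S -` V) \<Psi> \<and>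
        (\<forall>y\<in>V. \<forall>h\<in>H. prj S (\<Psi> (y, h)) = y) \<and>
        (\<forall>y\<in>V. \<forall>h\<in>H. \<forall>k\<in>H. \<Psi> (y, h ** k) = act S (\<Psi> (y, h)) k)"
proof -
  note p = principal[unfolded principal_bundle_def, THEN conjunct2, THEN conjunct2, THEN conjunct2]
  show "act S u (mat 1) = u" using p[THEN conjunct1] by blast
  show "h \<in> H \<Longrightarrow> k \<in> H \<Longrightarrow> act S (act S u h) k = act S u (h ** k)"
    using p[THEN conjunct2, THEN conjunct1] by blast
  show "h \<in> H \<Longrightarrow> prj S (act S u h) = prj S u"
    using p[THEN conjunct2, THEN conjunct2, THEN conjunct1] by blast
  show "\<exists>V \<Psi>. open V \<and> x \<in> V \<and>
        diffeo (prod_atlas MA (H_atlas (idx S))) (V \<times> H) PA (prj S -` V) \<Psi> \<and>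
        (\<forall>y\<in>V. \<forall>h\<in>H. prj S (\<Psi> (y, h)) = y) \<and>
        (\<forall>y\<in>V. \<forall>h\<in>H. \<forall>k\<in>H. \<Psi> (y, h ** k) = act S (\<Psi> (y, h)) k)"
    using p[THEN conjunct2, THEN conjunct2, THEN conjunct2] by (rule spec)
qed

text \<open>In a local trivialization the action is right multiplication of the group on itself,
  where one can cancel.\<close>

lemma act_inj:
  assumes "h \<in> H" "k \<in> H" "act S u h = act S u k"
  shows "h = k"
proof -
  obtain V \<Psi> where V: "prj S u \<in> V"
    and d: "diffeo (prod_atlas MA (H_atlas (idx S))) (V \<times> H) PA (prj S -` V) \<Psi>"
    and \<Psi>: "\<forall>y\<in>V. \<forall>h\<in>H. \<forall>k\<in>H. \<Psi> (y, h ** k) = act S (\<Psi> (y, h)) k"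
    using trivialization[of "prj S u"] by (elim exE conjE)
  have i: "inj_on \<Psi> (V \<times> H)" and im: "\<Psi> ` (V \<times> H) = prj S -` V"
    using d unfolding diffeo_def bij_betw_def by auto
  have "u \<in> \<Psi> ` (V \<times> H)" unfolding im using V by simp
  then obtain y g where y: "y \<in> V" "g \<in> H" "u = \<Psi> (y, g)" by blast
  then have "\<Psi> (y, g ** h) = \<Psi> (y, g ** k)" using \<Psi> assms by simp
  then have "(y, g ** h) = (y, g ** k)"
    by (rule inj_onD[OF i]) (use y assms H_group_mult in auto)
  then have "matrix_inv g ** g ** h = matrix_inv g ** g ** k" by (simp add: matrix_mul_assoc[symmetric])
  then show ?thesis using H_group_inv(3)[OF y(2)] by simp
qed

text \<open>The product charts of P and \<open>H\<close> have non-open images, so the action cannot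
  be differentiated directly in them. \<open>G\<close> is a smooth ambient map near the given pair
  which is the chart expression of the action wherever the second argument lies in
  \<open>H\<close>.\<close>

lemma act_local:
  assumes h: "h \<in> H" and c: "c \<in> PA" "u \<in> fst c" and d: "d \<in> PA" "act S u h \<in> fst d"
  obtains G where "smooth_at G (snd c u, h)"
    "\<forall>\<^sub>F z in nhds (snd c u, h). snd z \<in> H \<longrightarrow>
      act S (cinv c (fst z)) (snd z) \<in> fst d \<and> G z = snd d (act S (cinv c (fst z)) (snd z))"
proof -
  define c' where "c' = (fst c \<times> H, map_prod (snd c) (id :: complex^2^2 \<Rightarrow> _))"
  define f where "f = (\<lambda>(u, h). act S u h)"
  define T where "T = snd c' ` {p \<in> (UNIV \<times> H) \<inter> fst c'. f p \<in> fst d}"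
  note inj = inj_on_chart[OF tot_atlas c(1)]
  have c'in: "c' \<in> prod_atlas PA (H_atlas (idx S))"
    unfolding prod_atlas_def H_atlas_def c'_def
    by (intro CollectI exI[of _ c] exI[of _ "(H, id)"]) (use c(1) in auto)
  have inj': "inj_on (snd c') (fst c')"
    using inj by (auto simp: c'_def inj_on_def)
  have ci: "cinv c' (snd c q, k) = (q, k)" if "q \<in> fst c" "k \<in> H" for q k
    using cinv_chart[OF inj', of "(q, k)"] that by (simp add: c'_def)
  have T_alt: "T = snd c' ` ({p \<in> UNIV \<times> H. f p \<in> fst d} \<inter> fst c')" unfolding T_def by auto
  have "openin (top_of_set (snd c' ` ((UNIV \<times> H) \<inter> fst c'))) T"
    using act_smooth d(1) c'in unfolding smooth_map_def atlas_open_def T_alt f_def by blast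
  then obtain Q where Q: "open Q" "T = snd c' ` ((UNIV \<times> H) \<inter> fst c') \<inter> Q"
    unfolding openin_open by blast
  have uT: "(snd c u, h) \<in> T" unfolding T_def
    by (rule image_eqI[of _ _ "(u, h)"]) (use c d h in \<open>auto simp: c'_def f_def\<close>)
  have "smooth_on T (snd d \<circ> f \<circ> cinv c')"
    using act_smooth d(1) c'in unfolding smooth_map_def T_def f_def by blast
  then obtain G where G: "smooth_at G (snd c u, h)"
    "\<forall>\<^sub>F z in nhds (snd c u, h). z \<in> T \<longrightarrow> G z = (snd d \<circ> f \<circ> cinv c') z"
    using smooth_on_extension uT by blast
  \<comment> \<open>Since \<open>T\<close> is cut out of the product chart image by the open set
    \<open>Q\<close>, membership in \<open>T\<close> near the base point reduces to
    \<open>snd z \<in> H\<close>.\<close>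
  have "\<forall>\<^sub>F z in nhds (snd c u, h). z \<in> Q \<inter> (snd c ` fst c \<times> UNIV)"
    using Q uT open_chart_image[OF tot_atlas c(1)] c(2)
    by (intro eventually_nhds_in_open open_Int open_Times) auto
  with G(2) have "\<forall>\<^sub>F z in nhds (snd c u, h). snd z \<in> H \<longrightarrow>
      act S (cinv c (fst z)) (snd z) \<in> fst d \<and> G z = snd d (act S (cinv c (fst z)) (snd z))"
  proof eventually_elim
    case (elim z)
    show ?case
    proof
      assume k: "snd z \<in> H"
      obtain q where q: "q \<in> fst c" "fst z = snd c q" using elim(2) by auto
      have z: "z = (snd c q, snd z)" using q(2) by (metis prod.collapse)
      have "z \<in> snd c' ` ((UNIV \<times> H) \<inter> fst c')"
        by (rule image_eqI[of _ _ "(q, snd z)"]) (use q k z in \<open>auto simp: c'_def\<close>)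
      then have zT: "z \<in> T" using elim Q(2) by blast
      have ciz: "cinv c' z = (q, snd z)" using ci[OF q(1) k] z by metis
      obtain p where p: "p \<in> fst c'" "f p \<in> fst d" "z = snd c' p" using zT T_def by blast
      have "p = (q, snd z)" using cinv_chart[OF inj' p(1)] p(3) ciz by simp
      then have "act S q (snd z) \<in> fst d" using p(2) by (simp add: f_def)
      moreover have "cinv c (fst z) = q" using cinv_chart[OF inj q(1)] q(2) by simp
      ultimately show "act S (cinv c (fst z)) (snd z) \<in> fst d \<and>
          G z = snd d (act S (cinv c (fst z)) (snd z))"
        using elim(1) zT ciz by (simp add: f_def)
    qed
  qed
  with G(1) show ?thesis by (rule that)
qed

section \<open>The connection form on vertical vectors and along sections\<close>

lemma omega_linear: "linear (\<omega> u)"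
  and omega_smooth: "smooth_one_form PA \<omega>"
  and omega_lie: "\<omega> u \<xi> \<in> H_lie (idx S)"
  and omega_act: "h \<in> H \<Longrightarrow> \<omega> (act S u h) (mdiff PA PA (\<lambda>u. act S u h) u \<xi>) =
    matrix_inv h ** \<omega> u \<xi> ** h"
  and omega_curve: "H_curve (idx S) k U \<Longrightarrow> \<omega> u (mdiff euc PA (\<lambda>t::real. act S u (k t)) 0 1) = U"
  using levi_civita
  unfolding spin_levi_civita_def connection_form_def smooth_one_form_def by blast+

text \<open>The vector is the velocity of the curve \<open>act S u (k t)\<close>, where
  \<open>k\<close> runs in \<open>H\<close> with velocity \<open>U\<close>. The connection axiom
  gives its value under \<omega>, and its projection vanishes because the curve stays in one
  fibre.\<close>

lemma vertical_lift:
  assumes "U \<in> H_lie (idx S)"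
  obtains \<xi> where "\<omega> u \<xi> = U" "mdiff PA MA (prj S) u \<xi> = 0"
proof -
  obtain k where k: "H_curve (idx S) k U" using H_curve_exists[OF idx assms] by blast
  then have kH: "\<And>t. k t \<in> H" and k0: "k 0 = mat 1" and kd: "(k has_vector_derivative U) (at 0)"
    unfolding H_curve_def by auto
  define c where "c = chart_at PA u"
  have c: "c \<in> PA" "u \<in> fst c" using chart_at_in[OF tot_atlas] chart_at_mem[OF tot_atlas] c_def by auto
  obtain G where G: "smooth_at G (snd c u, mat 1)"
    "\<forall>\<^sub>F z in nhds (snd c u, mat 1). snd z \<in> H \<longrightarrow>
      act S (cinv c (fst z)) (snd z) \<in> fst c \<and> G z = snd c (act S (cinv c (fst z)) (snd z))"
    by (rule act_local[OF H_group_one c c(1)]) (auto simp: act_one c(2))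
  have cu: "cinv c (snd c u) = u" using cinv_chart[OF inj_on_chart[OF tot_atlas c(1)] c(2)] .
  have kd': "((\<lambda>t. (snd c u, k t)) has_derivative (\<lambda>t. (0, t *\<^sub>R U))) (at 0)"
    using kd unfolding has_vector_derivative_def by (intro has_derivative_Pair has_derivative_const)
  have "isCont (\<lambda>t. (snd c u, k t)) 0" using kd' has_derivative_continuous by blast
  from eventually_nhds_isCont[OF this, of "\<lambda>z. snd z \<in> H \<longrightarrow>
      act S (cinv c (fst z)) (snd z) \<in> fst c \<and> G z = snd c (act S (cinv c (fst z)) (snd z))"]
  have ev: "\<forall>\<^sub>F t in nhds 0. act S u (k t) \<in> fst c \<and> G (snd c u, k t) = snd c (act S u (k t))"
    using G(2) k0 by (simp add: cu kH)
  define \<xi> where "\<xi> = mdiff euc PA (\<lambda>t::real. act S u (k t)) 0 1"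
  have GD: "(G has_derivative frechet_derivative G (at (snd c u, mat 1))) (at (snd c u, k 0))"
    using smooth_at_has_derivative[OF G(1)] k0 by simp
  have d: "((\<lambda>t. snd c (act S u (k t))) has_derivative
      (\<lambda>t. frechet_derivative G (at (snd c u, mat 1)) (0, t *\<^sub>R U))) (at 0)"
    by (rule has_derivative_cong_eventually[OF has_derivative_compose[OF kd' GD]])
       (use ev in \<open>auto elim: eventually_mono\<close>)
  have "mdiff euc PA (\<lambda>t::real. act S u (k t)) 0 =
      (\<lambda>t. frechet_derivative G (at (snd c u, mat 1)) (0, t *\<^sub>R U))"
    by (rule mdiff_eq) (use d in \<open>simp add: chart_at_euc k0 act_one c_def\<close>)
  then have \<xi>: "\<xi> = frechet_derivative G (at (snd c u, mat 1)) (0, U)" by (simp add: \<xi>_def)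
  let ?m = "chart_at MA (prj S u)"
  have pd: "((\<lambda>y. snd ?m (prj S (cinv c y))) has_derivative mdiff PA MA (prj S) u)
      (at (snd c (act S u (k 0))))"
    using has_derivative_mdiff[OF tot_atlas base_atlas atlas_open_UNIV[OF tot_atlas] prj_smooth, of u]
    by (simp add: c_def k0 act_one)
  have 1: "((\<lambda>t. snd ?m (prj S (cinv c (snd c (act S u (k t)))))) has_derivative
      (\<lambda>t. mdiff PA MA (prj S) u (frechet_derivative G (at (snd c u, mat 1)) (0, t *\<^sub>R U)))) (at 0)"
    by (rule has_derivative_compose[OF d pd])
  have 2: "((\<lambda>t. snd ?m (prj S u)) has_derivative (\<lambda>t. 0)) (at (0::real))" by simp
  have "\<forall>\<^sub>F t in nhds 0. snd ?m (prj S (cinv c (snd c (act S u (k t))))) = snd ?m (prj S u)"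
    using ev by eventually_elim
      (simp add: cinv_chart[OF inj_on_chart[OF tot_atlas c(1)]] prj_act kH)
  from fun_cong[OF has_derivative_eventually_unique[OF 1 2 this], of 1]
  have "mdiff PA MA (prj S) u \<xi> = 0" by (simp add: \<xi>)
  moreover have "\<omega> u \<xi> = U" using omega_curve[OF k] \<xi>_def by simp
  ultimately show ?thesis using that by blast
qed

text \<open>The product rule \<open>\<omega>(d(sh)) = h\<^sup>-\<^sup>1 \<omega>(ds) h + h\<^sup>-\<^sup>1 dh\<close>. The second term comes from the curve
  \<open>t \<mapsto> h(x)\<^sup>-\<^sup>1 h(x + tX)\<close>, extended by \<open>1\<close> outside the chart; this is a legitimate \<open>H_curve\<close>
  because differentiability is only required at \<open>0\<close>.\<close>

lemma section_act:
  assumes s: "local_section S V s"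
    and hH: "\<And>x. x \<in> V \<Longrightarrow> h x \<in> H"
    and hs: "\<And>x c. x \<in> V \<Longrightarrow> c \<in> MA \<Longrightarrow> x \<in> fst c \<Longrightarrow> smooth_at (\<lambda>y. h (cinv c y)) (snd c x)"
  shows section_act_section: "local_section S V (\<lambda>x. act S (s x) (h x))"
    and omega_section_act: "\<And>x X. x \<in> V \<Longrightarrow>
      \<omega> (act S (s x) (h x)) (mdiff MA PA (\<lambda>x. act S (s x) (h x)) x X) =
      matrix_inv (h x) ** \<omega> (s x) (mdiff MA PA s x X) ** h x + matrix_inv (h x) **
        frechet_derivative (\<lambda>y. h (cinv (chart_at MA x) y)) (at (snd (chart_at MA x) x)) X"
proof -
  have V: "open V" and prj: "\<And>x. x \<in> V \<Longrightarrow> prj S (s x) = x" and sm: "smooth_map MA V PA s"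
    using s unfolding local_section_def by auto
  note Va = open_imp_atlas_open[OF base_atlas V]
  define \<sigma> where "\<sigma> = (\<lambda>x. act S (s x) (h x))"
  \<comment> \<open>The same \<open>G\<close> is to represent three things: the section \<sigma>,
    the right translation by \<open>h x\<close>, and a curve in the fibre through
    \<open>\<sigma> x\<close>. Hence both the property on the product and its specialization along
    the section are kept.\<close>
  have loc: "\<exists>G. smooth_at G (snd e (s x), h x) \<and>
      (\<forall>\<^sub>F z in nhds (snd e (s x), h x). snd z \<in> H \<longrightarrow>
        act S (cinv e (fst z)) (snd z) \<in> fst d \<and> G z = snd d (act S (cinv e (fst z)) (snd z))) \<and>
      (\<forall>\<^sub>F y in nhds (snd c x). \<sigma> (cinv c y) \<in> fst d \<and>
        G (snd e (s (cinv c y)), h (cinv c y)) = snd d (\<sigma> (cinv c y)))"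
    if x: "x \<in> V" "c \<in> MA" "x \<in> fst c" and e: "e \<in> PA" "s x \<in> fst e" and d: "d \<in> PA" "\<sigma> x \<in> fst d"
    for x c d e
  proof -
    obtain G where G: "smooth_at G (snd e (s x), h x)" and Ge:
      "\<forall>\<^sub>F z in nhds (snd e (s x), h x). snd z \<in> H \<longrightarrow>
        act S (cinv e (fst z)) (snd z) \<in> fst d \<and> G z = snd d (act S (cinv e (fst z)) (snd z))"
      using act_local[OF hH[OF x(1)] e d(1)] d(2) unfolding \<sigma>_def by blast
    have cx: "cinv c (snd c x) = x" using cinv_chart[OF inj_on_chart[OF base_atlas x(2)] x(3)] .
    have "smooth_at (\<lambda>y. (snd e (s (cinv c y)), h (cinv c y))) (snd c x)"
      by (intro smooth_at_Pair hs x smooth_map_smooth_at[OF base_atlas Va sm] e)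
    from eventually_nhds_isCont[OF smooth_at_continuous[OF this], of "\<lambda>z. snd z \<in> H \<longrightarrow>
        act S (cinv e (fst z)) (snd z) \<in> fst d \<and> G z = snd d (act S (cinv e (fst z)) (snd z))"]
    have "\<forall>\<^sub>F y in nhds (snd c x). h (cinv c y) \<in> H \<longrightarrow>
        act S (cinv e (snd e (s (cinv c y)))) (h (cinv c y)) \<in> fst d \<and>
        G (snd e (s (cinv c y)), h (cinv c y)) =
          snd d (act S (cinv e (snd e (s (cinv c y)))) (h (cinv c y)))"
      using Ge by (simp add: cx)
    with smooth_map_eventually[OF base_atlas Va sm x(1,2) e(1) x(3) e(2)]
    have "\<forall>\<^sub>F y in nhds (snd c x). \<sigma> (cinv c y) \<in> fst d \<and>
        G (snd e (s (cinv c y)), h (cinv c y)) = snd d (\<sigma> (cinv c y))"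
    proof eventually_elim
      case (elim y)
      have q: "cinv e (snd e (s (cinv c y))) = s (cinv c y)"
        by (rule cinv_chart[OF inj_on_chart[OF tot_atlas e(1)]]) (use elim in blast)
      have "h (cinv c y) \<in> H" using elim hH by blast
      then show ?case using elim(2) unfolding q \<sigma>_def by blast
    qed
    with G Ge show ?thesis by blast
  qed
  show sec: "local_section S V (\<lambda>x. act S (s x) (h x))"
    unfolding local_section_def \<sigma>_def[symmetric]
  proof (intro conjI ballI V)
    show "prj S (\<sigma> x) = x" if "x \<in> V" for x using prj_act[OF hH[OF that]] prj[OF that] \<sigma>_def by simp
    show "smooth_map MA V PA \<sigma>"
    proof (rule smooth_mapI[OF base_atlas Va])
      fix p
      show "\<exists>d\<in>PA. \<sigma> p \<in> fst d" using chart_at_in[OF tot_atlas] chart_at_mem[OF tot_atlas] by blast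
    next
      fix x c d assume *: "x \<in> V" "c \<in> MA" "d \<in> PA" "x \<in> fst c" "\<sigma> x \<in> fst d"
      define e where "e = chart_at PA (s x)"
      have e: "e \<in> PA" "s x \<in> fst e" using chart_at_in[OF tot_atlas] chart_at_mem[OF tot_atlas] e_def by auto
      obtain G where G: "smooth_at G (snd e (s x), h x)" and
        ev: "\<forall>\<^sub>F y in nhds (snd c x). \<sigma> (cinv c y) \<in> fst d \<and>
        G (snd e (s (cinv c y)), h (cinv c y)) = snd d (\<sigma> (cinv c y))"
        using loc[OF *(1,2,4) e *(3,5)] by blast
      show "\<forall>\<^sub>F y in nhds (snd c x). \<sigma> (cinv c y) \<in> fst d" using ev by eventually_elim blast
      have cx: "cinv c (snd c x) = x" using cinv_chart[OF inj_on_chart[OF base_atlas *(2)] *(4)] .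
      have p: "smooth_at (\<lambda>y. (snd e (s (cinv c y)), h (cinv c y))) (snd c x)"
        by (intro smooth_at_Pair hs * smooth_map_smooth_at[OF base_atlas Va sm] e)
      have "smooth_at (\<lambda>y. G (snd e (s (cinv c y)), h (cinv c y))) (snd c x)"
        by (rule smooth_at_compose[OF p]) (simp add: cx G)
      then show "smooth_at (\<lambda>y. snd d (\<sigma> (cinv c y))) (snd c x)"
        by (rule smooth_at_cong) (use ev in \<open>auto elim: eventually_mono\<close>)
    qed
  qed
  show "\<omega> (act S (s x) (h x)) (mdiff MA PA (\<lambda>x. act S (s x) (h x)) x X) =
      matrix_inv (h x) ** \<omega> (s x) (mdiff MA PA s x X) ** h x + matrix_inv (h x) **
        frechet_derivative (\<lambda>y. h (cinv (chart_at MA x) y)) (at (snd (chart_at MA x) x)) X"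
    if x: "x \<in> V" for x X
  proof -
    define c where "c = chart_at MA x"
    define e where "e = chart_at PA (s x)"
    define d where "d = chart_at PA (\<sigma> x)"
    define Dh where "Dh = frechet_derivative (\<lambda>y. h (cinv c y)) (at (snd c x))"
    define Ds where "Ds = mdiff MA PA s x"
    have c: "c \<in> MA" "x \<in> fst c"
      using chart_at_in[OF base_atlas] chart_at_mem[OF base_atlas] c_def by auto
    have e: "e \<in> PA" "s x \<in> fst e" and d: "d \<in> PA" "\<sigma> x \<in> fst d"
      using chart_at_in[OF tot_atlas] chart_at_mem[OF tot_atlas] e_def d_def by auto
    obtain G where G: "smooth_at G (snd e (s x), h x)" and Ge:
      "\<forall>\<^sub>F z in nhds (snd e (s x), h x). snd z \<in> H \<longrightarrow>
        act S (cinv e (fst z)) (snd z) \<in> fst d \<and> G z = snd d (act S (cinv e (fst z)) (snd z))"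
      and ev: "\<forall>\<^sub>F y in nhds (snd c x). \<sigma> (cinv c y) \<in> fst d \<and>
        G (snd e (s (cinv c y)), h (cinv c y)) = snd d (\<sigma> (cinv c y))"
      using loc[OF x c e d] by blast
    define DG where "DG = frechet_derivative G (at (snd e (s x), h x))"
    have GD: "(G has_derivative DG) (at (snd e (s x), h x))"
      using smooth_at_has_derivative[OF G] DG_def by simp
    have DGl: "linear DG" using GD has_derivative_linear by blast
    have cx: "cinv c (snd c x) = x" using cinv_chart[OF inj_on_chart[OF base_atlas c(1)] c(2)] .
    have es: "cinv e (snd e (s x)) = s x" using cinv_chart[OF inj_on_chart[OF tot_atlas e(1)] e(2)] .
    have hD: "((\<lambda>y. h (cinv c y)) has_derivative Dh) (at (snd c x))"
      using smooth_at_has_derivative[OF hs[OF x c]] Dh_def by simp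
    have sD: "((\<lambda>y. snd e (s (cinv c y))) has_derivative Ds) (at (snd c x))"
      using has_derivative_mdiff[OF base_atlas tot_atlas Va sm x] unfolding c_def e_def Ds_def .
    \<comment> \<open>The derivative of the section is \<open>DG\<close> on the pair of derivatives
      of \<open>s\<close> and \<open>h\<close>; \<open>mR\<close> and \<open>mC\<close> below
      interpret its two partial derivatives as vectors to which the connection axioms apply.\<close>
    have "((\<lambda>y. snd d (\<sigma> (cinv c y))) has_derivative (\<lambda>X. DG (Ds X, Dh X))) (at (snd c x))"
    proof (rule has_derivative_cong_eventually)
      show "((\<lambda>y. G (snd e (s (cinv c y)), h (cinv c y))) has_derivative (\<lambda>X. DG (Ds X, Dh X)))
          (at (snd c x))"
        by (rule has_derivative_compose[OF has_derivative_Pair[OF sD hD]]) (simp add: cx GD)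
    qed (use ev in \<open>auto elim: eventually_mono\<close>)
    then have m\<sigma>: "mdiff MA PA \<sigma> x = (\<lambda>X. DG (Ds X, Dh X))"
      unfolding c_def d_def by (rule mdiff_eq)
    have "((\<lambda>z. snd d (act S (cinv e z) (h x))) has_derivative (\<lambda>\<xi>. DG (\<xi>, 0))) (at (snd e (s x)))"
    proof (rule has_derivative_cong_eventually)
      have p: "((\<lambda>z. (z, h x)) has_derivative (\<lambda>\<xi>. (\<xi>, 0))) (at (snd e (s x)))"
        by (intro has_derivative_Pair has_derivative_ident has_derivative_const)
      show "((\<lambda>z. G (z, h x)) has_derivative (\<lambda>\<xi>. DG (\<xi>, 0))) (at (snd e (s x)))"
        by (rule has_derivative_compose[OF p GD])
      from eventually_nhds_isCont[OF has_derivative_continuous[OF p] Ge]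
      show "\<forall>\<^sub>F z in nhds (snd e (s x)). G (z, h x) = snd d (act S (cinv e z) (h x))"
        by (auto simp: hH[OF x] elim: eventually_mono)
    qed
    then have mR: "mdiff PA PA (\<lambda>u. act S u (h x)) (s x) = (\<lambda>\<xi>. DG (\<xi>, 0))"
      unfolding d_def e_def \<sigma>_def by (rule mdiff_eq)
    define hi where "hi = matrix_inv (h x)"
    have hi: "hi \<in> H" "h x ** hi = mat 1" "hi ** h x = mat 1"
      using H_group_inv[OF hH[OF x]] hi_def by auto
    define k where "k = (\<lambda>t::real. if cinv c (snd c x + t *\<^sub>R X) \<in> V
      then hi ** h (cinv c (snd c x + t *\<^sub>R X)) else mat 1)"
    have kH: "k t \<in> H" for t
      using H_group_mult[OF hi(1) hH] H_group_one by (simp add: k_def)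
    have k0: "k 0 = mat 1" using hi by (simp add: k_def cx)
    have line: "((\<lambda>t. snd c x + t *\<^sub>R X) has_derivative (\<lambda>t. t *\<^sub>R X)) (at (0::real))"
      by (auto intro!: derivative_eq_intros)
    have hD': "((\<lambda>y. h (cinv c y)) has_derivative Dh) (at (snd c x + (0::real) *\<^sub>R X))"
      using hD by simp
    have evV: "\<forall>\<^sub>F t in nhds (0::real). cinv c (snd c x + t *\<^sub>R X) \<in> V"
      using eventually_nhds_isCont[OF has_derivative_continuous[OF line], of "\<lambda>y. cinv c y \<in> V"]
        eventually_cinv[OF base_atlas c eventually_nhds_in_open[OF V x]] by simp
    have k1: "((\<lambda>t. hi ** h (cinv c (snd c x + t *\<^sub>R X))) has_derivative (\<lambda>t. hi ** Dh (t *\<^sub>R X))) (at 0)"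
      by (rule bounded_linear.has_derivative[OF
            bounded_bilinear.bounded_linear_right[OF bounded_bilinear_matrix2_mult]
            has_derivative_compose[OF line hD']])
    have "(k has_derivative (\<lambda>t. hi ** Dh (t *\<^sub>R X))) (at 0)"
      by (rule has_derivative_cong_eventually[OF k1])
         (use evV in \<open>auto simp: k_def elim: eventually_mono\<close>)
    moreover have "(\<lambda>t. hi ** Dh (t *\<^sub>R X)) = (\<lambda>t. t *\<^sub>R (hi ** Dh X))"
      using has_derivative_linear[OF hD]
      by (simp add: linear_cmul bounded_bilinear.scaleR_right[OF bounded_bilinear_matrix2_mult])
    ultimately have kD: "(k has_vector_derivative (hi ** Dh X)) (at 0)"
      unfolding has_vector_derivative_def by simp
    have curve: "H_curve (idx S) k (hi ** Dh X)"
      unfolding H_curve_def using kH k0 kD by blast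
    \<comment> \<open>Acting on \<open>\<sigma> x\<close> by \<open>k t\<close> is acting on
      \<open>s x\<close> by \<open>h x ** k t\<close>, so \<open>G\<close> represents this curve
      with its first argument frozen; the factor \<open>hi\<close> in the velocity of
      \<open>k\<close> then cancels against \<open>h x\<close>.\<close>
    have "((\<lambda>t. snd d (act S (\<sigma> x) (k t))) has_derivative (\<lambda>t. DG (0, h x ** (t *\<^sub>R (hi ** Dh X))))) (at 0)"
    proof (rule has_derivative_cong_eventually)
      have p: "((\<lambda>t. (snd e (s x), h x ** k t)) has_derivative
          (\<lambda>t. (0, h x ** (t *\<^sub>R (hi ** Dh X))))) (at 0)"
        using kD unfolding has_vector_derivative_def
        by (intro has_derivative_Pair has_derivative_const bounded_linear.has_derivative[OF
            bounded_bilinear.bounded_linear_right[OF bounded_bilinear_matrix2_mult]])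
      have v0: "(snd e (s x), h x ** k 0) = (snd e (s x), h x)" by (simp add: k0)
      show "((\<lambda>t. G (snd e (s x), h x ** k t)) has_derivative
          (\<lambda>t. DG (0, h x ** (t *\<^sub>R (hi ** Dh X))))) (at 0)"
        by (rule has_derivative_compose[OF p]) (unfold v0, rule GD)
      have "\<forall>\<^sub>F t in nhds 0. h x ** k t \<in> H \<longrightarrow>
        act S (s x) (h x ** k t) \<in> fst d \<and> G (snd e (s x), h x ** k t) = snd d (act S (s x) (h x ** k t))"
        using eventually_nhds_isCont[OF has_derivative_continuous[OF p], unfolded v0, OF Ge]
        by (simp add: es)
      then show "\<forall>\<^sub>F t in nhds 0. G (snd e (s x), h x ** k t) = snd d (act S (\<sigma> x) (k t))"
        by eventually_elim (simp add: \<sigma>_def act_mult[OF hH[OF x] kH] H_group_mult[OF hH[OF x] kH])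
    qed
    then have "mdiff euc PA (\<lambda>t::real. act S (\<sigma> x) (k t)) 0 = (\<lambda>t. DG (0, h x ** (t *\<^sub>R (hi ** Dh X))))"
      unfolding d_def by (intro mdiff_eq) (simp add: chart_at_euc k0 act_one)
    then have mC: "mdiff euc PA (\<lambda>t::real. act S (\<sigma> x) (k t)) 0 1 = DG (0, Dh X)"
      by (simp add: matrix_mul_assoc hi)
    \<comment> \<open>The first summand is the image of \<open>Ds X\<close> under the right
      translation by \<open>h x\<close>, the second the velocity of the fibre curve: equivariance of
      \<omega> evaluates the one, reproduction of Lie algebra elements the other.\<close>
    have "DG (Ds X, Dh X) = DG ((Ds X, 0) + (0, Dh X))" by simp
    also have "\<dots> = DG (Ds X, 0) + DG (0, Dh X)" using DGl linear_add by blast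
    finally have "\<omega> (\<sigma> x) (mdiff MA PA \<sigma> x X) = \<omega> (\<sigma> x) (DG (Ds X, 0)) + \<omega> (\<sigma> x) (DG (0, Dh X))"
      using linear_add[OF omega_linear] m\<sigma> by simp
    also have "\<omega> (\<sigma> x) (DG (Ds X, 0)) = hi ** \<omega> (s x) (Ds X) ** h x"
      using omega_act[OF hH[OF x], of "s x" "Ds X"] unfolding mR \<sigma>_def hi_def .
    also have "\<omega> (\<sigma> x) (DG (0, Dh X)) = hi ** Dh X"
      using omega_curve[OF curve, of "\<sigma> x"] unfolding mC .
    finally show ?thesis unfolding \<sigma>_def hi_def Ds_def Dh_def c_def .
  qed
qed

end


section \<open>The fundamental form along a section and spinors\<close>

lemma H_lie_diff:
  assumes "r \<in> {0, 1}" "U \<in> H_lie r" "W \<in> H_lie r"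
  shows "U - W \<in> H_lie r"
proof -
  have "U - W = lgx r (lgx_inv r U - lgx_inv r W)"
    by (simp add: linear_diff[OF linear_lgx] lgx_lgx_inv[OF assms(1)] assms)
  then show ?thesis using lgx_in_H_lie[OF assms(1)] by simp
qed

context spin_manifold
begin

lemma frm_in_frames: "(prj S u, frm S u) \<in> on_frames S"
  using covering unfolding smooth_double_covering_def by blast

lemma linear_frm: "linear (frm S u)"
  and frm_isometry: "met S (prj S u) (frm S u X) (frm S u Y) = ip (idx S) X Y"
  using frm_in_frames[of u] unfolding on_frames_def by auto

lemma bilinear_met: "bilinear (met S x)"
  using riemannian unfolding pseudo_riemannian_def smooth_bilinear_field_def by blast

lemma bij_frm: "bij (frm S u)"
proof -
  have "inj (frm S u)"
  proof (subst linear_injective_0[OF linear_frm], intro allI impI)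
    fix X assume 0: "frm S u X = 0"
    have "ip (idx S) X Y = 0" for Y
      using frm_isometry[of u X Y] bilinear_lzero[OF bilinear_met] by (simp add: 0)
    then show "X = 0" using ip_nondegenerate[OF idx] by blast
  qed
  then show ?thesis using linear_injective_imp_surjective[OF linear_frm] by (simp add: bij_def)
qed

lemma frm_inv_frm [simp]: "frm S u (inv (frm S u) X) = X" "inv (frm S u) (frm S u X) = X"
  using bij_frm by (simp_all add: bij_is_surj surj_f_inv_f bij_is_inj)

lemma linear_inv_frm: "linear (inv (frm S u))"
  using bij_frm linear_frm
  by (metis bij_is_inj bij_is_surj inj_linear_imp_inv_linear)

lemma solder_eq: "solder S u \<xi> = inv (frm S u) (mdiff PA MA (prj S) u \<xi>)"
  unfolding solder_def by (rule the_equality) auto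

lemma linear_solder: "linear (solder S u)"
  using linear_compose[OF linear_mdiff[OF tot_atlas base_atlas atlas_open_UNIV[OF tot_atlas] prj_smooth]
      linear_inv_frm, of u u]
  by (simp add: solder_eq[abs_def] o_def)

lemma
  assumes "local_section S V s"
  shows section_open: "open V" and section_atlas_open: "atlas_open MA UNIV V"
    and section_smooth: "smooth_map MA V PA s" and section_prj: "\<And>x. x \<in> V \<Longrightarrow> prj S (s x) = x"
  using assms open_imp_atlas_open[OF base_atlas] unfolding local_section_def by auto

lemma prj_section_mdiff:
  assumes s: "local_section S V s" and x: "x \<in> V"
  shows "mdiff PA MA (prj S) (s x) (mdiff MA PA s x X) = X"
proof -
  define c where "c = chart_at MA x"
  define e where "e = chart_at PA (s x)"
  have c: "c \<in> MA" "x \<in> fst c" and e: "e \<in> PA" "s x \<in> fst e"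
    using chart_at_in[OF tot_atlas] chart_at_mem[OF tot_atlas] chart_at_in[OF base_atlas]
      chart_at_mem[OF base_atlas] c_def e_def by auto
  have cx: "cinv c (snd c x) = x" using cinv_chart[OF inj_on_chart[OF base_atlas c(1)] c(2)] .
  have sD: "((\<lambda>y. snd e (s (cinv c y))) has_derivative mdiff MA PA s x) (at (snd c x))"
    using has_derivative_mdiff[OF base_atlas tot_atlas section_atlas_open[OF s] section_smooth[OF s] x]
    unfolding c_def e_def .
  have pD: "((\<lambda>z. snd c (prj S (cinv e z))) has_derivative mdiff PA MA (prj S) (s x))
      (at (snd e (s (cinv c (snd c x)))))"
    unfolding cx
    using has_derivative_mdiff[OF tot_atlas base_atlas atlas_open_UNIV[OF tot_atlas] prj_smooth
        UNIV_I, of "s x", unfolded section_prj[OF s x], folded c_def e_def] .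
  have "\<forall>\<^sub>F y in nhds (snd c x). snd c (prj S (cinv e (snd e (s (cinv c y))))) = y"
    using eventually_chart[OF base_atlas c] smooth_map_eventually[OF base_atlas
        section_atlas_open[OF s] section_smooth[OF s] x c(1) e(1) c(2) e(2)]
    by eventually_elim
       (simp add: cinv_chart[OF inj_on_chart[OF tot_atlas e(1)]] section_prj[OF s])
  from has_derivative_eventually_unique[OF has_derivative_compose[OF sD pD] has_derivative_ident this]
  show ?thesis by metis
qed

lemma solder_section:
  assumes "local_section S V s" "x \<in> V"
  shows "solder S (s x) (mdiff MA PA s x X) = inv (frm S (s x)) X"
  by (simp add: solder_eq prj_section_mdiff[OF assms])

text \<open>This is the unique existence behind \<open>horiz\<close> and \<open>fund\<close>. It is
  stated at points of a section because the differential of the section supplies vectors with any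
  prescribed value of \<theta>. In \<open>\<Phi>\<close> the value of \<omega> passes through
  \<open>lgx_inv\<close>, so that the target is a space of dimension 6 like the source and
  surjectivity yields injectivity.\<close>

lemma tangent_decomposition:
  assumes s: "local_section S V s" "x \<in> V" and U: "U \<in> H_lie (idx S)"
  shows "\<exists>!\<xi>. solder S (s x) \<xi> = X \<and> \<omega> (s x) \<xi> = U"
proof -
  define u where "u = s x"
  \<comment> \<open>\<open>(\<theta>, \<omega>)\<close> is onto: the image of \<open>ds\<close> takes care of \<open>\<theta>\<close> and vertical vectors correct \<open>\<omega>\<close>;
    both sides have dimension 6.\<close>
  define \<Phi> where "\<Phi> = (\<lambda>\<xi>. (solder S u \<xi>, lgx_inv (idx S) (\<omega> u \<xi>)))"
  have ex: "\<exists>\<xi>. solder S u \<xi> = X \<and> \<omega> u \<xi> = U" if "U \<in> H_lie (idx S)" for X U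
  proof -
    define \<eta> where "\<eta> = mdiff MA PA s x (frm S u X)"
    have \<eta>: "solder S u \<eta> = X" unfolding \<eta>_def u_def by (simp add: solder_section[OF s])
    have "U - \<omega> u \<eta> \<in> H_lie (idx S)" by (rule H_lie_diff[OF idx that omega_lie])
    then obtain \<xi> where \<xi>: "\<omega> u \<xi> = U - \<omega> u \<eta>" "mdiff PA MA (prj S) u \<xi> = 0"
      using vertical_lift by blast
    have "solder S u \<xi> = 0" using \<xi>(2) by (simp add: solder_eq linear_0[OF linear_inv_frm])
    then have "solder S u (\<eta> + \<xi>) = X \<and> \<omega> u (\<eta> + \<xi>) = U"
      using \<eta> \<xi>(1) by (simp add: linear_add[OF linear_solder] linear_add[OF omega_linear])
    then show ?thesis by blast
  qed
  have "linear \<Phi>"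
    unfolding \<Phi>_def
    by (rule linearI)
       (simp_all add: linear_add[OF linear_solder] linear_add[OF omega_linear]
         linear_cmul[OF linear_solder] linear_cmul[OF omega_linear]
         linear_add[OF bounded_linear.linear[OF bounded_linear_lgx_inv]]
         linear_cmul[OF bounded_linear.linear[OF bounded_linear_lgx_inv]])
  moreover have "surj \<Phi>"
  proof -
    have "\<exists>\<xi>. \<Phi> \<xi> = (X, Y)" for X Y
      using ex[OF lgx_in_H_lie[OF idx], of X Y] unfolding \<Phi>_def
      by (metis lgx_inv_lgx[OF idx])
    then show ?thesis unfolding surj_def by (metis surj_pair)
  qed
  ultimately have "inj \<Phi>"
    using linear_surjective_imp_injective[of \<Phi>] by simp
  then have "\<xi> = \<xi>'" if "solder S u \<xi> = X \<and> \<omega> u \<xi> = U" "solder S u \<xi>' = X \<and> \<omega> u \<xi>' = U" for \<xi> \<xi>'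
    using that unfolding inj_def \<Phi>_def by simp
  with ex[OF U, of X] show ?thesis unfolding u_def by blast
qed

lemma
  assumes "local_section S V s" "x \<in> V"
  shows solder_horiz: "solder S (s x) (horiz S \<omega> (s x) X) = X"
    and omega_horiz: "\<omega> (s x) (horiz S \<omega> (s x) X) = 0"
proof -
  have "0 \<in> H_lie (idx S)"
    using H_lie_diff[OF idx omega_lie omega_lie, of "s x" 0 "s x" 0] by simp
  from theI'[OF tangent_decomposition[OF assms this, of X]]
  show "solder S (s x) (horiz S \<omega> (s x) X) = X" "\<omega> (s x) (horiz S \<omega> (s x) X) = 0"
    unfolding horiz_def by auto
qed

lemma
  assumes "local_section S V s" "x \<in> V" "U \<in> H_lie (idx S)"
  shows solder_fund: "solder S (s x) (fund S \<omega> (s x) U) = 0"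
    and omega_fund: "\<omega> (s x) (fund S \<omega> (s x) U) = U"
  using theI'[OF tangent_decomposition[OF assms, of 0]] unfolding fund_def by auto

text \<open>\<open>J_str\<close> exchanges horizontal and vertical parts with weights reciprocal to
  those that \<open>G_str\<close> puts on the resulting parts, so the constant \<open>c\<close>
  cancels.\<close>

lemma fund_form_eq:
  assumes s: "local_section S V s" "x \<in> V" and c: "c > 0"
  shows "fund_form S \<omega> c (s x) \<xi> \<eta> =
    ip (idx S) (solder S (s x) \<xi>) (lgx_inv (idx S) (\<omega> (s x) \<eta>)) -
    ip (idx S) (lgx_inv (idx S) (\<omega> (s x) \<xi>)) (solder S (s x) \<eta>)"
proof -
  define X where "X = solder S (s x) \<xi>"
  define Y where "Y = lgx_inv (idx S) (\<omega> (s x) \<xi>)"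
  define J where "J = J_str S \<omega> c (s x) \<xi>"
  have Jdef: "J = - (inverse c *\<^sub>R horiz S \<omega> (s x) Y) + c *\<^sub>R fund S \<omega> (s x) (lgx (idx S) X)"
    unfolding J_def J_str_def X_def Y_def by (simp add: lg_eq_lgx[OF idx] lg_inv_eq[OF idx omega_lie])
  note fd = solder_fund[OF s lgx_in_H_lie[OF idx]] omega_fund[OF s lgx_in_H_lie[OF idx]]
  have J: "solder S (s x) J = - (inverse c *\<^sub>R Y)" "\<omega> (s x) J = c *\<^sub>R lgx (idx S) X"
    unfolding Jdef
    by (simp_all add: linear_add[OF linear_solder] linear_add[OF omega_linear]
        linear_diff[OF linear_solder] linear_diff[OF omega_linear]
         linear_cmul[OF linear_solder] linear_cmul[OF omega_linear] fd
         solder_horiz[OF s] omega_horiz[OF s])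
  have "lg_inv (idx S) (\<omega> (s x) J) = c *\<^sub>R X"
    using lg_inv_eq[OF idx omega_lie, of "s x" J]
    by (simp add: J(2) linear_cmul[OF bounded_linear.linear[OF bounded_linear_lgx_inv]] lgx_inv_lgx[OF idx])
  then have "fund_form S \<omega> c (s x) \<xi> \<eta> = c * ip (idx S) (- (inverse c *\<^sub>R Y)) (solder S (s x) \<eta>) +
      inverse c * ip (idx S) (c *\<^sub>R X) (lgx_inv (idx S) (\<omega> (s x) \<eta>))"
    unfolding fund_form_def G_str_def J_def[symmetric] J(1) lg_inv_eq[OF idx omega_lie, of "s x" \<eta>]
    by simp
  also have "\<dots> = ip (idx S) X (lgx_inv (idx S) (\<omega> (s x) \<eta>)) - ip (idx S) Y (solder S (s x) \<eta>)"
    using c by (simp add: linear_neg[OF linear_ip] linear_cmul[OF linear_ip] mult.assoc[symmetric])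
  finally show ?thesis unfolding X_def Y_def .
qed

definition section_endo :: "('m \<Rightarrow> 'p) \<Rightarrow> 'm \<Rightarrow> real^3 \<Rightarrow> real^3" where
  "section_endo s x X = frm S (s x) ((1/2) *\<^sub>R lgx_inv (idx S) (\<omega> (s x) (mdiff MA PA s x X)))"

lemma met_commute: "met S x X Y = met S x Y X"
  using riemannian unfolding pseudo_riemannian_def by blast

lemma lagrangian_iff:
  assumes s: "local_section S UNIV s" and c: "c > 0"
  shows "s \<in> lagrangian_sections S \<omega> c \<longleftrightarrow>
    (\<forall>x X Y. met S x (section_endo s x X) Y = met S x X (section_endo s x Y))"
proof -
  have m: "met S x (section_endo s x X) Y =
      (1/2) * ip (idx S) (lgx_inv (idx S) (\<omega> (s x) (mdiff MA PA s x X))) (inv (frm S (s x)) Y)" for x X Y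
    using frm_isometry[of "s x" "(1/2) *\<^sub>R lgx_inv (idx S) (\<omega> (s x) (mdiff MA PA s x X))"
        "inv (frm S (s x)) Y"]
    by (simp add: section_endo_def section_prj[OF s] linear_cmul[OF linear_ip])
  have "fund_form S \<omega> c (s x) (mdiff MA PA s x X) (mdiff MA PA s x Y) = 0 \<longleftrightarrow>
      met S x (section_endo s x X) Y = met S x X (section_endo s x Y)" for x X Y
    unfolding fund_form_eq[OF s UNIV_I c] solder_section[OF s UNIV_I] met_commute[of x X] m
    by (subst (3) ip_commute) auto
  then show ?thesis using s unfolding lagrangian_sections_def by simp
qed

section \<open>Spinors as equivalence classes\<close>

lemma sp_class_mem_iff: "(u', v') \<in> sp_class S u v \<longleftrightarrow>
    (\<exists>h\<in>H. u' = act S u h \<and> v' = matrix_inv h *v v)"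
  unfolding sp_class_def by blast

lemma sp_class_self: "(u, v) \<in> sp_class S u v"
proof -
  have "matrix_inv (mat 1 :: complex^2^2) = mat 1"
    using H_group_inv(3)[OF H_group_one] by simp
  then show ?thesis unfolding sp_class_mem_iff
    by (intro bexI[of _ "mat 1"]) (simp_all add: act_one H_group_one)
qed

lemma matrix_inv_mult_H:
  assumes "h \<in> H" "k \<in> H"
  shows "matrix_inv (h ** k) = matrix_inv k ** matrix_inv h"
proof -
  note hk = H_group_inv[OF H_group_mult[OF assms]]
  have "matrix_inv k ** matrix_inv h = matrix_inv k ** matrix_inv h ** (h ** k ** matrix_inv (h ** k))"
    by (simp add: hk)
  also have "\<dots> = matrix_inv k ** (matrix_inv h ** h) ** k ** matrix_inv (h ** k)"
    by (simp only: matrix_mul_assoc)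
  also have "\<dots> = matrix_inv (h ** k)"
    by (simp add: H_group_inv[OF assms(1)] H_group_inv[OF assms(2)])
  finally show ?thesis by simp
qed

lemma sp_class_subset:
  assumes "h \<in> H" shows "sp_class S (act S u h) v \<subseteq> sp_class S u (h *v v)"
proof
  fix z assume "z \<in> sp_class S (act S u h) v"
  then obtain k where k: "k \<in> H" "z = (act S (act S u h) k, matrix_inv k *v v)"
    unfolding sp_class_def by blast
  have "matrix_inv (h ** k) *v (h *v v) = (matrix_inv k ** (matrix_inv h ** h)) *v v"
    by (simp add: matrix_inv_mult_H[OF assms k(1)] matrix_vector_mul_assoc matrix_mul_assoc)
  then have "z = (act S u (h ** k), matrix_inv (h ** k) *v (h *v v))"
    using k by (simp add: act_mult[OF assms k(1)] H_group_inv[OF assms])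
  then show "z \<in> sp_class S u (h *v v)"
    unfolding sp_class_def using H_group_mult[OF assms k(1)] by blast
qed

lemma sp_class_act:
  assumes h: "h \<in> H" shows "sp_class S (act S u h) v = sp_class S u (h *v v)"
proof
  \<comment> \<open>The reverse inclusion is the proved one for the inverse of \<open>h\<close>,
    starting at \<open>act S u h\<close>.\<close>
  have "act S (act S u h) (matrix_inv h) = u"
    using act_mult[OF h H_group_inv(1)[OF h]] by (simp add: H_group_inv[OF h] act_one)
  then show "sp_class S u (h *v v) \<subseteq> sp_class S (act S u h) v"
    using sp_class_subset[OF H_group_inv(1)[OF h], of "act S u h" "h *v v"]
    by (simp add: matrix_vector_mul_assoc H_group_inv[OF h])
qed (rule sp_class_subset[OF h])

text \<open>Because the action is free, a class contains only one pair with a given first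
  component.\<close>

lemma sp_class_fibre_inj:
  assumes "sp_class S u v = sp_class S u w" shows "v = w"
proof -
  obtain h where h: "h \<in> H" "u = act S u h" "v = matrix_inv h *v w"
    using sp_class_self[of u v] unfolding assms sp_class_mem_iff by blast
  have "h = mat 1" using act_inj[OF h(1) H_group_one, of u] h(2) by (simp add: act_one)
  then show ?thesis using h(3) H_group_inv(3)[OF H_group_one] by simp
qed

text \<open>Two points of P giving the same class differ by an element of \<open>H\<close> fixing
  \<open>unit_vec \<epsilon>\<close>, hence by the identity. This makes the section of a unit spinor
  unique, and so also lets local sections agree on overlaps.\<close>

lemma sp_class_unit_vec_inj:
  assumes "\<epsilon> \<in> signs (idx S)" "sp_class S u (unit_vec \<epsilon>) = sp_class S u' (unit_vec \<epsilon>)"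
  shows "u = u'"
proof -
  obtain h where h: "h \<in> H" "u = act S u' h" "unit_vec \<epsilon> = matrix_inv h *v unit_vec \<epsilon>"
    using sp_class_self[of u "unit_vec \<epsilon>"] unfolding assms(2) sp_class_mem_iff by blast
  have "h *v unit_vec \<epsilon> = (h ** matrix_inv h) *v unit_vec \<epsilon>"
    by (subst h(3)) (simp add: matrix_vector_mul_assoc)
  then have "h *v unit_vec \<epsilon> = unit_vec \<epsilon>" by (simp add: H_group_inv[OF h(1)])
  then have "h = mat 1" using H_group_stabilizer[OF idx assms(1) h(1)] by blast
  then show ?thesis using h(2) act_one by simp
qed

lemma sp_herm_class: "sp_herm S (sp_class S u v) (sp_class S u w) = herm (idx S) v w"
  unfolding sp_herm_def
proof (rule the_equality)
  show "\<exists>u' v' w'. (u', v') \<in> sp_class S u v \<and> (u', w') \<in> sp_class S u w \<and>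
      herm (idx S) v w = herm (idx S) v' w'"
    using sp_class_self by blast
  fix z assume "\<exists>u' v' w'. (u', v') \<in> sp_class S u v \<and> (u', w') \<in> sp_class S u w \<and>
      z = herm (idx S) v' w'"
  then obtain h k where h: "h \<in> H" "k \<in> H" "act S u h = act S u k"
    and z: "z = herm (idx S) (matrix_inv h *v v) (matrix_inv k *v w)"
    unfolding sp_class_mem_iff by metis
  have "h = k" using act_inj h by blast
  then show "z = herm (idx S) v w"
    using z herm_invariant[OF idx H_group_inv(1)[OF h(1)]] by simp
qed

text \<open>Independence of the representative is the relation
  \<open>gam (lam h Y) = h ** gam Y ** matrix_inv h\<close>: the change of frame by \<open>h\<close>
  and the change of spinor components compensate.\<close>

lemma clifford_class: "clifford S X (sp_class S u v) =
    sp_class S u (gam (idx S) (inv (frm S u) X) *v v)"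
  unfolding clifford_def
proof (rule the_equality)
  show "\<exists>u' Y v'. (u', v') \<in> sp_class S u v \<and> frm S u' Y = X \<and>
      sp_class S u (gam (idx S) (inv (frm S u) X) *v v) = sp_class S u' (gam (idx S) Y *v v')"
    using sp_class_self frm_inv_frm(1) by blast
  fix b assume "\<exists>u' Y v'. (u', v') \<in> sp_class S u v \<and> frm S u' Y = X \<and>
      b = sp_class S u' (gam (idx S) Y *v v')"
  then obtain Y h where h: "h \<in> H" and Y: "frm S (act S u h) Y = X"
    and b: "b = sp_class S (act S u h) (gam (idx S) Y *v (matrix_inv h *v v))"
    unfolding sp_class_mem_iff by metis
  have "inv (frm S u) X = lam (idx S) h Y" using Y frm_act[OF h, of u] by auto
  then have "gam (idx S) (inv (frm S u) X) = h ** gam (idx S) Y ** matrix_inv h"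
    using gam_lam[OF idx h] by simp
  then show "b = sp_class S u (gam (idx S) (inv (frm S u) X) *v v)"
    unfolding b sp_class_act[OF h] by (simp add: matrix_vector_mul_assoc matrix_mul_assoc)
qed

lemma sp_scale_class: "sp_scale z (sp_class S u v) = sp_class S u (z *s v)"
  unfolding sp_scale_def sp_class_def by (auto simp: vector_scalar_commute image_iff)

end


section \<open>Unit spinors and sections\<close>

lemma bounded_bilinear_matrix_vector_mult:
  "bounded_bilinear ((*v) :: real^'n^'m \<Rightarrow> real^'n \<Rightarrow> real^'m)"
proof -
  have "bilinear ((*v) :: real^'n^'m \<Rightarrow> real^'n \<Rightarrow> real^'m)"
    unfolding bilinear_def
    by (intro conjI allI linearI)
       (simp_all add: vec_eq_iff matrix_vector_mult_def sum.distrib sum_distrib_left distrib_left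
         distrib_right mult_ac)
  then show ?thesis using bilinear_conv_bounded_bilinear by blast
qed

context spin_manifold
begin

lemma smooth_at_euc:
  assumes "atlas_open MA UNIV V" "smooth_map MA V euc v" "x \<in> V" "c \<in> MA" "x \<in> fst c"
  shows "smooth_at (\<lambda>y. v (cinv c y)) (snd c x)"
  using smooth_map_smooth_at[OF base_atlas assms(1,2,3,4) _ assms(5), of "(UNIV, id)"]
  by (simp add: euc_def)

text \<open>With \<open>h\<close> the group element taking \<open>unit_vec \<epsilon>\<close> to
  \<open>v\<close>, the pairs \<open>(s, v)\<close> and \<open>(s h, unit_vec \<epsilon>)\<close>
  give the same spinor. Applying \<open>h\<close> to the product rule for \<omega> along
  \<open>s h\<close> recovers the derivative formula for \<open>(s, v)\<close>, since by linearity
  of \<open>vec_group\<close> the derivative of \<open>h\<close> sends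
  \<open>unit_vec \<epsilon>\<close> to that of \<open>v\<close>.\<close>

lemma unit_spinor_representation:
  assumes \<epsilon>: "\<epsilon> \<in> signs (idx S)" and \<psi>: "unit_spinor S \<epsilon> \<psi>" and rep: "represents S \<psi> V s v"
  defines "\<sigma> \<equiv> \<lambda>x. act S (s x) (vec_group (idx S) \<epsilon> (v x))"
  shows normalized_section: "local_section S V \<sigma>"
    and normalized_spinor: "\<And>x. x \<in> V \<Longrightarrow> \<psi> x = sp_class S (\<sigma> x) (unit_vec \<epsilon>)"
    and normalized_derivative: "\<And>x X. x \<in> V \<Longrightarrow>
      sp_class S (s x) (mdiff MA euc v x X + \<omega> (s x) (mdiff MA PA s x X) *v v x) =
      sp_class S (\<sigma> x) (\<omega> (\<sigma> x) (mdiff MA PA \<sigma> x X) *v unit_vec \<epsilon>)"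
proof -
  define h where "h = (\<lambda>x. vec_group (idx S) \<epsilon> (v x))"
  have s: "local_section S V s" and v: "smooth_map MA V euc v"
    and \<psi>s: "\<And>x. x \<in> V \<Longrightarrow> \<psi> x = sp_class S (s x) (v x)"
    using rep unfolding represents_def by auto
  note V = section_atlas_open[OF s]
  have hH: "h x \<in> H" if "x \<in> V" for x
  proof -
    have "herm (idx S) (v x) (v x) = complex_of_real \<epsilon>"
      using \<psi> \<psi>s[OF that] sp_herm_class[of "s x" "v x" "v x"] unfolding unit_spinor_def by metis
    then show ?thesis unfolding h_def by (rule vec_group_in_H[OF idx \<epsilon>])
  qed
  have hv: "h x *v unit_vec \<epsilon> = v x" for x unfolding h_def by (rule vec_group_unit_vec)
  have hs: "smooth_at (\<lambda>y. h (cinv c y)) (snd c x)" if "x \<in> V" "c \<in> MA" "x \<in> fst c" for x c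
    unfolding h_def
    by (rule smooth_at_bounded_linear[OF bounded_linear_vec_group smooth_at_euc[OF V v that]])
  have \<sigma>: "\<sigma> = (\<lambda>x. act S (s x) (h x))" unfolding \<sigma>_def h_def ..
  show "local_section S V \<sigma>" unfolding \<sigma> by (rule section_act_section[OF s hH hs])
  show "\<psi> x = sp_class S (\<sigma> x) (unit_vec \<epsilon>)" if "x \<in> V" for x
    unfolding \<sigma> sp_class_act[OF hH[OF that]] hv by (rule \<psi>s[OF that])
  show "sp_class S (s x) (mdiff MA euc v x X + \<omega> (s x) (mdiff MA PA s x X) *v v x) =
      sp_class S (\<sigma> x) (\<omega> (\<sigma> x) (mdiff MA PA \<sigma> x X) *v unit_vec \<epsilon>)" if x: "x \<in> V" for x X
  proof -
    let ?c = "chart_at MA x"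
    have "((\<lambda>y. v (cinv ?c y)) has_derivative mdiff MA euc v x) (at (snd ?c x))"
      using has_derivative_mdiff[OF base_atlas smooth_atlas_euc V v x] by (simp add: chart_at_euc)
    from frechet_derivative_at[OF bounded_linear.has_derivative[OF bounded_linear_vec_group this]]
    have "frechet_derivative (\<lambda>y. h (cinv ?c y)) (at (snd ?c x)) X =
        vec_group (idx S) \<epsilon> (mdiff MA euc v x X)"
      unfolding h_def by metis
    then have "\<omega> (\<sigma> x) (mdiff MA PA \<sigma> x X) = matrix_inv (h x) ** \<omega> (s x) (mdiff MA PA s x X) ** h x +
        matrix_inv (h x) ** vec_group (idx S) \<epsilon> (mdiff MA euc v x X)"
      using omega_section_act[OF s hH hs x] unfolding \<sigma> by simp
    then have "h x *v (\<omega> (\<sigma> x) (mdiff MA PA \<sigma> x X) *v unit_vec \<epsilon>) =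
        ((h x ** matrix_inv (h x)) ** \<omega> (s x) (mdiff MA PA s x X)) *v (h x *v unit_vec \<epsilon>) +
        (h x ** matrix_inv (h x)) *v (vec_group (idx S) \<epsilon> (mdiff MA euc v x X) *v unit_vec \<epsilon>)"
      by (simp add: matrix_vector_mul_assoc matrix_mul_assoc matrix_vector_mult_add_rdistrib
          matrix_vector_right_distrib)
    also have "\<dots> = mdiff MA euc v x X + \<omega> (s x) (mdiff MA PA s x X) *v v x"
      by (simp add: H_group_inv[OF hH[OF x]] hv vec_group_unit_vec)
    finally show ?thesis unfolding \<sigma> sp_class_act[OF hH[OF x]] by simp
  qed
qed

section \<open>The covariant derivative of a unit spinor and its global section\<close>

lemma represents_section:
  assumes "local_section S V s" "\<And>y. y \<in> V \<Longrightarrow> \<psi> y = sp_class S (s y) a"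
  shows "represents S \<psi> V s (\<lambda>_. a)"
  unfolding represents_def
  using assms smooth_map_const[OF base_atlas section_atlas_open[OF assms(1)] smooth_atlas_euc] by blast

text \<open>For a unit spinor, all representations \<open>(s', v')\<close> have the same normalized representation, so the
  description defining \<open>cov_deriv\<close> is unique without transitivity of \<open>H\<close> on the fibres.\<close>

lemma cov_deriv_section:
  assumes \<epsilon>: "\<epsilon> \<in> signs (idx S)" and \<psi>: "unit_spinor S \<epsilon> \<psi>"
    and s: "local_section S V s" "\<And>y. y \<in> V \<Longrightarrow> \<psi> y = sp_class S (s y) (unit_vec \<epsilon>)" and x: "x \<in> V"
  shows "cov_deriv S \<omega> \<psi> x X = sp_class S (s x) (\<omega> (s x) (mdiff MA PA s x X) *v unit_vec \<epsilon>)"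
  unfolding cov_deriv_def
proof (rule the_equality)
  show "\<exists>V' s' v'. x \<in> V' \<and> represents S \<psi> V' s' v' \<and>
      sp_class S (s x) (\<omega> (s x) (mdiff MA PA s x X) *v unit_vec \<epsilon>) =
      sp_class S (s' x) (mdiff MA euc v' x X + \<omega> (s' x) (mdiff MA PA s' x X) *v v' x)"
    using x represents_section[OF s]
    by (intro exI[of _ V] exI[of _ s] exI[of _ "\<lambda>_. unit_vec \<epsilon>"])
       (simp add: mdiff_const[OF base_atlas smooth_atlas_euc])
  fix b assume "\<exists>V' s' v'. x \<in> V' \<and> represents S \<psi> V' s' v' \<and>
      b = sp_class S (s' x) (mdiff MA euc v' x X + \<omega> (s' x) (mdiff MA PA s' x X) *v v' x)"
  then obtain V' s' v' where V': "x \<in> V'" and rep: "represents S \<psi> V' s' v'"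
    and b: "b = sp_class S (s' x) (mdiff MA euc v' x X + \<omega> (s' x) (mdiff MA PA s' x X) *v v' x)"
    by blast
  define \<sigma> where "\<sigma> = (\<lambda>x. act S (s' x) (vec_group (idx S) \<epsilon> (v' x)))"
  have sec: "local_section S V' \<sigma>"
    and \<sigma>\<psi>: "\<And>x. x \<in> V' \<Longrightarrow> \<psi> x = sp_class S (\<sigma> x) (unit_vec \<epsilon>)"
    and b': "b = sp_class S (\<sigma> x) (\<omega> (\<sigma> x) (mdiff MA PA \<sigma> x X) *v unit_vec \<epsilon>)"
    using unit_spinor_representation[OF \<epsilon> \<psi> rep] V' unfolding b \<sigma>_def by auto
  \<comment> \<open>The normalized section is determined by the spinor, so \<sigma> and
    \<open>s\<close> agree on a whole neighbourhood and have equal differentials at x.\<close>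
  have eq: "\<sigma> y = s y" if "y \<in> V \<inter> V'" for y
    using sp_class_unit_vec_inj[OF \<epsilon>, of "\<sigma> y" "s y"] s(2)[of y] \<sigma>\<psi>[of y] that by simp
  have "\<forall>\<^sub>F y in nhds x. y \<in> V \<inter> V'"
    using x V' section_open[OF s(1)] section_open[OF sec] by (intro eventually_nhds_in_open) auto
  then have "\<forall>\<^sub>F y in nhds x. s y = \<sigma> y" by eventually_elim (simp add: eq)
  from mdiff_cong[OF base_atlas this has_derivative_mdiff[OF base_atlas tot_atlas
        section_atlas_open[OF s(1)] section_smooth[OF s(1)] x]]
  show "b = sp_class S (s x) (\<omega> (s x) (mdiff MA PA s x X) *v unit_vec \<epsilon>)"
    unfolding b' using eq x V' by simp
qed

lemma section_unit_spinor:
  assumes "\<epsilon> \<in> signs (idx S)" "local_section S UNIV s"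
  shows "unit_spinor S \<epsilon> (\<lambda>x. sp_class S (s x) (unit_vec \<epsilon>))"
  unfolding unit_spinor_def spinor_field_def sp_herm_class
  using represents_section[OF assms(2), of "\<lambda>x. sp_class S (s x) (unit_vec \<epsilon>)" "unit_vec \<epsilon>"]
    herm_unit_vec[OF idx assms(1)] by blast

text \<open>Normalizing local representations gives local sections, which agree on overlaps by
  uniqueness. The pointwise choice is therefore forced and inherits smoothness from each of
  them.\<close>

lemma unit_spinor_section:
  assumes \<epsilon>: "\<epsilon> \<in> signs (idx S)" and \<psi>: "unit_spinor S \<epsilon> \<psi>"
  obtains s where "local_section S UNIV s" "\<psi> = (\<lambda>x. sp_class S (s x) (unit_vec \<epsilon>))"
proof -
  have loc: "\<exists>V \<sigma>. x \<in> V \<and> local_section S V \<sigma> \<and> (\<forall>y\<in>V. \<psi> y = sp_class S (\<sigma> y) (unit_vec \<epsilon>))" for x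
  proof -
    obtain V s v where "x \<in> V" and rep: "represents S \<psi> V s v"
      using \<psi> unfolding unit_spinor_def spinor_field_def by blast
    then show ?thesis
      using normalized_section[OF \<epsilon> \<psi> rep] normalized_spinor[OF \<epsilon> \<psi> rep] by blast
  qed
  define s where "s = (\<lambda>x. SOME u. \<psi> x = sp_class S u (unit_vec \<epsilon>))"
  have s: "\<psi> x = sp_class S (s x) (unit_vec \<epsilon>)" for x
  proof -
    obtain u where "\<psi> x = sp_class S u (unit_vec \<epsilon>)" using loc[of x] by blast
    then show ?thesis unfolding s_def by (rule someI)
  qed
  have eq: "s y = u" if "\<psi> y = sp_class S u (unit_vec \<epsilon>)" for u y
    using sp_class_unit_vec_inj[OF \<epsilon>, of "s y" u] s[of y] that by simp
  have "local_section S UNIV s"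
    unfolding local_section_def
  proof (intro conjI ballI open_UNIV)
    show "prj S (s x) = x" for x
    proof -
      obtain V \<sigma> where "x \<in> V" "local_section S V \<sigma>" "\<psi> x = sp_class S (\<sigma> x) (unit_vec \<epsilon>)"
        using loc[of x] by blast
      then show ?thesis using eq section_prj by simp
    qed
    show "smooth_map MA UNIV PA s"
    proof (rule smooth_mapI[OF base_atlas atlas_open_UNIV[OF base_atlas]])
      show "\<exists>d\<in>PA. s p \<in> fst d" for p
        using chart_at_in[OF tot_atlas] chart_at_mem[OF tot_atlas] by blast
    next
      fix x c d assume *: "c \<in> MA" "d \<in> PA" "x \<in> fst c" "s x \<in> fst d"
      obtain V \<sigma> where x: "x \<in> V" and sec: "local_section S V \<sigma>"
        and \<sigma>: "\<And>y. y \<in> V \<Longrightarrow> \<psi> y = sp_class S (\<sigma> y) (unit_vec \<epsilon>)" using loc[of x] by blast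
      have \<sigma>x: "\<sigma> x \<in> fst d" using *(4) eq[OF \<sigma>[OF x]] by simp
      note sm = section_atlas_open[OF sec] section_smooth[OF sec] x *(1,2,3) \<sigma>x
      have ev: "\<forall>\<^sub>F y in nhds (snd c x). \<sigma> (cinv c y) = s (cinv c y) \<and> \<sigma> (cinv c y) \<in> fst d"
        using smooth_map_eventually[OF base_atlas sm] by eventually_elim (simp add: eq[OF \<sigma>])
      show "\<forall>\<^sub>F y in nhds (snd c x). s (cinv c y) \<in> fst d"
        using ev by eventually_elim (elim conjE, simp)
      show "smooth_at (\<lambda>y. snd d (s (cinv c y))) (snd c x)"
        by (rule smooth_at_cong[OF smooth_map_smooth_at[OF base_atlas sm]])
           (use ev in \<open>auto elim: eventually_mono\<close>)
    qed
  qed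
  then show ?thesis using that s by blast
qed

text \<open>Smoothness of the frames is contained in the double covering: the sheet through
  \<open>s x\<close> maps smoothly to the frame bundle, and the second component of a frame chart is
  the matrix in question.\<close>

lemma smooth_frm_section:
  assumes s: "local_section S UNIV s" and c: "c \<in> MA" "x \<in> fst c"
  shows "smooth_at (\<lambda>y. matrix (comp MA c (cinv c y) \<circ> frm S (s (cinv c y)))) (snd c x)"
proof -
  let ?f = "\<lambda>u. (prj S u, frm S u)"
  obtain V W1 W2 where V: "?f (s x) \<in> V" and W12: "W1 \<union> W2 = {p \<in> UNIV. ?f p \<in> V}"
    and Ws: "\<forall>W\<in>{W1, W2}. atlas_open PA UNIV W \<and> diffeo PA W (frame_atlas MA) V ?f"
    using covering[unfolded smooth_double_covering_def, THEN conjunct2, THEN bspec,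
        OF frm_in_frames[of "s x"]] by (elim exE conjE)
  have "s x \<in> W1 \<union> W2" using V W12 by blast
  then obtain W where W: "s x \<in> W" "atlas_open PA UNIV W" "smooth_map PA W (frame_atlas MA) ?f"
    using Ws unfolding diffeo_def by blast
  define d where "d = (fst c \<times> {f::real^3 \<Rightarrow> real^3. linear f},
    \<lambda>(x, f :: real^3 \<Rightarrow> real^3). (snd c x, matrix (comp MA c x \<circ> f)))"
  define e where "e = chart_at PA (s x)"
  have e: "e \<in> PA" "s x \<in> fst e"
    using chart_at_in[OF tot_atlas] chart_at_mem[OF tot_atlas] e_def by auto
  have d: "d \<in> frame_atlas MA" unfolding frame_atlas_def d_def using c(1) by blast
  have fd: "?f (s x) \<in> fst d" using c(2) section_prj[OF s] linear_frm by (simp add: d_def)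
  have cx: "cinv c (snd c x) = x" using cinv_chart[OF inj_on_chart[OF base_atlas c(1)] c(2)] .
  note sm = section_atlas_open[OF s] section_smooth[OF s] UNIV_I c(1) e(1) c(2) e(2)
  have "smooth_at (\<lambda>z. snd d (?f (cinv e z))) (snd e (s (cinv c (snd c x))))"
    using smooth_map_smooth_at[OF tot_atlas W(2,3,1) e(1) d e(2) fd] by (simp add: cx)
  from smooth_at_bounded_linear[OF bounded_linear_snd
      smooth_at_compose[OF smooth_map_smooth_at[OF base_atlas sm] this]]
  show ?thesis
  proof (rule smooth_at_cong)
    show "\<forall>\<^sub>F y in nhds (snd c x). snd (snd d (?f (cinv e (snd e (s (cinv c y)))))) =
        matrix (comp MA c (cinv c y) \<circ> frm S (s (cinv c y)))"
      using smooth_map_eventually[OF base_atlas sm]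
      by eventually_elim
         (simp add: cinv_chart[OF inj_on_chart[OF tot_atlas e(1)]] d_def section_prj[OF s])
  qed
qed

text \<open>\<open>gen_killing\<close> demands a smooth endomorphism field. In a chart this one is
  the frame matrix along the section applied to a linear image of the pulled back connection
  form.\<close>

lemma smooth_section_endo:
  assumes s: "local_section S UNIV s"
  shows "smooth_endo_field MA (section_endo s)"
  unfolding smooth_endo_field_def
proof (intro conjI allI ballI)
  show "linear (section_endo s x)" for x
  proof -
    have l: "linear (mdiff MA PA s x)"
      by (rule linear_mdiff[OF base_atlas tot_atlas section_atlas_open[OF s] section_smooth[OF s] UNIV_I])
    note l' = bounded_linear.linear[OF bounded_linear_lgx_inv]
    show ?thesis unfolding section_endo_def
      by (rule linearI)
         (simp_all add: linear_add[OF l] linear_add[OF omega_linear] linear_add[OF l']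
           linear_add[OF linear_frm] linear_cmul[OF l] linear_cmul[OF omega_linear]
           linear_cmul[OF l'] linear_cmul[OF linear_frm] scaleR_add_right)
  qed
  fix c w assume c: "c \<in> MA"
  show "smooth_on (snd c ` fst c)
      (\<lambda>y. comp MA c (cinv c y) (section_endo s (cinv c y) (tvec MA c (cinv c y) w)))"
  proof (rule smooth_onI)
    fix y assume "y \<in> snd c ` fst c"
    then obtain x where x: "x \<in> fst c" "y = snd c x" by blast
    have "smooth_at (\<lambda>y. matrix (comp MA c (cinv c y) \<circ> frm S (s (cinv c y))) *v
        ((1/2) *\<^sub>R lgx_inv (idx S) (\<omega> (s (cinv c y))
          (mdiff MA PA s (cinv c y) (tvec MA c (cinv c y) w))))) (snd c x)"
      by (intro smooth_at_bounded_bilinear[OF bounded_bilinear_matrix_vector_mult]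
          smooth_frm_section[OF s c x(1)] smooth_at_bounded_linear[OF bounded_linear_scaleR_right]
          smooth_at_bounded_linear[OF bounded_linear_lgx_inv]
          smooth_one_form_pullback[OF base_atlas tot_atlas section_atlas_open[OF s]
            section_smooth[OF s] omega_smooth UNIV_I c x(1)])
    then show "smooth_at (\<lambda>y. comp MA c (cinv c y)
        (section_endo s (cinv c y) (tvec MA c (cinv c y) w))) y"
      unfolding x(2)
    proof (rule smooth_at_cong)
      show "\<forall>\<^sub>F y in nhds (snd c x). matrix (comp MA c (cinv c y) \<circ> frm S (s (cinv c y))) *v
        ((1/2) *\<^sub>R lgx_inv (idx S) (\<omega> (s (cinv c y))
          (mdiff MA PA s (cinv c y) (tvec MA c (cinv c y) w)))) =
        comp MA c (cinv c y) (section_endo s (cinv c y) (tvec MA c (cinv c y) w))"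
        using eventually_chart[OF base_atlas c x(1)]
      proof eventually_elim
        case (elim y)
        have "linear (comp MA c (cinv c y) \<circ> frm S (s (cinv c y)))"
          using elim by (intro linear_compose linear_frm linear_comp[OF base_atlas c]) blast
        from fun_cong[OF matrix_vector_mul(2)[OF this]] show ?case
          unfolding section_endo_def by simp
      qed
    qed
  qed
qed

text \<open>The equation is solved at one point and for one vector. Hence the field \<open>A\<close>
  in \<open>gen_killing\<close> has only one candidate, and the existential there becomes a symmetry
  condition on \<open>section_endo s\<close>.\<close>

lemma killing_equation_iff:
  assumes \<epsilon>: "\<epsilon> \<in> signs (idx S)" and s: "local_section S UNIV s"
  defines "\<psi> \<equiv> \<lambda>x. sp_class S (s x) (unit_vec \<epsilon>)"
  shows "cov_deriv S \<omega> \<psi> x X = sp_scale (\<i> ^ idx S) (clifford S Z (\<psi> x)) \<longleftrightarrow>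
    Z = section_endo s x X"
proof -
  define W where "W = \<omega> (s x) (mdiff MA PA s x X)"
  define Y where "Y = inv (frm S (s x)) Z"
  have W: "W \<in> H_lie (idx S)" unfolding W_def by (rule omega_lie)
  have "cov_deriv S \<omega> \<psi> x X = sp_class S (s x) (W *v unit_vec \<epsilon>)"
    unfolding \<psi>_def W_def
    by (rule cov_deriv_section[OF \<epsilon> section_unit_spinor[OF \<epsilon> s] s]) auto
  moreover have "sp_scale (\<i> ^ idx S) (clifford S Z (\<psi> x)) =
      sp_class S (s x) (lgx (idx S) (2 *\<^sub>R Y) *v unit_vec \<epsilon>)"
    unfolding \<psi>_def clifford_class sp_scale_class gam_clifford Y_def linear_cmul[OF linear_lgx] ..
  ultimately have "cov_deriv S \<omega> \<psi> x X = sp_scale (\<i> ^ idx S) (clifford S Z (\<psi> x)) \<longleftrightarrow>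
      W *v unit_vec \<epsilon> = lgx (idx S) (2 *\<^sub>R Y) *v unit_vec \<epsilon>"
    using sp_class_fibre_inj by auto
  also have "\<dots> \<longleftrightarrow> W = lgx (idx S) (2 *\<^sub>R Y)"
    using H_lie_unit_vec_inj[OF idx W lgx_in_H_lie[OF idx]] by blast
  also have "\<dots> \<longleftrightarrow> lgx_inv (idx S) W = 2 *\<^sub>R Y"
    using lgx_inv_lgx[OF idx] lgx_lgx_inv[OF idx W] by metis
  also have "\<dots> \<longleftrightarrow> Y = (1/2) *\<^sub>R lgx_inv (idx S) W" by auto
  also have "\<dots> \<longleftrightarrow> Z = section_endo s x X"
    unfolding section_endo_def W_def[symmetric] Y_def using frm_inv_frm by metis
  finally show ?thesis .
qed

lemma gen_killing_iff:
  assumes \<epsilon>: "\<epsilon> \<in> signs (idx S)" and s: "local_section S UNIV s" and c: "c > 0"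
  shows "(\<lambda>x. sp_class S (s x) (unit_vec \<epsilon>)) \<in> gen_killing S \<omega> \<epsilon> \<longleftrightarrow> s \<in> lagrangian_sections S \<omega> c"
proof -
  have "(\<lambda>x. sp_class S (s x) (unit_vec \<epsilon>)) \<in> gen_killing S \<omega> \<epsilon> \<longleftrightarrow>
      (\<exists>A. smooth_endo_field MA A \<and> (\<forall>x X. A x X = section_endo s x X) \<and>
        (\<forall>x X Y. met S x (A x X) Y = met S x X (A x Y)))"
    unfolding gen_killing_def using section_unit_spinor[OF \<epsilon> s] killing_equation_iff[OF \<epsilon> s] by simp
  also have "\<dots> \<longleftrightarrow> (\<forall>x X Y. met S x (section_endo s x X) Y = met S x X (section_endo s x Y))"
    using smooth_section_endo[OF s] by auto
  finally show ?thesis using lagrangian_iff[OF s c] by simp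
qed

lemma bij_betw_sections_spinors:
  assumes \<epsilon>: "\<epsilon> \<in> signs (idx S)" and c: "c > 0"
  shows "bij_betw (\<lambda>s x. sp_class S (s x) (unit_vec \<epsilon>)) (lagrangian_sections S \<omega> c)
    (gen_killing S \<omega> \<epsilon>)"
proof (rule bij_betw_imageI)
  show "inj_on (\<lambda>s x. sp_class S (s x) (unit_vec \<epsilon>)) (lagrangian_sections S \<omega> c)"
  proof (rule inj_onI, rule ext)
    fix s s' x
    assume "(\<lambda>x. sp_class S (s x) (unit_vec \<epsilon>)) = (\<lambda>x. sp_class S (s' x) (unit_vec \<epsilon>))"
    from fun_cong[OF this, of x] show "s x = s' x" by (rule sp_class_unit_vec_inj[OF \<epsilon>])
  qed
  show "(\<lambda>s x. sp_class S (s x) (unit_vec \<epsilon>)) ` lagrangian_sections S \<omega> c = gen_killing S \<omega> \<epsilon>"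
  proof (intro equalityI subsetI)
    fix \<psi> assume "\<psi> \<in> (\<lambda>s x. sp_class S (s x) (unit_vec \<epsilon>)) ` lagrangian_sections S \<omega> c"
    then show "\<psi> \<in> gen_killing S \<omega> \<epsilon>"
      using gen_killing_iff[OF \<epsilon> _ c] unfolding lagrangian_sections_def by blast
  next
    fix \<psi> assume \<psi>: "\<psi> \<in> gen_killing S \<omega> \<epsilon>"
    then have "unit_spinor S \<epsilon> \<psi>" unfolding gen_killing_def by blast
    then obtain s where "local_section S UNIV s" "\<psi> = (\<lambda>x. sp_class S (s x) (unit_vec \<epsilon>))"
      using unit_spinor_section[OF \<epsilon>] by blast
    then show "\<psi> \<in> (\<lambda>s x. sp_class S (s x) (unit_vec \<epsilon>)) ` lagrangian_sections S \<omega> c"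
      using \<psi> gen_killing_iff[OF \<epsilon> _ c] by blast
  qed
qed

end

theorem theorem1p1:
  fixes S :: "('m::{t2_space, second_countable_topology}, 'p::{t2_space, second_countable_topology}) spin_data"
    and \<omega> :: "'p \<Rightarrow> real^6 \<Rightarrow> complex^2^2"
    and c :: real
  assumes "idx S \<in> {0, 1}"
    and "spin_structure S"
    and "spin_levi_civita S \<omega>"
    and "c > 0"
  shows "\<exists>(F :: ('m \<Rightarrow> ('p \<times> (complex^2)) set) \<Rightarrow> 'm \<Rightarrow> 'p) (v :: real \<Rightarrow> complex^2).
    (\<forall>\<epsilon>\<in>signs (idx S).
       bij_betw F (gen_killing S \<omega> \<epsilon>) (lagrangian_sections S \<omega> c) \<and>
       herm (idx S) (v \<epsilon>) (v \<epsilon>) = complex_of_real \<epsilon> \<and>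
       (\<forall>\<psi>\<in>gen_killing S \<omega> \<epsilon>. \<forall>x. \<psi> x = sp_class S (F \<psi> x) (v \<epsilon>))) \<and>
    (idx S = 1 \<longrightarrow>
       (\<forall>s\<in>lagrangian_sections S \<omega> c.
          card {\<psi> \<in> gen_killing S \<omega> 1 \<union> gen_killing S \<omega> (-1). F \<psi> = s} = 2))"
proof -
  interpret spin_manifold S \<omega> using assms by unfold_locales
  define L where "L = lagrangian_sections S \<omega> c"
  define \<Psi> where "\<Psi> = (\<lambda>\<epsilon> (s :: 'm \<Rightarrow> 'p) x. sp_class S (s x) (unit_vec \<epsilon>))"
  \<comment> \<open>A single \<open>F\<close> has to invert the correspondence for both signs. The
    case distinction is consistent because no spinor has both; outside the two sets of Killing
    spinors its values are immaterial.\<close>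
  define F where "F = (\<lambda>\<psi>. if \<psi> \<in> gen_killing S \<omega> 1 then inv_into L (\<Psi> 1) \<psi> else inv_into L (\<Psi> (-1)) \<psi>)"
  have bij: "bij_betw (\<Psi> \<epsilon>) L (gen_killing S \<omega> \<epsilon>)" if "\<epsilon> \<in> signs (idx S)" for \<epsilon>
    using bij_betw_sections_spinors[OF that \<open>c > 0\<close>] unfolding \<Psi>_def L_def .
  have signs: "1 \<in> signs (idx S)" "\<epsilon> \<in> signs (idx S) \<Longrightarrow> \<epsilon> = 1 \<or> \<epsilon> = -1" for \<epsilon>
    by (auto simp: signs_def split: if_splits)
  \<comment> \<open>The squares 1 and -1 conflict at any point of M, and a point exists because
    types are inhabited.\<close>
  have disj: "\<psi> \<notin> gen_killing S \<omega> 1" if "\<psi> \<in> gen_killing S \<omega> (-1)" for \<psi>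
  proof
    assume "\<psi> \<in> gen_killing S \<omega> 1"
    then have "sp_herm S (\<psi> x) (\<psi> x) = 1" "sp_herm S (\<psi> x) (\<psi> x) = -1" for x
      using that unfolding gen_killing_def unit_spinor_def by simp_all
    then show False by simp
  qed
  have F: "F \<psi> = inv_into L (\<Psi> \<epsilon>) \<psi>" if "\<epsilon> \<in> signs (idx S)" "\<psi> \<in> gen_killing S \<omega> \<epsilon>" for \<epsilon> \<psi>
    using signs(2)[OF that(1)] that(2) disj unfolding F_def by auto
  have bijF: "bij_betw F (gen_killing S \<omega> \<epsilon>) L" if "\<epsilon> \<in> signs (idx S)" for \<epsilon>
    using bij_betw_inv_into[OF bij[OF that]]
      bij_betw_cong[of "gen_killing S \<omega> \<epsilon>" F "inv_into L (\<Psi> \<epsilon>)", OF F[OF that]] by simp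
  have \<Psi>F: "\<Psi> \<epsilon> (F \<psi>) = \<psi>" if "\<epsilon> \<in> signs (idx S)" "\<psi> \<in> gen_killing S \<omega> \<epsilon>" for \<epsilon> \<psi>
    using bij_betw_inv_into_right[OF bij[OF that(1)] that(2)] F[OF that] by simp
  have F\<Psi>: "F (\<Psi> \<epsilon> s) = s" "\<Psi> \<epsilon> s \<in> gen_killing S \<omega> \<epsilon>"
    if "\<epsilon> \<in> signs (idx S)" "s \<in> L" for \<epsilon> s
  proof -
    show "\<Psi> \<epsilon> s \<in> gen_killing S \<omega> \<epsilon>" using bij_betwE[OF bij[OF that(1)]] that(2) by blast
    then show "F (\<Psi> \<epsilon> s) = s"
      using F[OF that(1)] bij_betw_inv_into_left[OF bij[OF that(1)] that(2)] by simp
  qed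
  have two: "card {\<psi> \<in> gen_killing S \<omega> 1 \<union> gen_killing S \<omega> (-1). F \<psi> = s} = 2"
    if "idx S = 1" and s: "s \<in> L" for s
  proof -
    have m: "-1 \<in> signs (idx S)" using that by (simp add: signs_def)
    \<comment> \<open>Each sign contributes exactly one spinor over \<open>s\<close>, and
      \<open>disj\<close> keeps the two apart.\<close>
    have "{\<psi> \<in> gen_killing S \<omega> 1 \<union> gen_killing S \<omega> (-1). F \<psi> = s} = {\<Psi> 1 s, \<Psi> (-1) s}"
    proof (intro equalityI subsetI)
      fix \<psi> assume "\<psi> \<in> {\<psi> \<in> gen_killing S \<omega> 1 \<union> gen_killing S \<omega> (-1). F \<psi> = s}"
      then have "\<psi> \<in> gen_killing S \<omega> 1 \<or> \<psi> \<in> gen_killing S \<omega> (-1)" and "F \<psi> = s" by auto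
      then show "\<psi> \<in> {\<Psi> 1 s, \<Psi> (-1) s}" using \<Psi>F[OF signs(1), of \<psi>] \<Psi>F[OF m, of \<psi>] by auto
    qed (use F\<Psi>[OF signs(1) s] F\<Psi>[OF m s] in auto)
    moreover have "\<Psi> 1 s \<noteq> \<Psi> (-1) s"
      using F\<Psi>(2)[OF signs(1) s] F\<Psi>(2)[OF m s] disj by metis
    ultimately show ?thesis by simp
  qed
  show ?thesis
  proof (intro exI[of _ F] exI[of _ unit_vec] conjI ballI impI allI)
    fix \<epsilon> assume \<epsilon>: "\<epsilon> \<in> signs (idx S)"
    show "bij_betw F (gen_killing S \<omega> \<epsilon>) (lagrangian_sections S \<omega> c)"
      using bijF[OF \<epsilon>] unfolding L_def .
    show "herm (idx S) (unit_vec \<epsilon>) (unit_vec \<epsilon>) = complex_of_real \<epsilon>"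
      by (rule herm_unit_vec[OF idx \<epsilon>])
    show "\<psi> x = sp_class S (F \<psi> x) (unit_vec \<epsilon>)" if "\<psi> \<in> gen_killing S \<omega> \<epsilon>" for \<psi> x
      using fun_cong[OF \<Psi>F[OF \<epsilon> that], of x] unfolding \<Psi>_def by simp
  next
    show "card {\<psi> \<in> gen_killing S \<omega> 1 \<union> gen_killing S \<omega> (-1). F \<psi> = s} = 2"
      if "idx S = 1" "s \<in> lagrangian_sections S \<omega> c" for s
      using two that unfolding L_def by blast
  qed
qed

end
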